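(* Let $a:\mathbb{R}\to\mathbb{R}$ be a measurable function (not necessarily continuous) for which there are constants $A_0\ge a_0>0$ with $A_0\ge a(x)\ge a_0$ for a.e. $x\in\mathbb{R}$. Then there exists a unique solution $\varphi\in\dot H^1(\mathbb{R})$ of $$\partial_x(a(x)\partial_x\varphi)+a(x)\sin\varphi\cos\varphi=0\quad\text{in }\mathbb{R}\setminus\{0\}$$ under the constraints $$\varphi(0)=0\quad\text{and}\quad\varphi(\pm\infty)=\pm\frac{\pi}{2}$$ that satisfies $-\frac{\pi}{2}\le\varphi(-x)\le 0\le\varphi(x)\le\frac{\pi}{2}$ for every $x>0$. This solution $\varphi$ is Lipschitz and increasing in $\mathbb{R}$, $a(x)\partial_x\varphi\in W^{1,\infty}(\mathbb{R}\setminus\{0\})$ is positive, and $\varphi$ is the unique minimizer of $$\min\Big\{G(\phi)\,:\,\phi(0)=0\ \text{ and }\ \phi(\pm\infty)=\pm\frac{\pi}{2}\Big\},\qquad G(\phi)=\int_{\mathbb{R}}\Big(a(x)(\partial_x\phi)^2+a(x)\cos^2\phi\Big)\,dx .$$ Furthermore, if $a$ is even in $\mathbb{R}$ and non-decreasing in $\mathbb{R}_+=(0,+\infty)$, then $\varphi$ is an odd stable solution of $\partial_x(a(x)\partial_x\varphi)+a(x)\sin\varphi\cos\varphi=0$ in the entire $\mathbb{R}$, i.e., for every $\eta\in H^1(\mathbb{R})$, $$Q(\eta)=\frac12\frac{d^2}{dt^2}\bigg|_{t=0}G(\varphi+t\eta)=\int_{\mathbb{R}}\Big(a(x)(\partial_x\eta)^2-a(x)\cos(2\varphi(x))\,\eta^2\Big)\,dx\ge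 0 .$$
   Context: $\dot H^1(\mathbb{R})$ is the set of functions $\phi\in H^1_{loc}(\mathbb{R})$ with $\partial_x\phi\in L^2(\mathbb{R})$, identified with their continuous representatives. Competitors in the minimization problem are functions $\phi:\mathbb{R}\to\mathbb{R}$ in $H^1_{loc}(\mathbb{R})$ satisfying the stated constraints, with $G(\phi)\in[0,+\infty]$. The notation $\varphi(\pm\infty)=\pm\frac\pi2$ means $\lim_{x\to+\infty}\varphi(x)=\frac\pi2$ and $\lim_{x\to-\infty}\varphi(x)=-\frac\pi2$. The differential equations are understood in the sense of distributions on the indicated open set. The functional $G$ equals $F\big((\sin\phi,\cos\phi,0)\big)$, where $F(m)=\int_{\mathbb{R}}\big(a(x)|\partial_x m|^2+a(x)(m_2^2+m_3^2)\big)\,dx$ for $m=(m_1,m_2,m_3):\mathbb{R}\to\mathbb{S}^2$. *)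

theory Defs
  imports "HOL-Analysis.Analysis"
begin

text \<open>
  Functions are honest functions \<^typ>\<open>real \<Rightarrow> real\<close>, and all integrals are taken with respect
  to Lebesgue measure. Except where continuity is imposed explicitly, the function spaces below
  are closed under modification on null sets.
\<close>

definition test_functions :: "real set \<Rightarrow> (real \<Rightarrow> real) set" where
  "test_functions U =
     {\<psi>. (\<forall>n x. ((deriv ^^ n) \<psi>) differentiable (at x)) \<and>
         compact (closure {x. \<psi> x \<noteq> 0}) \<and> closure {x. \<psi> x \<noteq> 0} \<subseteq> U}"

definition L1_loc :: "real set \<Rightarrow> (real \<Rightarrow> real) set" where
  "L1_loc U = {u. \<forall>K. compact K \<and> K \<subseteq> U \<longrightarrow> set_integrable lebesgue K u}"

definition L2 :: "real set \<Rightarrow> (real \<Rightarrow> real) set" where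
  "L2 U = {u. set_borel_measurable lebesgue U u \<and> set_integrable lebesgue U (\<lambda>x. (u x)\<^sup>2)}"

definition L2_loc :: "real set \<Rightarrow> (real \<Rightarrow> real) set" where
  "L2_loc U = {u. \<forall>K. compact K \<and> K \<subseteq> U \<longrightarrow> u \<in> L2 K}"

definition L_infinity :: "real set \<Rightarrow> (real \<Rightarrow> real) set" where
  "L_infinity U =
     {u. set_borel_measurable lebesgue U u \<and>
         (\<exists>C. AE x in lebesgue. x \<in> U \<longrightarrow> \<bar>u x\<bar> \<le> C)}"

definition has_weak_deriv :: "real set \<Rightarrow> (real \<Rightarrow> real) \<Rightarrow> (real \<Rightarrow> real) \<Rightarrow> bool" where
  "has_weak_deriv U u g \<longleftrightarrow>
     u \<in> L1_loc U \<and> g \<in> L1_loc U \<and>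
     (\<forall>\<psi>\<in>test_functions U.
        (LINT x:U|lebesgue. u x * deriv \<psi> x) = - (LINT x:U|lebesgue. g x * \<psi> x))"

text \<open>
  A fixed representative of the weak derivative on the whole line, which is unique up to null sets.
  It is meaningful only for weakly differentiable functions.
\<close>

definition weak_deriv :: "(real \<Rightarrow> real) \<Rightarrow> real \<Rightarrow> real" where
  "weak_deriv u = (SOME g. has_weak_deriv UNIV u g)"

definition H1_loc :: "(real \<Rightarrow> real) set" where
  "H1_loc = {u \<in> L2_loc UNIV. \<exists>g \<in> L2_loc UNIV. has_weak_deriv UNIV u g}"

definition H1 :: "(real \<Rightarrow> real) set" where
  "H1 = {u \<in> L2 UNIV. \<exists>g \<in> L2 UNIV. has_weak_deriv UNIV u g}"

text \<open>Elements of the homogeneous space are identified with their continuous representatives.\<close>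

definition H1_dot :: "(real \<Rightarrow> real) set" where
  "H1_dot = {u \<in> H1_loc. continuous_on UNIV u \<and> weak_deriv u \<in> L2 UNIV}"

definition W1_infinity :: "real set \<Rightarrow> (real \<Rightarrow> real) set" where
  "W1_infinity U = {u \<in> L_infinity U. \<exists>g \<in> L_infinity U. has_weak_deriv U u g}"

text \<open>
  The equation $\partial_x (a\,\partial_x \varphi) + a \sin\varphi \cos\varphi = 0$ in the sense of
  distributions on the open set \<open>U\<close>. For bounded measurable \<open>a\<close> and
  \<open>\<phi> \<in> H1_loc\<close> both integrands are integrable.
\<close>

definition solves_in :: "(real \<Rightarrow> real) \<Rightarrow> real set \<Rightarrow> (real \<Rightarrow> real) \<Rightarrow> bool" where
  "solves_in a U \<phi> \<longleftrightarrow>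
     (\<forall>\<psi>\<in>test_functions U.
        - (LINT x:U|lebesgue. a x * weak_deriv \<phi> x * deriv \<psi> x)
        + (LINT x:U|lebesgue. a x * sin (\<phi> x) * cos (\<phi> x) * \<psi> x) = 0)"

definition wall_constraints :: "(real \<Rightarrow> real) \<Rightarrow> bool" where
  "wall_constraints \<phi> \<longleftrightarrow>
     \<phi> 0 = 0 \<and> (\<phi> \<longlongrightarrow> pi / 2) at_top \<and> (\<phi> \<longlongrightarrow> - (pi / 2)) at_bot"

definition wall_solution :: "(real \<Rightarrow> real) \<Rightarrow> (real \<Rightarrow> real) \<Rightarrow> bool" where
  "wall_solution a \<phi> \<longleftrightarrow>
     \<phi> \<in> H1_dot \<and> solves_in a (- {0}) \<phi> \<and> wall_constraints \<phi> \<and>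
     (\<forall>x>0. - (pi / 2) \<le> \<phi> (- x) \<and> \<phi> (- x) \<le> 0 \<and> 0 \<le> \<phi> x \<and> \<phi> x \<le> pi / 2)"

text \<open>
  The energy takes values in $[0,+\infty]$. For \<open>a \<ge> 0\<close> almost everywhere, the coercion
  \<^const>\<open>ennreal\<close> truncates the integrand only on a null set.
\<close>

definition G :: "(real \<Rightarrow> real) \<Rightarrow> (real \<Rightarrow> real) \<Rightarrow> ennreal" where
  "G a \<phi> =
     (\<integral>\<^sup>+ x. ennreal (a x * (weak_deriv \<phi> x)\<^sup>2 + a x * (cos (\<phi> x))\<^sup>2) \<partial>lebesgue)"

definition competitor :: "(real \<Rightarrow> real) \<Rightarrow> bool" where
  "competitor \<phi> \<longleftrightarrow> \<phi> \<in> H1_loc \<and> continuous_on UNIV \<phi> \<and> wall_constraints \<phi>"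

definition has_second_deriv_at :: "(real \<Rightarrow> real) \<Rightarrow> real \<Rightarrow> real \<Rightarrow> bool" where
  "has_second_deriv_at f D t \<longleftrightarrow>
     (\<exists>f'. (\<forall>\<^sub>F s in nhds t. (f has_real_derivative f' s) (at s)) \<and>
           (f' has_real_derivative D) (at t))"

definition Q_integrand :: "(real \<Rightarrow> real) \<Rightarrow> (real \<Rightarrow> real) \<Rightarrow> (real \<Rightarrow> real) \<Rightarrow> real \<Rightarrow> real" where
  "Q_integrand a \<phi> \<eta> x = a x * (weak_deriv \<eta> x)\<^sup>2 - a x * cos (2 * \<phi> x) * (\<eta> x)\<^sup>2"

end

theory Submission
  imports Defs
begin

text \<open>
  Write the equation on each half line as a system for \<open>\<phi>\<close> and the flux \<open>y = a \<phi>'\<close>, which is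
  Lipschitz continuous even though \<open>a\<close> is only measurable. Along a solution with
  \<open>0 \<le> \<phi> \<le> \<pi>/2\<close> the quantity \<open>y\<^sup>2 + k\<^sup>2 sin\<^sup>2 \<phi>\<close> is monotone whenever \<open>k\<close> bounds \<open>a\<close> from one
  side, which gives \<open>a0 cos \<phi> \<le> y \<le> A0 cos \<phi>\<close>. A solution exists by shooting in the initial flux.

  Minimality and uniqueness come from a calibration: for a competitor \<open>f\<close>,
  \<open>a f'\<^sup>2 + a cos\<^sup>2 f = a \<phi>'\<^sup>2 + a cos\<^sup>2 \<phi> + a sin\<^sup>2 \<phi> ((sin f / sin \<phi>)')\<^sup>2 + a cos\<^sup>2 \<phi> ((cos f / cos \<phi>)')\<^sup>2 + K'\<close>,
  where \<open>K = y (sin\<^sup>2 f cot \<phi> - cos\<^sup>2 f tan \<phi>)\<close> vanishes at \<open>0\<close> and at infinity. Hence every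
  solution minimizes, and equality forces both quotients to be constant.

  If \<open>a\<close> is even and non-decreasing on the right half line, then \<open>y \<ge> a cos \<phi>\<close> there, so that
  \<open>cos \<phi>\<close> is a positive supersolution of the linearized equation and \<open>Q\<close> is nonnegative.
\<close>

section \<open>Absolutely continuous functions\<close>

text \<open>With \<open>a\<close> merely measurable, \<phi> has no useful pointwise derivative and
  classical initial value theory does not apply. Derivatives are therefore densities in integral
  identities over compact intervals (\<open>has_AC_deriv\<close>), and every differential
  computation rests on a chain and a product rule for these. The constraint at \<open>0\<close>
  decouples the two half lines, and the flux may jump there; each side is solved alone, the left one
  after reflection. The calibration arises by viewing (sin f, cos f) as a unit vector. Let \<lambda>
  be the energy density of \<phi>. Then w = sin \<phi> satisfies (a w')' + \<lambda> w = 0 and w =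
  cos \<phi> satisfies (a w')' + \<lambda> w = a w. Picone's identity, applied to each component
  with its positive w, produces the two squares, and the multiplier contributes \<lambda> (sin^2 f +
  cos^2 f) = \<lambda>, exactly the density being compared. The obstacle is that cot \<phi> and tan
  \<phi> blow up at the two ends. At \<open>0\<close> finite energy gives f^2 = o(x), and at
  infinity y <= A0 cos \<phi> keeps y tan \<phi> bounded. The latter bound also prevents \<phi> from
  reaching \<pi>/2 at a finite point.\<close>

definition has_AC_deriv :: "(real \<Rightarrow> real) \<Rightarrow> (real \<Rightarrow> real) \<Rightarrow> real set \<Rightarrow> bool" where
  "has_AC_deriv u g S \<longleftrightarrow>
     (\<forall>c d. c \<le> d \<longrightarrow> {c..d} \<subseteq> S \<longrightarrow>
        g absolutely_integrable_on {c..d} \<and> integral {c..d} g = u d - u c)"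

lemma has_AC_derivD:
  assumes "has_AC_deriv u g S" "c \<le> d" "{c..d} \<subseteq> S"
  shows "g absolutely_integrable_on {c..d}" "g integrable_on {c..d}" "integral {c..d} g = u d - u c"
  using assms unfolding has_AC_deriv_def
  by (blast intro: absolutely_integrable_on_def[THEN iffD1, THEN conjunct1])+

lemma has_AC_deriv_subset: "has_AC_deriv u g S \<Longrightarrow> T \<subseteq> S \<Longrightarrow> has_AC_deriv u g T"
  unfolding has_AC_deriv_def by blast

lemma has_AC_deriv_imp_continuous_Icc:
  assumes "has_AC_deriv u g S" "{c..d} \<subseteq> S"
  shows "continuous_on {c..d} u"
proof (cases "c \<le> d")
  case True
  have "continuous_on {c..d} (\<lambda>x. u c + integral {c..x} g)"
    by (intro continuous_intros indefinite_integral_continuous_1 has_AC_derivD[OF assms(1) True assms(2)])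
  moreover have "u c + integral {c..x} g = u x" if "x \<in> {c..d}" for x
    using has_AC_derivD(3)[OF assms(1), of c x] that assms(2) by fastforce
  ultimately show ?thesis using continuous_on_cong[OF refl, of "{c..d}" "\<lambda>x. u c + integral {c..x} g" u] by blast
qed auto

lemma has_AC_deriv_imp_continuous:
  assumes "has_AC_deriv u g S" "S = UNIV \<or> S = {0..}"
  shows "continuous_on S u"
  unfolding continuous_on_eq_continuous_within
proof
  fix x assume x: "x \<in> S"
  have *: "S \<inter> {x - 1..x + 1} = {(if S = UNIV then x - 1 else max 0 (x - 1))..x+1}"
    using assms(2)
  proof
    assume S: "S = {0..}"
    then have "S \<noteq> UNIV" by (metis UNIV_I atLeast_iff neg_0_le_iff_le not_one_le_zero)
    then show ?thesis using S by auto
  qed simp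
  have "continuous_on (S \<inter> {x - 1..x + 1}) u"
    using has_AC_deriv_imp_continuous_Icc[OF assms(1)] * by (metis inf_le1)
  then have "continuous (at x within (S \<inter> {x - 1..x + 1})) u"
    using x by (auto simp: continuous_on_eq_continuous_within)
  moreover have "at x within (S \<inter> {x - 1..x + 1}) = at x within S"
    by (rule at_within_nhd[of _ "{x-1<..<x+1}"]) auto
  ultimately show "continuous (at x within S) u" by simp
qed

lemma has_AC_deriv_cong:
  assumes "has_AC_deriv u g S" "\<And>x. x \<in> S \<Longrightarrow> u x = v x" "\<And>x. x \<in> S \<Longrightarrow> g x = h x"
  shows "has_AC_deriv v h S"
  unfolding has_AC_deriv_def
proof (intro allI impI)
  fix c d :: real assume cd: "c \<le> d" "{c..d} \<subseteq> S"
  have e: "g x = h x" if "x \<in> {c..d}" for x using assms(3) cd that by auto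
  have "h absolutely_integrable_on {c..d}"
    using has_AC_derivD(1)[OF assms(1) cd] e by (metis set_integrable_cong)
  moreover have "integral {c..d} h = v d - v c"
  proof -
    have "integral {c..d} h = integral {c..d} g" using e by (intro integral_cong) auto
    moreover have "u d = v d" "u c = v c" using assms(2) cd by auto
    ultimately show ?thesis using has_AC_derivD(3)[OF assms(1) cd] by simp
  qed
  ultimately show "h absolutely_integrable_on {c..d} \<and> integral {c..d} h = v d - v c" ..
qed

lemma has_AC_deriv_cong_AE:
  assumes "has_AC_deriv u g S" "AE x in lebesgue. x \<in> S \<longrightarrow> g x = h x"
  shows "has_AC_deriv u h S"
  unfolding has_AC_deriv_def
proof (intro allI impI)
  fix c d :: real assume cd: "c \<le> d" "{c..d} \<subseteq> S"
  obtain N where N: "negligible N" "{x. \<not> (x \<in> S \<longrightarrow> g x = h x)} \<subseteq> N"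
    using assms(2) unfolding eventually_ae_filter_negligible by blast
  have e: "h x = g x" if "x \<in> {c..d} - N" for x 
  proof -
    have "x \<notin> {x. \<not> (x \<in> S \<longrightarrow> g x = h x)}" using N(2) that by blast
    then show ?thesis using that cd by auto
  qed
  show "h absolutely_integrable_on {c..d} \<and> integral {c..d} h = u d - u c"
    using has_AC_derivD(1,3)[OF assms(1) cd] absolutely_integrable_spike[where f = g and g = h and T = "{c..d}", OF _ N(1)]
      integral_spike[where f = g and g = h and T = "{c..d}", OF N(1)] e by auto
qed

lemma has_AC_deriv_add:
  assumes "has_AC_deriv u g S" "has_AC_deriv v h S"
  shows "has_AC_deriv (\<lambda>x. u x + v x) (\<lambda>x. g x + h x) S"
  using assms unfolding has_AC_deriv_def
  by (auto simp: integral_add absolutely_integrable_on_def[THEN iffD1, THEN conjunct1] intro: set_integral_add)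

lemma has_AC_deriv_cmult:
  assumes "has_AC_deriv u g S"
  shows "has_AC_deriv (\<lambda>x. k * u x) (\<lambda>x. k * g x) S"
  using assms unfolding has_AC_deriv_def
  by (auto simp: right_diff_distrib)

lemma has_AC_deriv_const: "has_AC_deriv (\<lambda>x. k) (\<lambda>x. 0) S"
  unfolding has_AC_deriv_def by auto

lemma has_AC_deriv_minus:
  assumes "has_AC_deriv u g S"
  shows "has_AC_deriv (\<lambda>x. - u x) (\<lambda>x. - g x) S"
  using has_AC_deriv_cmult[OF assms, of "-1"] by simp

lemma has_AC_deriv_diff:
  assumes "has_AC_deriv u g S" "has_AC_deriv v h S"
  shows "has_AC_deriv (\<lambda>x. u x - v x) (\<lambda>x. g x - h x) S"
  using has_AC_deriv_add[OF assms(1) has_AC_deriv_minus[OF assms(2)]] by simp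

text \<open>The odd reflection is the right one here: it turns the left half of a wall, rising from
  -\<pi>/2 to 0, into a right half rising from 0 to \<pi>/2, and it leaves the sign of the density
  unchanged.\<close>

lemma has_AC_deriv_reflect:
  assumes "has_AC_deriv u g S"
  shows "has_AC_deriv (\<lambda>x. - u (- x)) (\<lambda>x. g (- x)) (uminus ` S)"
  unfolding has_AC_deriv_def
proof (intro allI impI)
  fix c d :: real assume cd: "c \<le> d" "{c..d} \<subseteq> uminus ` S"
  have cd': "-d \<le> -c" "{-d..-c} \<subseteq> S"
  proof -
    show "{-d..-c} \<subseteq> S"
    proof
      fix x assume "x \<in> {-d..-c}"
      then have "- x \<in> uminus ` S" using cd by auto
      then show "x \<in> S" by auto
    qed
  qed (use cd in simp)
  show "(\<lambda>x. g (- x)) absolutely_integrable_on {c..d} \<and> integral {c..d} (\<lambda>x. g (- x)) = - u (- d) - - u (- c)"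
    using has_AC_derivD(1,3)[OF assms cd'] absolutely_integrable_reflect_real[where f = g and a = "-d" and b = "-c"]
      Henstock_Kurzweil_Integration.integral_reflect_real[where f = g and a = "-d" and b = "-c"]
    by simp
qed

lemma has_AC_deriv_C1:
  assumes "\<And>x. x \<in> S \<Longrightarrow> (f has_real_derivative f' x) (at x within S)" "continuous_on S f'"
  shows "has_AC_deriv f f' S"
  unfolding has_AC_deriv_def
proof (intro allI impI)
  fix c d :: real assume cd: "c \<le> d" "{c..d} \<subseteq> S"
  have "(f' has_integral f d - f c) {c..d}"
    by (rule fundamental_theorem_of_calculus[OF cd(1)])
      (use assms cd in \<open>auto simp: has_real_derivative_iff_has_vector_derivative[symmetric] subset_eq intro!: DERIV_subset[OF _ cd(2)]\<close>)
  then show "f' absolutely_integrable_on {c..d} \<and> integral {c..d} f' = f d - f c"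
    using absolutely_integrable_continuous_real continuous_on_subset[OF assms(2) cd(2)] by blast
qed

text \<open>Telescoping over a uniform partition bounds the total increment of \<open>H\<close> by
  \<open>e\<close> times that of \<open>M\<close>, and \<open>e\<close> is arbitrary. In the chain
  rule, where \<open>M\<close> is the primitive of the absolute value of the density, this takes the
  place of differentiating almost everywhere.\<close>

lemma small_increments_imp_eq:
  fixes H M :: "real \<Rightarrow> real"
  assumes "c \<le> d"
    and small: "\<And>e. e > 0 \<Longrightarrow> \<exists>\<delta>>0. \<forall>x y. c \<le> x \<longrightarrow> x \<le> y \<longrightarrow> y \<le> d \<longrightarrow> y - x < \<delta> \<longrightarrow>
                   \<bar>H y - H x\<bar> \<le> e * (M y - M x)"
  shows "H d = H c"
proof -
  have *: "\<bar>H d - H c\<bar> \<le> e * (M d - M c)" if e: "e > 0" for e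
  proof -
    obtain \<delta> where \<delta>: "\<delta> > 0" "\<And>x y. c \<le> x \<Longrightarrow> x \<le> y \<Longrightarrow> y \<le> d \<Longrightarrow> y - x < \<delta> \<Longrightarrow> \<bar>H y - H x\<bar> \<le> e * (M y - M x)"
      using small[OF e] by blast
    obtain N :: nat where N: "(d - c) / \<delta> < real N" using reals_Archimedean2 by blast
    have N0: "0 < real N" using N \<open>c \<le> d\<close> \<delta>(1)
      by (smt (verit, best) divide_nonneg_pos)
    define t where "t i = c + real i * ((d - c) / real N)" for i :: nat
    have st: "(d - c) / real N < \<delta>" using N N0 \<delta>(1) by (simp add: field_simps)
    have nn: "0 \<le> (d - c) / real N" using \<open>c \<le> d\<close> N0 by simp
    have "\<bar>H (t i) - H c\<bar> \<le> e * (M (t i) - M c)" if "i \<le> N" for i using that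
    proof (induction i)
      case 0 then show ?case by (simp add: t_def)
    next
      case (Suc i)
      have "real (Suc i) * ((d - c) / real N) \<le> real N * ((d - c) / real N)"
        using Suc.prems nn by (intro mult_right_mono) auto
      then have "t (Suc i) \<le> d" using N0 by (simp add: t_def)
      moreover have "t (Suc i) - t i = (d - c) / real N" using distrib_right[of "real i" 1 "(d - c) / real N"] by (simp add: t_def add.commute)
      moreover have "c \<le> t i" using mult_nonneg_nonneg[OF of_nat_0_le_iff nn] by (simp add: t_def)
      ultimately have "\<bar>H (t (Suc i)) - H (t i)\<bar> \<le> e * (M (t (Suc i)) - M (t i))"
        using \<delta>(2)[of "t i" "t (Suc i)"] st nn by linarith
      then show ?case using Suc by (simp add: right_diff_distrib)
    qed
    from this[of N] show ?thesis using N0 by (simp add: t_def)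
  qed
  have "((\<lambda>e. e * (M d - M c)) \<longlongrightarrow> 0 * (M d - M c)) (at_right 0)"
    by (intro tendsto_intros)
  then have "\<bar>H d - H c\<bar> \<le> 0 * (M d - M c)"
    by (rule tendsto_lowerbound) (use * in \<open>auto simp: eventually_at_filter\<close>)
  then show ?thesis by simp
qed

lemma absolutely_integrable_continuous_mult:
  fixes g h :: "real \<Rightarrow> real"
  assumes "continuous_on {c..d} h" "g absolutely_integrable_on {c..d}"
  shows "(\<lambda>x. h x * g x) absolutely_integrable_on {c..d}"
  using assms
  by (intro absolutely_integrable_bounded_measurable_product_real)
    (auto simp: continuous_imp_measurable_on_sets_lebesgue intro: compact_imp_bounded compact_continuous_image)

text \<open>On a short interval the increment of \<open>f\<close> along \<open>u\<close> is
  \<open>f'\<close> at a mean value point times the integral of \<open>g\<close>; by uniform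
  continuity of \<open>f'\<close> along \<open>u\<close> it differs from the claimed integral by at
  most \<open>e\<close> times the integral of the absolute value of \<open>g\<close>. Convexity of
  \<open>T\<close> keeps the segment between two values of \<open>u\<close> inside the domain of
  \<open>f\<close>.\<close>

lemma has_AC_deriv_chain:
  assumes u: "has_AC_deriv u g S"
    and T: "\<And>x. x \<in> S \<Longrightarrow> u x \<in> T" "convex T"
    and f: "\<And>t. t \<in> T \<Longrightarrow> (f has_real_derivative f' t) (at t within T)" "continuous_on T f'"
  shows "has_AC_deriv (\<lambda>x. f (u x)) (\<lambda>x. f' (u x) * g x) S"
  unfolding has_AC_deriv_def
proof (intro allI impI)
  fix c d :: real assume cd: "c \<le> d" "{c..d} \<subseteq> S"
  have uc: "continuous_on {c..d} u" using has_AC_deriv_imp_continuous_Icc[OF u cd(2)] .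
  have fc: "continuous_on {c..d} (\<lambda>x. f' (u x))"
    by (rule continuous_on_compose2[OF f(2) uc]) (use T cd in auto)
  have g: "g absolutely_integrable_on {c..d}" using has_AC_derivD[OF u cd] by simp
  have G: "(\<lambda>x. f' (u x) * g x) absolutely_integrable_on {c..d}"
    by (rule absolutely_integrable_continuous_mult[OF fc g])
  define H where "H x = f (u x) - integral {c..x} (\<lambda>x. f' (u x) * g x)" for x
  define M where "M x = integral {c..x} (\<lambda>x. \<bar>g x\<bar>)" for x
  have ag: "(\<lambda>x. \<bar>g x\<bar>) integrable_on {c..d}" using g by (simp add: absolutely_integrable_on_def)
  have "H d = H c"
  proof (rule small_increments_imp_eq[OF cd(1), of H M])
    fix e :: real assume e: "e > 0"
    have "uniformly_continuous_on {c..d} (\<lambda>x. f' (u x))"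
      using fc compact_uniformly_continuous by blast
    then obtain \<delta> where \<delta>: "\<delta> > 0"
       "\<And>x y. x \<in> {c..d} \<Longrightarrow> y \<in> {c..d} \<Longrightarrow> dist y x < \<delta> \<Longrightarrow> dist (f' (u y)) (f' (u x)) < e"
      unfolding uniformly_continuous_on_def using e by metis
    have "\<bar>H y - H x\<bar> \<le> e * (M y - M x)" if xy: "c \<le> x" "x \<le> y" "y \<le> d" "y - x < \<delta>" for x y
    proof -
      have sub: "{x..y} \<subseteq> {c..d}" using xy by auto
      have gi: "g absolutely_integrable_on {x..y}" and gi': "g integrable_on {x..y}"
        and gu: "integral {x..y} g = u y - u x"
        using has_AC_derivD[OF u xy(2)] subset_trans[OF sub cd(2)] by auto
      have Gi: "(\<lambda>x. f' (u x) * g x) integrable_on {x..y}"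
        using absolutely_integrable_on_subinterval[OF G sub] by (simp add: absolutely_integrable_on_def)
      have agi: "(\<lambda>x. \<bar>g x\<bar>) integrable_on {x..y}" using gi by (simp add: absolutely_integrable_on_def)
      have conv: "closed_segment (u x) (u y) \<subseteq> T"
        using T xy subsetD[OF cd(2)] by (intro closed_segment_subset) auto
      obtain xi where xi: "xi \<in> closed_segment (u x) (u y)" "f (u y) - f (u x) = f' xi * (u y - u x)"
      proof -
        have D: "(f has_derivative (\<lambda>h. f' t * h)) (at t within {p..q})"
          if "p \<le> t" "t \<le> q" "{p..q} \<subseteq> T" for t p q
          using has_field_derivative_subset[OF f(1) that(3)] that
          unfolding has_field_derivative_def by fastforce
        show thesis
        proof (cases "u x \<le> u y")
          case True
          have "{u x..u y} \<subseteq> T" using conv True by (simp add: closed_segment_eq_real_ivl)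
          then obtain z where "z \<in> {u x..u y}" "f (u y) - f (u x) = f' z * (u y - u x)"
            using mvt_very_simple[OF True, of f "\<lambda>t h. f' t * h", OF D] by blast
          then show ?thesis using that True by (auto simp: closed_segment_eq_real_ivl)
        next
          case False
          then have "{u y..u x} \<subseteq> T" "u y \<le> u x" using conv by (simp_all add: closed_segment_eq_real_ivl)
          then obtain z where "z \<in> {u y..u x}" "f (u x) - f (u y) = f' z * (u x - u y)"
            using mvt_very_simple[of "u y" "u x" f "\<lambda>t h. f' t * h", OF _ D] by blast
          moreover have "f' z * (u y - u x) = - (f' z * (u x - u y))" by (simp add: right_diff_distrib)
          ultimately show ?thesis using that[of z] False by (simp add: closed_segment_eq_real_ivl)
        qed
      qed
      \<comment> \<open>The mean value point \<open>xi\<close> is itself a value \<open>u s\<close>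
        with \<open>s\<close> in the short interval, so the modulus of continuity of
        \<open>f'\<close> along \<open>u\<close> applies to it.\<close>
      have "connected (u ` {x..y})"
        by (rule connected_continuous_image[OF continuous_on_subset[OF uc sub]]) simp
      then have "closed_segment (u x) (u y) \<subseteq> u ` {x..y}"
        using xy(2) by (intro closed_segment_subset) (auto simp: connected_convex_1)
      then obtain s where s: "s \<in> {x..y}" "xi = u s" using xi(1) by auto
      have split: "integral {c..y} F = integral {c..x} F + integral {x..y} F" if "F integrable_on {c..d}" for F :: "real \<Rightarrow> real"
        using Henstock_Kurzweil_Integration.integral_combine[of c x y F] xy
          integrable_subinterval_real[OF that, of c y] by auto
      have "H y - H x = f' (u s) * integral {x..y} g - integral {x..y} (\<lambda>x. f' (u x) * g x)"
        using split[of "\<lambda>x. f' (u x) * g x"] G xi(2) s(2) gu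
        by (simp add: H_def absolutely_integrable_on_def)
      also have "\<dots> = integral {x..y} (\<lambda>t. f' (u s) * g t - f' (u t) * g t)"
      proof -
        have A: "(\<lambda>t. f' (u s) * g t) integrable_on {x..y}"
          using integrable_cmul[OF gi', of "f' (u s)"] by (simp only: real_scaleR_def)
        show ?thesis
          by (simp only: Henstock_Kurzweil_Integration.integral_diff[OF A Gi] Henstock_Kurzweil_Integration.integral_mult_right)
      qed
      also have "\<bar>\<dots>\<bar> \<le> integral {x..y} (\<lambda>t. e * \<bar>g t\<bar>)"
      proof -
        have "norm (integral {x..y} (\<lambda>t. f' (u s) * g t - f' (u t) * g t)) \<le> integral {x..y} (\<lambda>t. e * \<bar>g t\<bar>)"
        proof (rule integral_norm_bound_integral)
          show "(\<lambda>t. f' (u s) * g t - f' (u t) * g t) integrable_on {x..y}"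
            using integrable_diff[OF integrable_cmul[OF gi', of "f' (u s)"] Gi] by (simp only: real_scaleR_def)
          show "(\<lambda>t. e * \<bar>g t\<bar>) integrable_on {x..y}"
            using integrable_cmul[OF agi, of e] by (simp only: real_scaleR_def)
          fix t assume t: "t \<in> {x..y}"
          have "\<bar>f' (u s) - f' (u t)\<bar> \<le> e"
          proof -
            have "\<bar>s - t\<bar> < \<delta>" using t s(1) xy(4) by auto
            then show ?thesis using \<delta>(2)[of t s] t s(1) xy by (auto simp: dist_real_def)
          qed
          then show "norm (f' (u s) * g t - f' (u t) * g t) \<le> e * \<bar>g t\<bar>"
            by (simp add: left_diff_distrib[symmetric] abs_mult mult_right_mono)
        qed
        then show ?thesis by simp
      qed
      also have "\<dots> = e * (M y - M x)"
        using split[OF ag] by (simp add: M_def)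
      finally show ?thesis .
    qed
    then show "\<exists>\<delta>>0. \<forall>x y. c \<le> x \<longrightarrow> x \<le> y \<longrightarrow> y \<le> d \<longrightarrow> y - x < \<delta> \<longrightarrow> \<bar>H y - H x\<bar> \<le> e * (M y - M x)"
      using \<delta>(1) by blast
  qed
  then show "(\<lambda>x. f' (u x) * g x) absolutely_integrable_on {c..d} \<and> integral {c..d} (\<lambda>x. f' (u x) * g x) = f (u d) - f (u c)"
    using G by (simp add: H_def)
qed

text \<open>By polarization a product is a difference of two squares, so the chain rule for squaring
  is enough.\<close>

lemma has_AC_deriv_mult:
  assumes u: "has_AC_deriv u g S" and v: "has_AC_deriv v h S"
  shows "has_AC_deriv (\<lambda>x. u x * v x) (\<lambda>x. g x * v x + u x * h x) S"
proof -
  have sq: "has_AC_deriv (\<lambda>x. (w x)\<^sup>2) (\<lambda>x. 2 * w x * k x) S" if "has_AC_deriv w k S" for w k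
    by (rule has_AC_deriv_chain[OF that, where T = UNIV])
      (auto intro!: derivative_eq_intros continuous_intros)
  have "has_AC_deriv (\<lambda>x. (1/4) * ((u x + v x)\<^sup>2 - (u x - v x)\<^sup>2))
     (\<lambda>x. (1/4) * (2 * (u x + v x) * (g x + h x) - 2 * (u x - v x) * (g x - h x))) S"
    by (intro has_AC_deriv_cmult has_AC_deriv_diff sq has_AC_deriv_add u v)
  then show ?thesis
    by (rule has_AC_deriv_cong) (auto simp: power2_eq_square algebra_simps)
qed


section \<open>Test functions and the du Bois-Reymond lemma\<close>

text \<open>The classical flat function exp(-1/x), divided by a power of x. Up to linear
  combinations this family is closed under differentiation, so that a single limit settles all
  derivatives at \<open>0\<close>.\<close>

definition flat :: "nat \<Rightarrow> real \<Rightarrow> real" where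
  "flat k x = (if x > 0 then exp (- (1 / x)) / x ^ k else 0)"

lemma flat_nonpos [simp]: "x \<le> 0 \<Longrightarrow> flat k x = 0"
  by (simp add: flat_def)

lemma tendsto_flat_0: "((\<lambda>x. flat k x) \<longlongrightarrow> 0) (at 0)"
proof (rule filterlim_split_at_real)
  have "((\<lambda>x. 0::real) \<longlongrightarrow> 0) (at_left 0)" by simp
  then show "((\<lambda>x. flat k x) \<longlongrightarrow> 0) (at_left 0)"
    by (rule Lim_transform_eventually) (auto simp: eventually_at_filter)
  have "((\<lambda>x. (inverse x) ^ k / exp (inverse x)) \<longlongrightarrow> (0::real)) (at_right 0)"
    by (rule filterlim_compose[OF tendsto_power_div_exp_0 filterlim_inverse_at_top_right])
  then show "((\<lambda>x. flat k x) \<longlongrightarrow> 0) (at_right 0)"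
    by (rule Lim_transform_eventually)
      (auto simp: eventually_at_filter flat_def exp_minus field_simps power_inverse)
qed

lemma flat_has_real_derivative:
  "(flat k has_real_derivative flat (k + 2) x - real k * flat (k + 1) x) (at x)"
proof -
  consider "x > 0" | "x < 0" | "x = 0" by linarith
  then show ?thesis
  proof cases
    case 1
    have "((\<lambda>x. exp (- (1 / x)) / x ^ k) has_real_derivative
       (exp (- (1/x)) * (1 / x\<^sup>2) * x ^ k - exp (- (1/x)) * (real k * x ^ (k - 1))) / (x ^ k * x ^ k)) (at x)"
      using 1 by (auto intro!: derivative_eq_intros simp: power2_eq_square field_simps)
    moreover have "(exp (- (1/x)) * (1 / x\<^sup>2) * x ^ k - exp (- (1/x)) * (real k * x ^ (k - 1))) / (x ^ k * x ^ k)
       = flat (k + 2) x - real k * flat (k + 1) x"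
    proof (cases k)
      case (Suc m)
      then show ?thesis using 1 by (simp add: flat_def field_simps power2_eq_square)
    qed (use 1 in \<open>simp add: flat_def power2_eq_square\<close>)
    ultimately have "((\<lambda>x. exp (- (1 / x)) / x ^ k) has_real_derivative flat (k + 2) x - real k * flat (k + 1) x) (at x)"
      by simp
    then show ?thesis
      by (rule has_field_derivative_transform_within_open[where S = "{0<..}"]) (use 1 in \<open>auto simp: flat_def\<close>)
  next
    case 2
    have "((\<lambda>x. 0) has_real_derivative flat (k + 2) x - real k * flat (k + 1) x) (at x)" using 2 by simp
    then show ?thesis
      by (rule has_field_derivative_transform_within_open[where S = "{..<0}"]) (use 2 in \<open>auto simp: flat_def\<close>)
  next
    case 3
    \<comment> \<open>The difference quotient of \<open>flat k\<close> at \<open>0\<close> is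
      \<open>flat (Suc k)\<close>, which tends to zero.\<close>
    have "((\<lambda>h. (flat k (0 + h) - flat k 0) / h) \<longlongrightarrow> 0) (at 0)"
      by (rule Lim_transform_eventually[OF tendsto_flat_0[of "Suc k"]])
        (auto simp: eventually_at_filter flat_def field_simps)
    then show ?thesis using 3 by (simp add: DERIV_def)
  qed
qed

lemma flat_bounds: "0 \<le> flat 0 x" "flat 0 x \<le> 1"
  by (auto simp: flat_def)

text \<open>A class generated so as to be closed under differentiation: smoothness of every order
  follows by induction, without formulas for higher derivatives. The clause \<open>primitive\<close>
  is there for test functions obtained by integrating a difference of bumps.\<close>

inductive smooth_family :: "(real \<Rightarrow> real) \<Rightarrow> bool" where
  flat: "smooth_family (\<lambda>x. flat k (p * x + q))"
| add: "smooth_family f \<Longrightarrow> smooth_family g \<Longrightarrow> smooth_family (\<lambda>x. f x + g x)"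
| mult: "smooth_family f \<Longrightarrow> smooth_family g \<Longrightarrow> smooth_family (\<lambda>x. f x * g x)"
| cmult: "smooth_family f \<Longrightarrow> smooth_family (\<lambda>x. c * f x)"
| primitive: "smooth_family f \<Longrightarrow> (\<And>x. (F has_real_derivative f x) (at x)) \<Longrightarrow> smooth_family F"

lemmas smooth_family_intros = smooth_family.flat smooth_family.add smooth_family.mult smooth_family.cmult

lemma smooth_family_has_deriv:
  assumes "smooth_family f"
  shows "\<exists>f'. smooth_family f' \<and> (\<forall>x. (f has_real_derivative f' x) (at x))"
  using assms
proof induction
  case (flat k p q)
  have "((\<lambda>x. flat k (p * x + q)) has_real_derivative
      (flat (k + 2) (p * x + q) - real k * flat (k + 1) (p * x + q)) * p) (at x)" for x
    by (rule DERIV_chain'[OF _ flat_has_real_derivative]) (auto intro!: derivative_eq_intros)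
  moreover have "(flat (k + 2) (p * x + q) - real k * flat (k + 1) (p * x + q)) * p =
      p * flat (k + 2) (p * x + q) + (- real k * p) * flat (k + 1) (p * x + q)" for x
    by (simp add: left_diff_distrib)
  ultimately have "((\<lambda>x. flat k (p * x + q)) has_real_derivative
      p * flat (k + 2) (p * x + q) + (- real k * p) * flat (k + 1) (p * x + q)) (at x)" for x
    by metis
  moreover have "smooth_family (\<lambda>x. p * flat (k + 2) (p * x + q) + (- real k * p) * flat (k + 1) (p * x + q))"
    by (intro smooth_family_intros)
  ultimately show ?case by blast
next
  case (add f g)
  then obtain f' g' where "smooth_family f'" "\<forall>x. (f has_real_derivative f' x) (at x)"
    "smooth_family g'" "\<forall>x. (g has_real_derivative g' x) (at x)" by blast
  then show ?case
    by (intro exI[of _ "\<lambda>x. f' x + g' x"]) (auto intro!: smooth_family_intros derivative_eq_intros)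
next
  case (mult f g)
  then obtain f' g' where "smooth_family f'" "\<forall>x. (f has_real_derivative f' x) (at x)"
    "smooth_family g'" "\<forall>x. (g has_real_derivative g' x) (at x)" by blast
  with mult show ?case
    by (intro exI[of _ "\<lambda>x. f' x * g x + f x * g' x"])
      (auto intro!: smooth_family.add smooth_family.mult derivative_eq_intros)
next
  case (cmult f c)
  then obtain f' where "smooth_family f'" "\<forall>x. (f has_real_derivative f' x) (at x)" by blast
  then show ?case
    by (intro exI[of _ "\<lambda>x. c * f' x"]) (auto intro!: smooth_family_intros derivative_eq_intros)
qed blast

lemma smooth_family_continuous: "smooth_family f \<Longrightarrow> continuous_on S f"
  by (meson DERIV_isCont continuous_at_imp_continuous_on smooth_family_has_deriv)

lemma smooth_family_iterated_deriv: "smooth_family f \<Longrightarrow> smooth_family ((deriv ^^ n) f)"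
proof (induction n)
  case (Suc n)
  then obtain f' where f': "smooth_family f'" "\<forall>x. ((deriv ^^ n) f has_real_derivative f' x) (at x)"
    using smooth_family_has_deriv by blast
  then have "deriv ((deriv ^^ n) f) = f'" by (auto intro: DERIV_imp_deriv)
  with f' show ?case by simp
qed simp

lemma smooth_family_test_function:
  assumes "smooth_family f" "\<And>x. x \<notin> {p..q} \<Longrightarrow> f x = 0" "{p..q} \<subseteq> U"
  shows "f \<in> test_functions U"
proof -
  have "(deriv ^^ n) f differentiable (at x)" for n x
    using smooth_family_has_deriv[OF smooth_family_iterated_deriv[OF assms(1)]]
    by (meson real_differentiable_def)
  moreover have sub: "closure {x. f x \<noteq> 0} \<subseteq> {p..q}"
    using assms(2) by (intro closure_minimal) (blast, simp)
  moreover have "compact (closure {x. f x \<noteq> 0})"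
    using sub by (meson bounded_closed_interval bounded_subset closed_closure compact_eq_bounded_closed)
  ultimately show ?thesis using assms(3) by (auto simp: test_functions_def)
qed

lemma test_functions_mono: "U \<subseteq> V \<Longrightarrow> test_functions U \<subseteq> test_functions V"
  by (auto simp: test_functions_def)

lemma test_functions_has_deriv:
  assumes "\<psi> \<in> test_functions U"
  shows "(\<psi> has_real_derivative deriv \<psi> x) (at x)" "continuous_on S (deriv \<psi>)"
proof -
  have "(deriv ^^ n) \<psi> differentiable (at x)" for n x
    using assms by (auto simp: test_functions_def)
  from this[of 0] this[of 1] show "(\<psi> has_real_derivative deriv \<psi> x) (at x)" "continuous_on S (deriv \<psi>)"
    by (auto simp: DERIV_deriv_iff_real_differentiable continuous_at_imp_continuous_on differentiable_imp_continuous_within)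
qed

lemma test_functions_eq_0:
  assumes "\<psi> \<in> test_functions U" "x \<notin> closure {x. \<psi> x \<noteq> 0}"
  shows "\<psi> x = 0" "deriv \<psi> x = 0"
proof -
  show "\<psi> x = 0" using assms(2) closure_subset[of "{x. \<psi> x \<noteq> 0}"] by auto
  have "((\<lambda>x. 0) has_real_derivative 0) (at x)" by simp
  then have "(\<psi> has_real_derivative 0) (at x)"
    by (rule has_field_derivative_transform_within_open[where S = "- closure {x. \<psi> x \<noteq> 0}"])
      (use assms(2) closure_subset[of "{x. \<psi> x \<noteq> 0}"] in auto)
  then show "deriv \<psi> x = 0" by (rule DERIV_imp_deriv)
qed

lemma test_functions_outside:
  assumes "\<psi> \<in> test_functions U" "x \<notin> U"
  shows "\<psi> x = 0" "deriv \<psi> x = 0"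
  using test_functions_eq_0[OF assms(1)] assms unfolding test_functions_def by blast+

lemma test_functions_support:
  assumes "\<psi> \<in> test_functions U"
  obtains m where "m > 0" "\<forall>x. \<bar>x\<bar> \<ge> m \<longrightarrow> \<psi> x = 0 \<and> deriv \<psi> x = 0"
proof -
  have "bounded (closure {x. \<psi> x \<noteq> 0})" using assms compact_imp_bounded by (auto simp: test_functions_def)
  then obtain m where m: "\<And>x. x \<in> closure {x. \<psi> x \<noteq> 0} \<Longrightarrow> \<bar>x\<bar> \<le> m"
    unfolding bounded_iff real_norm_def by blast
  have "x \<notin> closure {x. \<psi> x \<noteq> 0}" if "\<bar>x\<bar> \<ge> max m 0 + 1" for x
    using m[of x] that by fastforce
  then have "\<psi> x = 0" "deriv \<psi> x = 0" if "\<bar>x\<bar> \<ge> max m 0 + 1" for x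
    using test_functions_eq_0[OF assms] that by blast+
  moreover have "max m 0 + 1 > 0" by simp
  ultimately show thesis using that by blast
qed

lemma test_functions_AC: "\<psi> \<in> test_functions U \<Longrightarrow> has_AC_deriv \<psi> (deriv \<psi>) S"
  by (rule has_AC_deriv_C1) (auto intro: test_functions_has_deriv has_field_derivative_at_within)

lemma LINT_eq_integral_Icc:
  fixes f :: "real \<Rightarrow> real"
  assumes "\<And>x. x \<in> U \<Longrightarrow> x \<notin> {p..q} \<Longrightarrow> f x = 0" "\<And>x. x \<in> {p..q} \<Longrightarrow> x \<notin> U \<Longrightarrow> f x = 0"
    "f absolutely_integrable_on {p..q}"
  shows "(LINT x:U|lebesgue. f x) = integral {p..q} f"
proof -
  have "(LINT x:U|lebesgue. f x) = (LINT x:{p..q}|lebesgue. f x)"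
    unfolding set_lebesgue_integral_def
    by (rule Bochner_Integration.integral_cong) (use assms(1,2) in \<open>auto simp: indicator_def\<close>)
  with set_lebesgue_integral_eq_integral(2)[OF assms(3)] show ?thesis by simp
qed

text \<open>\<open>b2\<close> is a translate of the bump \<open>b1\<close>, so both have the same
  mass, and the primitive of their difference returns to zero to the right of both supports.\<close>

lemma smooth_primitive_of_difference:
  fixes b1 b2 :: "real \<Rightarrow> real"
  assumes sm: "smooth_family b1" "smooth_family b2"
    and supp: "\<And>x. x \<notin> {c..c+h} \<Longrightarrow> b1 x = 0" "\<And>x. b2 x = b1 (x - (d - c))"
    and cd: "c < d" "h > 0"
  obtains \<psi> where "smooth_family \<psi>" "\<And>x. x \<notin> {c..d+h} \<Longrightarrow> \<psi> x = 0"
    "\<And>x. (\<psi> has_real_derivative b1 x - b2 x) (at x)"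
proof
  define G where "G x = b1 x - b2 x" for x
  \<comment> \<open>Starting at \<open>c-1\<close>, to the left of both supports, makes
    \<open>c\<close> an interior point when the primitive is differentiated.\<close>
  define \<psi> where "\<psi> x = integral {c-1..x} G" for x
  have "smooth_family (\<lambda>x. b1 x + (-1) * b2 x)" by (intro smooth_family_intros sm)
  then have G: "smooth_family G" by (simp add: G_def[abs_def])
  note Gc = smooth_family_continuous[OF G]
  have b2: "b2 x = 0" if "x \<notin> {d..d+h}" for x
    using that supp(1)[of "x - (d - c)"] supp(2)[of x] by auto
  have zero: "\<psi> x = 0" if "x \<le> c" for x
  proof -
    have *: "G t = 0" if "t \<in> {c-1..x} - {c}" for t
      using that \<open>x \<le> c\<close> supp(1)[of t] b2[of t] cd by (auto simp: G_def)
    have "integral {c-1..x} G = integral {c-1..x} (\<lambda>x. 0)"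
      by (rule integral_spike[of "{c}"]) (use * in auto)
    then show ?thesis by (simp add: \<psi>_def)
  qed
  show D: "(\<psi> has_real_derivative b1 x - b2 x) (at x)" for x
  proof (cases "x < c")
    case True
    have "((\<lambda>x. 0) has_real_derivative 0) (at x)" by simp
    then have "(\<psi> has_real_derivative 0) (at x)"
      by (rule has_field_derivative_transform_within_open[where S = "{..<c}"]) (use True zero in auto)
    then show ?thesis using True supp(1)[of x] b2[of x] cd by simp
  next
    case False
    have "(\<psi> has_real_derivative G x) (at x within {c-1..x+1})"
      unfolding \<psi>_def by (rule integral_has_real_derivative[OF Gc]) (use False in auto)
    then show ?thesis using False by (simp add: G_def at_within_Icc_at)
  qed
  then show "smooth_family \<psi>" using smooth_family.primitive[OF G, of \<psi>] by (simp add: G_def)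
  show "\<psi> x = 0" if x: "x \<notin> {c..d+h}" for x
  proof (cases "x \<le> c")
    case False
    then have xd: "x > d + h" using x by auto
    have i1: "b1 integrable_on {p..q}" "b2 integrable_on {p..q}" for p q
      using smooth_family_continuous sm integrable_continuous_real by blast+
    have I1: "integral {c-1..x} b1 = integral {c..c+h} b1"
      by (intro integral_unique has_integral_on_superset[OF integrable_integral[OF i1(1)]])
        (use xd cd supp(1) in auto)
    have "integral {c-1..x} b2 = integral {d..d+h} b2"
      by (intro integral_unique has_integral_on_superset[OF integrable_integral[OF i1(2)]])
        (use xd cd b2 in auto)
    also have "\<dots> = integral {c..c+h} (\<lambda>x. b2 (x + (d - c)))"
      using integral_shift_Icc_real[of c "c + h" b2 "d - c"] by (simp add: comp_def add.commute)
    also have "\<dots> = integral {c..c+h} b1" by (simp add: supp(2))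
    finally show ?thesis 
      using I1 Henstock_Kurzweil_Integration.integral_diff[OF i1]
      by (simp add: \<psi>_def G_def[abs_def])
  qed (rule zero)
qed

section \<open>The du Bois-Reymond lemma, by sharpening bumps to indicators\<close>

lemma tendsto_flat_scaled:
  "x > 0 \<Longrightarrow> (\<lambda>n. flat 0 (real (Suc n) * x)) \<longlonglongrightarrow> 1"
proof -
  assume x: "x > 0"
  have "(\<lambda>n. exp (- ((1 / x) * inverse (real (Suc n))))) \<longlonglongrightarrow> exp (- ((1 / x) * 0))"
    by (intro tendsto_intros LIMSEQ_inverse_real_of_nat)
  moreover have "exp (- ((1 / x) * inverse (real (Suc n)))) = flat 0 (real (Suc n) * x)" for n
  proof -
    have "(1 / x) * inverse (real (Suc n)) = 1 / (real (Suc n) * x)" by (simp add: divide_inverse)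
    moreover have "real (Suc n) * x > 0" using x by simp
    ultimately show ?thesis unfolding flat_def by simp
  qed
  ultimately show ?thesis by simp
qed

text \<open>Testing with the primitive of a difference of two translated bumps shows that
  \<open>w\<close> has equal integrals against both bumps. Letting the bumps tend to indicators,
  with the absolute value of \<open>w\<close> as majorant, gives equal integrals over both
  intervals.\<close>

lemma du_Bois_Reymond_averages:
  assumes w: "\<And>p q. w absolutely_integrable_on {p..q}"
    and test: "\<And>\<psi>. \<psi> \<in> test_functions U \<Longrightarrow> (LINT x:U|lebesgue. w x * deriv \<psi> x) = 0"
    and cd: "c < d" "h > 0" "{c..d+h} \<subseteq> U"
  shows "integral {c..c+h} w = integral {d..d+h} w"
proof -
  \<comment> \<open>A smooth bump with values between 0 and 1 that vanishes outside the open
    interval from \<open>p\<close> to \<open>p + h\<close> and tends pointwise to its indicator as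
    \<open>n\<close> grows.\<close>
  define b where "b n p x = flat 0 (real (Suc n) * (x - p)) * flat 0 (real (Suc n) * (p + h - x))" for n p x
  have sm: "smooth_family (b n p)" for n p
  proof -
    have "smooth_family (\<lambda>x. flat 0 (real (Suc n) * x + - real (Suc n) * p) *
       flat 0 (- real (Suc n) * x + real (Suc n) * (p + h)))"
      by (intro smooth_family_intros)
    then show ?thesis by (simp add: b_def[abs_def] algebra_simps)
  qed
  have b0: "b n p x = 0" if "x \<notin> {p<..<p+h}" for n p x
    using that by (auto simp: b_def mult_nonneg_nonpos)
  have b_le: "0 \<le> b n p x" "b n p x \<le> 1" for n p x
    unfolding b_def by (intro mult_nonneg_nonneg mult_le_one flat_bounds)+
  have b_lim: "(\<lambda>n. b n p x) \<longlonglongrightarrow> indicator {p<..<p+h} x" for p x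
  proof (cases "x \<in> {p<..<p+h}")
    case True
    then have "(\<lambda>n. b n p x) \<longlonglongrightarrow> 1 * 1"
      unfolding b_def by (intro tendsto_mult tendsto_flat_scaled) auto
    then show ?thesis using True by simp
  qed (simp add: b0)
  have wi: "(\<lambda>x. w x * (b n c x - b n d x)) absolutely_integrable_on {c..d+h}" for n
    using absolutely_integrable_continuous_mult[OF _ w, of c "d + h" "\<lambda>x. b n c x - b n d x"]
    by (simp add: mult.commute continuous_on_diff smooth_family_continuous sm)
  have zero: "integral {c..d+h} (\<lambda>x. w x * (b n c x - b n d x)) = 0" for n
  proof -
    have supp: "b n c x = 0" if "x \<notin> {c..c+h}" for x
      by (rule b0) (use that in auto)
    have shift: "b n d x = b n c (x - (d - c))" for x
    proof -
      have "x - d = x - (d - c) - c" "d + h - x = c + h - (x - (d - c))" by auto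
      then show ?thesis by (simp only: b_def)
    qed
    obtain \<psi> where \<psi>: "smooth_family \<psi>" "\<And>x. x \<notin> {c..d+h} \<Longrightarrow> \<psi> x = 0"
      "\<And>x. (\<psi> has_real_derivative b n c x - b n d x) (at x)"
      using smooth_primitive_of_difference[of "b n c" "b n d" c h d, OF sm sm supp shift cd(1,2)] by metis
    have "deriv \<psi> = (\<lambda>x. b n c x - b n d x)" using \<psi>(3) by (auto intro: DERIV_imp_deriv)
    then have "0 = (LINT x:U|lebesgue. w x * (b n c x - b n d x))"
      using test[OF smooth_family_test_function[OF \<psi>(1,2) cd(3)]] by simp
    also have "\<dots> = integral {c..d+h} (\<lambda>x. w x * (b n c x - b n d x))"
      by (rule LINT_eq_integral_Icc[OF _ _ wi]) (use cd b0 in auto)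
    finally show ?thesis ..
  qed
  have "(\<lambda>n. integral {c..d+h} (\<lambda>x. w x * (b n c x - b n d x))) \<longlonglongrightarrow>
     integral {c..d+h} (\<lambda>x. w x * (indicator {c<..<c+h} x - indicator {d<..<d+h} x))"
  proof (rule dominated_convergence[where h = "\<lambda>x. \<bar>w x\<bar>"])
    show "(\<lambda>x. w x * (b n c x - b n d x)) integrable_on {c..d+h}" for n
      using wi[of n] by (simp add: absolutely_integrable_on_def)
    show "(\<lambda>x. \<bar>w x\<bar>) integrable_on {c..d+h}" using w by (simp add: absolutely_integrable_on_def)
    show "norm (w x * (b n c x - b n d x)) \<le> \<bar>w x\<bar>" for n x
    proof -
      have "\<bar>b n c x - b n d x\<bar> \<le> 1" using b_le[of n c x] b_le[of n d x] by linarith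
      then show ?thesis by (simp add: abs_mult mult_left_le)
    qed
    show "(\<lambda>n. w x * (b n c x - b n d x)) \<longlonglongrightarrow> w x * (indicator {c<..<c+h} x - indicator {d<..<d+h} x)" for x
      by (intro tendsto_intros b_lim)
  qed
  then have *: "integral {c..d+h} (\<lambda>x. w x * (indicator {c<..<c+h} x - indicator {d<..<d+h} x)) = 0"
    using zero by (simp add: LIMSEQ_const_iff)
  have I: "((\<lambda>x. w x * indicator {p<..<p+h} x) has_integral integral {p..p+h} w) {c..d+h}"
    if "c \<le> p" "p \<le> d" for p
  proof -
    have "w integrable_on {p..p+h}" using w by (simp add: absolutely_integrable_on_def)
    then have "(w has_integral integral {p..p+h} w) {p<..<p+h}"
      using has_integral_Icc_iff_Ioo by blast
    then have "((\<lambda>x. if x \<in> {p<..<p+h} then w x else 0) has_integral integral {p..p+h} w) {c..d+h}"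
      by (rule has_integral_restrict[THEN iffD2, rotated]) (use that in auto)
    moreover have "(\<lambda>x. if x \<in> {p<..<p+h} then w x else 0) = (\<lambda>x. w x * indicator {p<..<p+h} x)"
      by (auto simp: indicator_def)
    ultimately show ?thesis by metis
  qed
  have "((\<lambda>x. w x * indicator {c<..<c+h} x - w x * indicator {d<..<d+h} x) has_integral
     integral {c..c+h} w - integral {d..d+h} w) {c..d+h}"
    by (rule has_integral_diff) (use I cd in auto)
  then show ?thesis using * by (simp add: right_diff_distrib integral_unique)
qed

text \<open>Lebesgue's differentiation theorem for averages to the right of a point, with the
  exceptional null set made explicit so that it can be removed once for all points.\<close>

lemma eventually_integral_average:
  assumes "\<And>p q. w absolutely_integrable_on {p..q}"
  obtains N where "negligible N"
    "\<And>x e. x \<notin> N \<Longrightarrow> 0 < e \<Longrightarrow> \<exists>d>0. \<forall>h. 0 < h \<and> h < d \<longrightarrow> \<bar>integral {x..x+h} w / h - w x\<bar> < (e::real)"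
proof -
  show thesis
  proof (rule integrable_ccontinuous_explicit[of w])
    show "w integrable_on cbox p q" for p q using assms by (simp add: absolutely_integrable_on_def)
    fix N
    assume N: "negligible N" "\<And>x e. \<lbrakk>x \<notin> N; 0 < e\<rbrakk> \<Longrightarrow> \<exists>d>0. \<forall>h. 0 < h \<and> h < d \<longrightarrow>
      norm (integral (cbox x (x + h *\<^sub>R One)) w /\<^sub>R h ^ DIM(real) - w x) < e"
    show thesis
    proof (rule that[OF N(1)])
      fix x e :: real assume "x \<notin> N" "0 < e"
      from N(2)[OF this] show "\<exists>d>0. \<forall>h. 0 < h \<and> h < d \<longrightarrow> \<bar>integral {x..x+h} w / h - w x\<bar> < e"
        by (simp add: divide_inverse mult.commute)
    qed
  qed
qed

text \<open>At two Lebesgue points the averages of \<open>w\<close> over short intervals of equal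
  length agree, hence so do the values. Convexity of \<open>U\<close> keeps the interval between the
  two points inside \<open>U\<close>.\<close>

lemma du_Bois_Reymond:
  assumes w: "\<And>p q. w absolutely_integrable_on {p..q}"
    and U: "open U" "convex U"
    and test: "\<And>\<psi>. \<psi> \<in> test_functions U \<Longrightarrow> (LINT x:U|lebesgue. w x * deriv \<psi> x) = 0"
  shows "\<exists>C. AE x in lebesgue. x \<in> U \<longrightarrow> w x = (C::real)"
proof -
  obtain N where N: "negligible N"
    "\<And>x e. x \<notin> N \<Longrightarrow> 0 < e \<Longrightarrow> \<exists>d>0. \<forall>h. 0 < h \<and> h < d \<longrightarrow> \<bar>integral {x..x+h} w / h - w x\<bar> < e"
    using eventually_integral_average[OF w] by blast
  have less: "w x = w y" if xy: "x \<in> U - N" "y \<in> U - N" "x < y" for x y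
  proof (rule ccontr)
    assume "w x \<noteq> w y"
    define e where "e = \<bar>w x - w y\<bar> / 2"
    have e: "e > 0" using \<open>w x \<noteq> w y\<close> by (simp add: e_def)
    obtain dx where dx: "dx > 0" "\<And>h. 0 < h \<Longrightarrow> h < dx \<Longrightarrow> \<bar>integral {x..x+h} w / h - w x\<bar> < e"
      using N(2)[of x e] xy e by blast
    obtain dy where dy: "dy > 0" "\<And>h. 0 < h \<Longrightarrow> h < dy \<Longrightarrow> \<bar>integral {y..y+h} w / h - w y\<bar> < e"
      using N(2)[of y e] xy e by blast
    obtain r where r: "r > 0" "cball y r \<subseteq> U" using U(1) xy open_contains_cball by (metis DiffD1)
    define h where "h = min (min dx dy) r / 2"
    have h: "0 < h" "h < dx" "h < dy" "h < r" using dx dy r by (auto simp: h_def)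
    have "y + h \<in> U" using r h by (auto simp: dist_real_def)
    then have "{x..y+h} \<subseteq> U"
      using closed_segment_subset[of x U "y + h"] U(2) xy h by (simp add: closed_segment_eq_real_ivl)
    then have "integral {x..x+h} w = integral {y..y+h} w"
      by (intro du_Bois_Reymond_averages[OF w test]) (use xy h in auto)
    then show False using dx(2)[of h] dy(2)[of h] h by (simp add: e_def) argo
  qed
  have "\<exists>C. \<forall>x\<in>U - N. w x = C"
    by (metis less linorder_neqE)
  then show ?thesis
    using N(1) unfolding eventually_ae_filter_negligible by blast
qed

lemma AE_eq_0_if_integrals_eq_0:
  fixes f :: "real \<Rightarrow> real"
  assumes f: "\<And>p q. f absolutely_integrable_on {p..q}" and S: "open S"
    and zero: "\<And>c d. c \<le> d \<Longrightarrow> {c..d} \<subseteq> S \<Longrightarrow> integral {c..d} f = 0"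
  shows "AE x in lebesgue. x \<in> S \<longrightarrow> f x = 0"
proof -
  obtain N where N: "negligible N"
    "\<And>x e. x \<notin> N \<Longrightarrow> 0 < e \<Longrightarrow> \<exists>d>0. \<forall>h. 0 < h \<and> h < d \<longrightarrow> \<bar>integral {x..x+h} f / h - f x\<bar> < e"
    using eventually_integral_average[OF f] by blast
  have "f x = 0" if x: "x \<in> S" "x \<notin> N" for x
  proof (rule ccontr)
    assume "f x \<noteq> 0"
    then obtain d where d: "d > 0" "\<And>h. 0 < h \<Longrightarrow> h < d \<Longrightarrow> \<bar>integral {x..x+h} f / h - f x\<bar> < \<bar>f x\<bar>"
      using N(2)[of x "\<bar>f x\<bar>"] x by auto
    obtain r where r: "r > 0" "cball x r \<subseteq> S" using S x open_contains_cball by metis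
    define h where "h = min d r / 2"
    have h: "0 < h" "h < d" "h < r" using d r by (auto simp: h_def)
    have "{x..x+h} \<subseteq> S" using r h by (auto simp: subset_eq dist_real_def)
    then show False using zero[of x "x + h"] d(2)[of h] h by simp
  qed
  then show ?thesis
    using N(1) unfolding eventually_ae_filter_negligible by blast
qed


section \<open>Weak derivatives\<close>

lemma AC_primitive_exists:
  assumes g: "\<And>p q. g absolutely_integrable_on {p..q}"
  obtains v where "has_AC_deriv v g UNIV"
proof
  have i: "g integrable_on {p..q}" for p q using g by (simp add: absolutely_integrable_on_def)
  \<comment> \<open>For reversed endpoints the interval is empty, so at least one of the two
    integrals vanishes and the formula covers both signs of \<open>x\<close>.\<close>
  define v where "v x = integral {0..x} g - integral {x..0} g" for x
  have "integral {c..d} g = v d - v c" if "c \<le> d" for c d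
  proof -
    consider "0 \<le> c" | "d \<le> 0" | "c < 0" "0 < d" by linarith
    then show ?thesis
    proof cases
      case 1
      then show ?thesis
        using Henstock_Kurzweil_Integration.integral_combine[OF 1 that i] that
        by (cases "c = 0"; cases "d = 0") (auto simp: v_def)
    next
      case 2
      then show ?thesis
        using Henstock_Kurzweil_Integration.integral_combine[OF that 2 i] that
        by (cases "c = 0"; cases "d = 0") (auto simp: v_def)
    next
      case 3
      then show ?thesis
        using Henstock_Kurzweil_Integration.integral_combine[of c 0 d, OF _ _ i]
        by (auto simp: v_def)
    qed
  qed
  then show "has_AC_deriv v g UNIV" using g by (simp add: has_AC_deriv_def)
qed

lemma L1_loc_UNIV_iff: "u \<in> L1_loc UNIV \<longleftrightarrow> (\<forall>p q. u absolutely_integrable_on {p..q})"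
proof
  assume R: "\<forall>p q. u absolutely_integrable_on {p..q}"
  have "u absolutely_integrable_on K" if K: "compact K" for K
  proof -
    obtain m where "\<forall>x\<in>K. \<bar>x\<bar> \<le> m" using compact_imp_bounded[OF K] by (auto simp: bounded_real)
    then have "K \<subseteq> {-m..m}" by (auto simp: abs_le_iff)
    then show ?thesis
      using set_integrable_subset[OF R[rule_format, of "-m" m]] lmeasurable_compact[OF K] by blast
  qed
  then show "u \<in> L1_loc UNIV" by (simp add: L1_loc_def)
qed (auto simp: L1_loc_def)

lemma locally_integrable_imp_measurable:
  fixes f :: "real \<Rightarrow> real"
  assumes "\<And>p q. f absolutely_integrable_on {p..q}"
  shows "f \<in> borel_measurable lebesgue"
proof (rule borel_measurable_LIMSEQ_real)
  show "(\<lambda>x. indicator {- real n..real n} x *\<^sub>R f x) \<in> borel_measurable lebesgue" for n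
    using assms[of "- real n" "real n"] unfolding set_integrable_def by (rule borel_measurable_integrable)
  show "(\<lambda>n. indicator {- real n..real n} x *\<^sub>R f x) \<longlonglongrightarrow> f x" for x
  proof -
    obtain n0 :: nat where n0: "\<bar>x\<bar> \<le> real n0" using real_arch_simple by blast
    have "\<forall>\<^sub>F n in sequentially. indicator {- real n..real n} x *\<^sub>R f x = f x"
      using eventually_ge_at_top[of n0]
    proof eventually_elim
      case (elim n)
      then have "\<bar>x\<bar> \<le> real n" using n0 by linarith
      then show ?case by (auto simp: indicator_def)
    qed
    then show ?thesis by (simp add: tendsto_eventually)
  qed
qed

lemma AC_by_parts:
  assumes "has_AC_deriv u g {c..d}" "has_AC_deriv v h {c..d}" "c \<le> d"
  shows "(\<lambda>x. g x * v x) absolutely_integrable_on {c..d}"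
    "(\<lambda>x. u x * h x) absolutely_integrable_on {c..d}"
    "integral {c..d} (\<lambda>x. u x * h x) = u d * v d - u c * v c - integral {c..d} (\<lambda>x. g x * v x)"
proof -
  have cont: "continuous_on {c..d} u" "continuous_on {c..d} v"
    using has_AC_deriv_imp_continuous_Icc assms by blast+
  have "(\<lambda>x. v x * g x) absolutely_integrable_on {c..d}"
    by (rule absolutely_integrable_continuous_mult[OF cont(2) has_AC_derivD(1)[OF assms(1,3)]]) simp
  then show 1: "(\<lambda>x. g x * v x) absolutely_integrable_on {c..d}" by (simp add: mult.commute)
  show 2: "(\<lambda>x. u x * h x) absolutely_integrable_on {c..d}"
    by (rule absolutely_integrable_continuous_mult[OF cont(1) has_AC_derivD(1)[OF assms(2,3)]]) simp
  have "integral {c..d} (\<lambda>x. g x * v x + u x * h x) = u d * v d - u c * v c"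
    using has_AC_derivD(3)[OF has_AC_deriv_mult[OF assms(1,2)] assms(3)] by simp
  moreover have "integral {c..d} (\<lambda>x. g x * v x + u x * h x)
      = integral {c..d} (\<lambda>x. g x * v x) + integral {c..d} (\<lambda>x. u x * h x)"
    using 1 2 by (intro Henstock_Kurzweil_Integration.integral_add) (auto simp: absolutely_integrable_on_def)
  ultimately show "integral {c..d} (\<lambda>x. u x * h x) = u d * v d - u c * v c - integral {c..d} (\<lambda>x. g x * v x)"
    by simp
qed

lemma test_LINT_eq_integral:
  assumes \<psi>: "\<psi> \<in> test_functions U"
    and m: "\<forall>x. \<bar>x\<bar> \<ge> m \<longrightarrow> \<psi> x = 0 \<and> deriv \<psi> x = 0"
    and f: "f absolutely_integrable_on {-m..m}"
  shows "(LINT x:U|lebesgue. f x * \<psi> x) = integral {-m..m} (\<lambda>x. f x * \<psi> x)"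
    "(LINT x:U|lebesgue. f x * deriv \<psi> x) = integral {-m..m} (\<lambda>x. f x * deriv \<psi> x)"
    "(\<lambda>x. f x * \<psi> x) absolutely_integrable_on {-m..m}"
    "(\<lambda>x. f x * deriv \<psi> x) absolutely_integrable_on {-m..m}"
proof -
  have "continuous_on {-m..m} \<psi>"
    using test_functions_has_deriv(1)[OF \<psi>] by (meson DERIV_isCont continuous_at_imp_continuous_on)
  from absolutely_integrable_continuous_mult[OF this f]
  show 1: "(\<lambda>x. f x * \<psi> x) absolutely_integrable_on {-m..m}" by (simp add: mult.commute)
  from absolutely_integrable_continuous_mult[OF test_functions_has_deriv(2)[OF \<psi>] f]
  show 2: "(\<lambda>x. f x * deriv \<psi> x) absolutely_integrable_on {-m..m}" by (simp add: mult.commute)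
  have "\<bar>x\<bar> \<ge> m" if "x \<notin> {-m..m}" for x using that by auto
  then show "(LINT x:U|lebesgue. f x * \<psi> x) = integral {-m..m} (\<lambda>x. f x * \<psi> x)"
    "(LINT x:U|lebesgue. f x * deriv \<psi> x) = integral {-m..m} (\<lambda>x. f x * deriv \<psi> x)"
    using 1 2 m test_functions_outside[OF \<psi>] by (intro LINT_eq_integral_Icc; simp)+
qed

text \<open>Subtracting a primitive of \<open>g\<close> from \<open>f\<close> leaves a function
  whose weak derivative on \<open>U\<close> is zero, hence a constant there. The primitive lives on
  the whole line, so it also provides a value at a boundary point of \<open>U\<close>; this is how
  the flux acquires one-sided values at \<open>0\<close>.\<close>

lemma weak_equation_imp_AC:
  assumes f: "\<And>p q. f absolutely_integrable_on {p..q}" and g: "\<And>p q. g absolutely_integrable_on {p..q}"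
    and U: "open U" "convex U"
    and weak: "\<And>\<psi>. \<psi> \<in> test_functions U \<Longrightarrow>
      (LINT x:U|lebesgue. f x * deriv \<psi> x) = - (LINT x:U|lebesgue. g x * \<psi> x)"
  obtains v where "has_AC_deriv v g UNIV" "AE x in lebesgue. x \<in> U \<longrightarrow> f x = v x"
proof -
  obtain v where v: "has_AC_deriv v g UNIV" using AC_primitive_exists[OF g] by blast
  have vi: "v absolutely_integrable_on {p..q}" for p q
    using has_AC_deriv_imp_continuous[OF v] by (intro absolutely_integrable_continuous_real) (auto intro: continuous_on_subset)
  have "\<exists>C. AE x in lebesgue. x \<in> U \<longrightarrow> f x - v x = C"
  proof (rule du_Bois_Reymond[OF _ U])
    show wi: "(\<lambda>x. f x - v x) absolutely_integrable_on {p..q}" for p q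
      using f vi by (rule set_integral_diff)
    fix \<psi> assume \<psi>: "\<psi> \<in> test_functions U"
    obtain m where m: "m > 0" "\<forall>x. \<bar>x\<bar> \<ge> m \<longrightarrow> \<psi> x = 0 \<and> deriv \<psi> x = 0"
      using test_functions_support[OF \<psi>] by metis
    note L = test_LINT_eq_integral[OF \<psi> m(2)]
    have V: "integral {-m..m} (\<lambda>x. v x * deriv \<psi> x) = - integral {-m..m} (\<lambda>x. g x * \<psi> x)"
      using AC_by_parts(3)[OF has_AC_deriv_subset[OF v] test_functions_AC[OF \<psi>], of "-m" m] m by simp
    have "(LINT x:U|lebesgue. (f x - v x) * deriv \<psi> x) = integral {-m..m} (\<lambda>x. (f x - v x) * deriv \<psi> x)"
      by (rule L(2)[OF wi])
    also have "\<dots> = integral {-m..m} (\<lambda>x. f x * deriv \<psi> x) - integral {-m..m} (\<lambda>x. v x * deriv \<psi> x)"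
      unfolding left_diff_distrib
      using L(4)[OF f] L(4)[OF vi] by (intro Henstock_Kurzweil_Integration.integral_diff) (auto simp: absolutely_integrable_on_def)
    also have "\<dots> = 0" using V weak[OF \<psi>] L(1)[OF g] L(2)[OF f] by simp
    finally show "(LINT x:U|lebesgue. (f x - v x) * deriv \<psi> x) = 0" .
  qed
  then obtain C where C: "AE x in lebesgue. x \<in> U \<longrightarrow> f x - v x = C" by blast
  have "has_AC_deriv (\<lambda>x. v x + C) g UNIV"
    using has_AC_deriv_add[OF v has_AC_deriv_const[of C]] by simp
  moreover have "AE x in lebesgue. x \<in> U \<longrightarrow> f x = v x + C" using C by eventually_elim auto
  ultimately show thesis by (rule that)
qed

lemma has_AC_deriv_locally_integrable:
  "has_AC_deriv u g UNIV \<Longrightarrow> g absolutely_integrable_on {p..q}"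
  by (cases "p \<le> q") (auto simp: has_AC_deriv_def)

lemma has_AC_deriv_self_integrable:
  "has_AC_deriv u g UNIV \<Longrightarrow> u absolutely_integrable_on {p..q}"
  using has_AC_deriv_imp_continuous[of u g UNIV]
  by (intro absolutely_integrable_continuous_real) (auto intro: continuous_on_subset)

lemma has_AC_deriv_imp_has_weak_deriv:
  assumes u: "has_AC_deriv u g UNIV"
  shows "has_weak_deriv UNIV u g"
  unfolding has_weak_deriv_def L1_loc_UNIV_iff
proof (intro conjI allI ballI)
  note ui = has_AC_deriv_self_integrable[OF u] and gi = has_AC_deriv_locally_integrable[OF u]
  show "u absolutely_integrable_on {p..q}" "g absolutely_integrable_on {p..q}" for p q
    using ui gi by auto
  fix \<psi> assume \<psi>: "\<psi> \<in> test_functions UNIV"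
  obtain m where m: "m > 0" "\<forall>x. \<bar>x\<bar> \<ge> m \<longrightarrow> \<psi> x = 0 \<and> deriv \<psi> x = 0"
    using test_functions_support[OF \<psi>] by metis
  show "(LINT x:UNIV|lebesgue. u x * deriv \<psi> x) = - (LINT x:UNIV|lebesgue. g x * \<psi> x)"
    using AC_by_parts(3)[OF has_AC_deriv_subset[OF u] test_functions_AC[OF \<psi>], of "-m" m] m
      test_LINT_eq_integral(2)[OF \<psi> m(2) ui] test_LINT_eq_integral(1)[OF \<psi> m(2) gi] by simp
qed

lemma has_weak_deriv_imp_AC:
  assumes "has_weak_deriv UNIV u g"
  obtains v where "has_AC_deriv v g UNIV" "AE x in lebesgue. u x = v x"
proof -
  have "u absolutely_integrable_on {p..q}" "g absolutely_integrable_on {p..q}" for p q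
    using assms by (auto simp: has_weak_deriv_def L1_loc_UNIV_iff)
  then show thesis
    by (rule weak_equation_imp_AC[of u g UNIV])
      (use assms that in \<open>auto simp: has_weak_deriv_def\<close>)
qed

lemma continuous_AE_eq_imp_eq:
  fixes u v :: "real \<Rightarrow> real"
  assumes "continuous_on S u" "continuous_on S v" "open S" "AE x in lebesgue. x \<in> S \<longrightarrow> u x = v x" "x \<in> S"
  shows "u x = v x"
proof (rule ccontr)
  assume "u x \<noteq> v x"
  have "open {x \<in> S. u x - v x \<in> - {0}}"
    using continuous_open_preimage[OF continuous_on_diff[OF assms(1,2)] assms(3), of "- {0}"]
      open_Compl[OF closed_singleton[of 0]]
    by (simp only: vimage_def Int_def mem_Collect_eq)
  moreover have "x \<in> {x \<in> S. u x - v x \<in> - {0}}" using \<open>u x \<noteq> v x\<close> assms(5) by simp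
  ultimately have "\<not> negligible {x \<in> S. u x - v x \<in> - {0}}" using open_not_negligible by blast
  moreover have "negligible {x \<in> S. u x - v x \<in> - {0}}"
    using assms(4) unfolding eventually_ae_filter_negligible by (auto intro: negligible_subset)
  ultimately show False by blast
qed

lemma has_AC_deriv_unique:
  assumes "has_AC_deriv u g S" "has_AC_deriv u h S" "open S"
    and "\<And>p q. g absolutely_integrable_on {p..q}" "\<And>p q. h absolutely_integrable_on {p..q}"
  shows "AE x in lebesgue. x \<in> S \<longrightarrow> g x = h x"
proof -
  have "AE x in lebesgue. x \<in> S \<longrightarrow> g x - h x = 0"
  proof (rule AE_eq_0_if_integrals_eq_0[OF _ assms(3)])
    show "(\<lambda>x. g x - h x) absolutely_integrable_on {p..q}" for p q using assms(4,5) by (rule set_integral_diff)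
    show "integral {c..d} (\<lambda>x. g x - h x) = 0" if "c \<le> d" "{c..d} \<subseteq> S" for c d
      using has_AC_derivD(3)[OF has_AC_deriv_diff[OF assms(1,2)] that] by simp
  qed
  then show ?thesis by eventually_elim auto
qed

text \<open>The choice hidden in \<open>weak_deriv\<close> does not matter: two weak derivatives of
  \<open>u\<close> have primitives that agree with \<open>u\<close> almost everywhere, hence with
  each other everywhere by continuity, and then the densities agree almost everywhere.\<close>

lemma weak_deriv_AE:
  assumes "has_weak_deriv UNIV u g"
  shows "has_weak_deriv UNIV u (weak_deriv u)" "AE x in lebesgue. weak_deriv u x = g x"
proof -
  show w: "has_weak_deriv UNIV u (weak_deriv u)"
    unfolding weak_deriv_def by (rule someI[of "has_weak_deriv UNIV u", OF assms])
  obtain v where v: "has_AC_deriv v g UNIV" "AE x in lebesgue. u x = v x"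
    using has_weak_deriv_imp_AC[OF assms] by blast
  obtain v' where v': "has_AC_deriv v' (weak_deriv u) UNIV" "AE x in lebesgue. u x = v' x"
    using has_weak_deriv_imp_AC[OF w] by blast
  have "AE x in lebesgue. x \<in> UNIV \<longrightarrow> v' x = v x" using v(2) v'(2) by eventually_elim auto
  then have "v' x = v x" for x
    using continuous_AE_eq_imp_eq[of UNIV v' v x] has_AC_deriv_imp_continuous[OF v(1)]
      has_AC_deriv_imp_continuous[OF v'(1)] by simp
  then have "v' = v" by blast
  then show "AE x in lebesgue. weak_deriv u x = g x"
    using has_AC_deriv_unique[of v "weak_deriv u" UNIV g] v v' has_AC_deriv_locally_integrable by simp
qed

lemma has_AC_deriv_weak_deriv:
  assumes "has_AC_deriv u g UNIV"
  shows "AE x in lebesgue. weak_deriv u x = g x" "has_AC_deriv u (weak_deriv u) UNIV"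
proof -
  show *: "AE x in lebesgue. weak_deriv u x = g x"
    by (rule weak_deriv_AE(2)[OF has_AC_deriv_imp_has_weak_deriv[OF assms]])
  have "AE x in lebesgue. x \<in> UNIV \<longrightarrow> g x = weak_deriv u x" using * by eventually_elim simp
  then show "has_AC_deriv u (weak_deriv u) UNIV" by (rule has_AC_deriv_cong_AE[OF assms])
qed

lemma has_weak_deriv_continuous_imp_AC:
  assumes "has_weak_deriv UNIV u g" "continuous_on UNIV u"
  shows "has_AC_deriv u g UNIV"
proof -
  obtain v where v: "has_AC_deriv v g UNIV" "AE x in lebesgue. u x = v x"
    using has_weak_deriv_imp_AC[OF assms(1)] by blast
  have "u x = v x" for x
    using continuous_AE_eq_imp_eq[of UNIV u v x] has_AC_deriv_imp_continuous[OF v(1)] v(2) assms(2) by simp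
  then have "u = v" by blast
  with v show ?thesis by simp
qed

lemma L2_UNIV_iff: "u \<in> L2 UNIV \<longleftrightarrow> u \<in> borel_measurable lebesgue \<and> integrable lebesgue (\<lambda>x. (u x)\<^sup>2)"
  by (simp add: L2_def set_borel_measurable_def set_integrable_def)

lemma L2_loc_UNIV_iff:
  "u \<in> L2_loc UNIV \<longleftrightarrow> u \<in> borel_measurable lebesgue \<and> (\<forall>p q. (\<lambda>x. (u x)\<^sup>2) absolutely_integrable_on {p..q})"
proof
  assume u: "u \<in> L2_loc UNIV"
  have "u \<in> borel_measurable lebesgue"
  proof (rule borel_measurable_LIMSEQ_real)
    show "(\<lambda>x. indicator {- real n..real n} x *\<^sub>R u x) \<in> borel_measurable lebesgue" for n
      using u by (auto simp: L2_loc_def L2_def set_borel_measurable_def)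
    show "(\<lambda>n. indicator {- real n..real n} x *\<^sub>R u x) \<longlonglongrightarrow> u x" for x
    proof -
      obtain n0 :: nat where n0: "\<bar>x\<bar> \<le> real n0" using real_arch_simple by blast
      have "\<forall>\<^sub>F n in sequentially. indicator {- real n..real n} x *\<^sub>R u x = u x"
        using eventually_ge_at_top[of n0]
      proof eventually_elim
        case (elim n)
        then have "\<bar>x\<bar> \<le> real n" using n0 by linarith
        then show ?case by (auto simp: indicator_def)
      qed
      then show ?thesis by (simp add: tendsto_eventually)
    qed
  qed
  then show "u \<in> borel_measurable lebesgue \<and> (\<forall>p q. (\<lambda>x. (u x)\<^sup>2) absolutely_integrable_on {p..q})"
    using u by (auto simp: L2_loc_def L2_def)
next
  assume R: "u \<in> borel_measurable lebesgue \<and> (\<forall>p q. (\<lambda>x. (u x)\<^sup>2) absolutely_integrable_on {p..q})"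
  then have "(\<lambda>x. (u x)\<^sup>2) \<in> L1_loc UNIV" by (simp add: L1_loc_UNIV_iff)
  then show "u \<in> L2_loc UNIV"
    using R by (auto simp: L2_loc_def L2_def L1_loc_def set_borel_measurable_def
       intro!: borel_measurable_scaleR borel_measurable_indicator dest: lmeasurable_compact)
qed

text \<open>The bridge from the distributional definitions to the integral calculus; solutions and
  competitors are used through the right-hand side only.\<close>

lemma H1_loc_continuous_iff:
  "u \<in> H1_loc \<and> continuous_on UNIV u \<longleftrightarrow>
     has_AC_deriv u (weak_deriv u) UNIV \<and> (\<forall>p q. (\<lambda>x. (weak_deriv u x)\<^sup>2) absolutely_integrable_on {p..q})"
    (is "?L \<longleftrightarrow> ?R")
proof
  assume L: ?L
  then obtain g where g: "g \<in> L2_loc UNIV" "has_weak_deriv UNIV u g" by (auto simp: H1_loc_def)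
  have AC: "has_AC_deriv u g UNIV" using has_weak_deriv_continuous_imp_AC g(2) L by blast
  have "(\<lambda>x. (weak_deriv u x)\<^sup>2) absolutely_integrable_on {p..q}" for p q
  proof -
    obtain N where N: "negligible N" "{x. weak_deriv u x \<noteq> g x} \<subseteq> N"
      using has_AC_deriv_weak_deriv(1)[OF AC] unfolding eventually_ae_filter_negligible by blast
    have "(\<lambda>x. (g x)\<^sup>2) absolutely_integrable_on {p..q}" using g(1) by (simp add: L2_loc_UNIV_iff)
    then show ?thesis
    proof (rule absolutely_integrable_spike[OF _ N(1)])
      fix x assume "x \<in> {p..q} - N"
      then have "weak_deriv u x = g x" using N(2) by blast
      then show "(weak_deriv u x)\<^sup>2 = (g x)\<^sup>2" by simp
    qed
  qed
  then show ?R using has_AC_deriv_weak_deriv(2)[OF AC] by blast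
next
  assume R: ?R
  then have AC: "has_AC_deriv u (weak_deriv u) UNIV" by blast
  then have c: "continuous_on UNIV u" using has_AC_deriv_imp_continuous by blast
  have "weak_deriv u \<in> borel_measurable lebesgue"
    by (rule locally_integrable_imp_measurable[OF has_AC_deriv_locally_integrable[OF AC]])
  then have 1: "weak_deriv u \<in> L2_loc UNIV" using R by (simp add: L2_loc_UNIV_iff)
  have "u \<in> borel_measurable lebesgue"
    by (rule locally_integrable_imp_measurable[OF has_AC_deriv_self_integrable[OF AC]])
  moreover have "(\<lambda>x. (u x)\<^sup>2) absolutely_integrable_on {p..q}" for p q
    by (intro absolutely_integrable_continuous_real continuous_on_power continuous_on_subset[OF c]) simp
  ultimately have "u \<in> L2_loc UNIV" by (simp add: L2_loc_UNIV_iff)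
  moreover have "has_weak_deriv UNIV u (weak_deriv u)"
    using R by (intro has_AC_deriv_imp_has_weak_deriv) simp
  ultimately show ?L using 1 c unfolding H1_loc_def by blast
qed


section \<open>Half-line solutions\<close>

lemma AC_increment_ge:
  assumes "has_AC_deriv u g S" "c \<le> d" "{c..d} \<subseteq> S" "\<And>x. x \<in> {c..d} \<Longrightarrow> k \<le> g x"
  shows "k * (d - c) \<le> u d - u c"
proof -
  have "integral {c..d} (\<lambda>x. k) \<le> integral {c..d} g"
    using has_AC_derivD(2)[OF assms(1-3)] assms(4) by (intro integral_le) auto
  then show ?thesis using has_AC_derivD(3)[OF assms(1-3)] assms(2) by (simp add: mult.commute)
qed

lemma AC_increment_le:
  assumes "has_AC_deriv u g S" "c \<le> d" "{c..d} \<subseteq> S" "\<And>x. x \<in> {c..d} \<Longrightarrow> g x \<le> k"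
  shows "u d - u c \<le> k * (d - c)"
  using AC_increment_ge[OF has_AC_deriv_minus[OF assms(1)] assms(2,3), of "- k"] assms(4) by simp

lemma AC_mono:
  assumes "has_AC_deriv u g S" "c \<le> d" "{c..d} \<subseteq> S" "\<And>x. x \<in> {c..d} \<Longrightarrow> 0 \<le> g x"
  shows "u c \<le> u d"
  using AC_increment_ge[OF assms(1-3), of 0] assms(4) by simp

lemma AC_antimono:
  assumes "has_AC_deriv u g S" "c \<le> d" "{c..d} \<subseteq> S" "\<And>x. x \<in> {c..d} \<Longrightarrow> g x \<le> 0"
  shows "u d \<le> u c"
  using AC_increment_le[OF assms(1-3), of 0] assms(4) by simp

text \<open>The equation as a first-order system for \<open>\<phi>\<close> and the flux \<open>y = a \<phi>'\<close>, which unlike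
  \<open>\<phi>'\<close> is continuous.\<close>

definition wall_system :: "(real \<Rightarrow> real) \<Rightarrow> (real \<Rightarrow> real) \<Rightarrow> (real \<Rightarrow> real) \<Rightarrow> real set \<Rightarrow> bool" where
  "wall_system a \<phi> y S \<longleftrightarrow>
     has_AC_deriv \<phi> (\<lambda>x. y x / a x) S \<and>
     has_AC_deriv y (\<lambda>x. - (a x * (sin (\<phi> x) * cos (\<phi> x)))) S"

definition half_wall :: "(real \<Rightarrow> real) \<Rightarrow> (real \<Rightarrow> real) \<Rightarrow> (real \<Rightarrow> real) \<Rightarrow> bool" where
  "half_wall a \<phi> y \<longleftrightarrow>
     wall_system a \<phi> y {0..} \<and> \<phi> 0 = 0 \<and> (\<forall>x\<ge>0. 0 \<le> \<phi> x \<and> \<phi> x \<le> pi / 2) \<and>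
     (\<phi> \<longlongrightarrow> pi / 2) at_top"

lemma sin_cos_nonneg: "0 \<le> t \<Longrightarrow> t \<le> pi / 2 \<Longrightarrow> 0 \<le> sin t \<and> 0 \<le> cos t"
  by (simp add: cos_ge_zero sin_ge_zero)

text \<open>The bounds are imposed at every point rather than almost everywhere. In the theorem the
  coefficient is first clamped to the interval from \<open>a0\<close> to \<open>A0\<close>, which
  alters it on a null set only.\<close>

locale wall_coefficient =
  fixes a :: "real \<Rightarrow> real" and a0 A0 :: real
  assumes meas: "a \<in> borel_measurable lebesgue"
    and a0: "0 < a0"
    and a_ge: "\<And>x. a0 \<le> a x" and a_le: "\<And>x. a x \<le> A0"
begin

lemma a_pos: "0 < a x" using a0 a_ge[of x] by linarith

lemma A0_pos: "0 < A0" using a_pos[of 0] a_le[of 0] by linarith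

lemma bounded_a: "bounded (a ` S)"
  unfolding bounded_iff using a_pos a_le
  by (metis (no_types, lifting) abs_of_pos imageE real_norm_def)

lemma bounded_inverse_a: "bounded ((\<lambda>x. 1 / a x) ` S)"
  unfolding bounded_iff
proof (intro exI[of _ "1 / a0"] ballI)
  fix t assume "t \<in> (\<lambda>x. 1 / a x) ` S"
  then obtain x where "t = 1 / a x" by blast
  then show "norm t \<le> 1 / a0" using a_pos[of x] a_ge[of x] a0 by (simp add: frac_le)
qed

lemma a_mult_integrable:
  assumes "g absolutely_integrable_on S" "S \<in> sets lebesgue"
  shows "(\<lambda>x. a x * g x) absolutely_integrable_on S"
  using assms meas bounded_a
  by (intro absolutely_integrable_bounded_measurable_product_real) (auto intro: measurable_restrict_space1)

lemma a_div_integrable: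
  assumes "g absolutely_integrable_on S" "S \<in> sets lebesgue"
  shows "(\<lambda>x. g x / a x) absolutely_integrable_on S"
proof -
  have "(\<lambda>x. 1 / a x * g x) absolutely_integrable_on S"
    using assms meas bounded_inverse_a
    by (intro absolutely_integrable_bounded_measurable_product_real)
      (auto intro!: borel_measurable_divide intro: measurable_restrict_space1)
  then show ?thesis by simp
qed

lemma wall_system_continuous:
  assumes "wall_system a \<phi> y S" "{c..d} \<subseteq> S"
  shows "continuous_on {c..d} \<phi>" "continuous_on {c..d} y"
  using assms has_AC_deriv_imp_continuous_Icc unfolding wall_system_def by blast+

text \<open>For constant \<open>a = k\<close> this quantity is the conserved energy of the
  pendulum-like system. For variable \<open>a\<close> the two contributions no longer cancel, and
  the derivative has the sign of \<open>k - a x\<close> as long as \<open>y\<close> and sin \<phi>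
  cos \<phi> are non-negative and \<open>k \<ge> 0\<close>.\<close>

lemma energy_AC:
  assumes "wall_system a \<phi> y S"
  shows "has_AC_deriv (\<lambda>x. (y x)\<^sup>2 + k\<^sup>2 * (sin (\<phi> x))\<^sup>2)
     (\<lambda>x. 2 * y x * (sin (\<phi> x) * cos (\<phi> x)) * (k\<^sup>2 - (a x)\<^sup>2) / a x) S"
proof -
  have "has_AC_deriv (\<lambda>x. (y x)\<^sup>2) (\<lambda>x. 2 * y x * - (a x * (sin (\<phi> x) * cos (\<phi> x)))) S"
    by (rule has_AC_deriv_chain[where T = UNIV])
      (use assms in \<open>auto simp: wall_system_def intro!: derivative_eq_intros continuous_intros\<close>)
  moreover have "has_AC_deriv (\<lambda>x. (sin (\<phi> x))\<^sup>2) (\<lambda>x. (2 * sin (\<phi> x) * cos (\<phi> x)) * (y x / a x)) S"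
    by (rule has_AC_deriv_chain[where T = UNIV and f = "\<lambda>t. (sin t)\<^sup>2"])
      (use assms in \<open>auto simp: wall_system_def intro!: derivative_eq_intros continuous_intros\<close>)
  ultimately have "has_AC_deriv (\<lambda>x. (y x)\<^sup>2 + k\<^sup>2 * (sin (\<phi> x))\<^sup>2)
     (\<lambda>x. 2 * y x * - (a x * (sin (\<phi> x) * cos (\<phi> x))) + k\<^sup>2 * ((2 * sin (\<phi> x) * cos (\<phi> x)) * (y x / a x))) S"
    by (intro has_AC_deriv_add has_AC_deriv_cmult)
  then show ?thesis
  proof (rule has_AC_deriv_cong)
    fix x
    have "a x \<noteq> 0" using a_pos[of x] by simp
    then show "2 * y x * - (a x * (sin (\<phi> x) * cos (\<phi> x))) + k\<^sup>2 * ((2 * sin (\<phi> x) * cos (\<phi> x)) * (y x / a x))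
      = 2 * y x * (sin (\<phi> x) * cos (\<phi> x)) * (k\<^sup>2 - (a x)\<^sup>2) / a x"
      by (simp add: field_simps power2_eq_square)
  qed simp
qed

lemma energy_mono:
  assumes "wall_system a \<phi> y S" "c \<le> d" "{c..d} \<subseteq> S"
    and R: "\<And>x. x \<in> {c..d} \<Longrightarrow> 0 \<le> y x \<and> 0 \<le> \<phi> x \<and> \<phi> x \<le> pi / 2"
    and k: "\<And>x. x \<in> {c..d} \<Longrightarrow> a x \<le> k"
  shows "(y c)\<^sup>2 + k\<^sup>2 * (sin (\<phi> c))\<^sup>2 \<le> (y d)\<^sup>2 + k\<^sup>2 * (sin (\<phi> d))\<^sup>2"
proof (rule AC_mono[OF energy_AC[OF assms(1)] assms(2,3)])
  fix x assume x: "x \<in> {c..d}"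
  have "(a x)\<^sup>2 \<le> k\<^sup>2" using k[OF x] a_pos[of x] by (intro power_mono) auto
  then show "0 \<le> 2 * y x * (sin (\<phi> x) * cos (\<phi> x)) * (k\<^sup>2 - (a x)\<^sup>2) / a x"
    using R[OF x] sin_cos_nonneg[of "\<phi> x"] a_pos[of x]
    by (intro divide_nonneg_pos mult_nonneg_nonneg) auto
qed

lemma energy_antimono:
  assumes "wall_system a \<phi> y S" "c \<le> d" "{c..d} \<subseteq> S"
    and R: "\<And>x. x \<in> {c..d} \<Longrightarrow> 0 \<le> y x \<and> 0 \<le> \<phi> x \<and> \<phi> x \<le> pi / 2"
    and k: "0 \<le> k" "\<And>x. x \<in> {c..d} \<Longrightarrow> k \<le> a x"
  shows "(y d)\<^sup>2 + k\<^sup>2 * (sin (\<phi> d))\<^sup>2 \<le> (y c)\<^sup>2 + k\<^sup>2 * (sin (\<phi> c))\<^sup>2"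
proof (rule AC_antimono[OF energy_AC[OF assms(1)] assms(2,3)])
  fix x assume x: "x \<in> {c..d}"
  have "k\<^sup>2 \<le> (a x)\<^sup>2" using k(2)[OF x] k(1) by (intro power_mono) auto
  then show "2 * y x * (sin (\<phi> x) * cos (\<phi> x)) * (k\<^sup>2 - (a x)\<^sup>2) / a x \<le> 0"
    using R[OF x] sin_cos_nonneg[of "\<phi> x"] a_pos[of x]
    by (intro divide_nonpos_pos mult_nonneg_nonpos mult_nonneg_nonneg) auto
qed

text \<open>A Gronwall argument: y <= A0 cos \<phi> makes cos \<phi> decay at relative rate at most
  \<open>A0 / a0\<close>, so its product with the exponential of that rate is non-decreasing from
  the initial value 1. Thus \<phi> cannot reach \<pi>/2 at a finite point.\<close>

lemma cos_lower_bound: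
  assumes "wall_system a \<phi> y S" "0 \<le> d" "{0..d} \<subseteq> S" "\<phi> 0 = 0"
    and R: "\<And>x. x \<in> {0..d} \<Longrightarrow> 0 \<le> \<phi> x \<and> \<phi> x \<le> pi / 2 \<and> 0 \<le> y x \<and> y x \<le> A0 * cos (\<phi> x)"
  shows "0 < cos (\<phi> d)"
proof -
  define k where "k = A0 / a0"
  have C: "has_AC_deriv (\<lambda>x. cos (\<phi> x)) (\<lambda>x. - sin (\<phi> x) * (y x / a x)) S"
    by (rule has_AC_deriv_chain[where T = UNIV])
      (use assms in \<open>auto simp: wall_system_def intro!: derivative_eq_intros continuous_intros\<close>)
  have X: "has_AC_deriv (\<lambda>x. exp (k * x)) (\<lambda>x. k * exp (k * x)) S"
    by (rule has_AC_deriv_C1) (auto intro!: derivative_eq_intros continuous_intros)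
  have "cos (\<phi> 0) * exp (k * 0) \<le> cos (\<phi> d) * exp (k * d)"
  proof (rule AC_mono[OF has_AC_deriv_mult[OF C X] assms(2,3)])
    fix x assume x: "x \<in> {0..d}"
    note r = R[OF x]
    have sc: "0 \<le> sin (\<phi> x)" "0 \<le> cos (\<phi> x)" using r sin_cos_nonneg by auto
    have "sin (\<phi> x) * (y x / a x) \<le> 1 * (A0 * cos (\<phi> x) / a0)"
      using r sc a_pos[of x] a_ge[of x] a0 A0_pos
      by (intro mult_mono frac_le divide_nonneg_pos) auto
    then have "(sin (\<phi> x) * (y x / a x)) * exp (k * x) \<le> (k * cos (\<phi> x)) * exp (k * x)"
      by (intro mult_right_mono) (auto simp: k_def)
    then show "0 \<le> - sin (\<phi> x) * (y x / a x) * exp (k * x) + cos (\<phi> x) * (k * exp (k * x))"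
      by (simp add: algebra_simps)
  qed
  then have "0 < cos (\<phi> d) * exp (k * d)" using assms(4) by simp
  then show ?thesis by (rule zero_less_mult_pos2) simp
qed

end

locale half_wall_solution = wall_coefficient +
  fixes \<phi> y :: "real \<Rightarrow> real"
  assumes hw: "half_wall a \<phi> y"
begin

lemma ws: "wall_system a \<phi> y {0..}" and phi0 [simp]: "\<phi> 0 = 0"
  and phi_range: "0 \<le> x \<Longrightarrow> 0 \<le> \<phi> x" "0 \<le> x \<Longrightarrow> \<phi> x \<le> pi / 2"
  and phi_lim: "(\<phi> \<longlongrightarrow> pi / 2) at_top"
  using hw by (auto simp: half_wall_def)

lemma AC_phi: "has_AC_deriv \<phi> (\<lambda>x. y x / a x) {0..}"
  and AC_y: "has_AC_deriv y (\<lambda>x. - (a x * (sin (\<phi> x) * cos (\<phi> x)))) {0..}"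
  using ws by (auto simp: wall_system_def)

lemma y_antimono: "0 \<le> c \<Longrightarrow> c \<le> d \<Longrightarrow> y d \<le> y c"
proof (rule AC_antimono[OF AC_y])
  fix x assume "0 \<le> c" "x \<in> {c..d}"
  then have "0 \<le> sin (\<phi> x) \<and> 0 \<le> cos (\<phi> x)" using phi_range[of x] sin_cos_nonneg by auto
  then show "- (a x * (sin (\<phi> x) * cos (\<phi> x))) \<le> 0" using a_pos[of x] by simp
qed auto

lemma y_nonneg: assumes "0 \<le> x" shows "0 \<le> y x"
proof (rule ccontr)
  assume "\<not> 0 \<le> y x"
  then have neg: "y x < 0" by simp
  \<comment> \<open>On the way to \<open>d\<close> the slope of \<phi> is at most
    \<open>y x / A0 < 0\<close>, so \<phi> falls by at least \<open>\<phi> x + 1\<close> and becomes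
    negative.\<close>
  define d where "d = x + (\<phi> x + 1) * A0 / (- y x)"
  have xd: "x \<le> d" using neg phi_range[OF assms] A0_pos by (simp add: d_def divide_nonneg_neg)
  have "\<phi> d - \<phi> x \<le> (y x / A0) * (d - x)"
  proof (rule AC_increment_le[OF AC_phi xd])
    fix t assume t: "t \<in> {x..d}"
    have "y t / a t \<le> y x / a t" using y_antimono[of x t] assms t a_pos[of t] by (simp add: divide_right_mono)
    also have "\<dots> \<le> y x / A0" using neg a_pos[of t] a_le[of t] by (simp add: divide_left_mono_neg A0_pos)
    finally show "y t / a t \<le> y x / A0" .
  qed (use assms in auto)
  also have "\<dots> = - (\<phi> x + 1)" using neg A0_pos by (simp add: d_def field_simps)
  finally have "\<phi> d < 0" by simp
  then show False using phi_range(1)[of d] assms xd by simp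
qed

lemma phi_mono: "0 \<le> c \<Longrightarrow> c \<le> d \<Longrightarrow> \<phi> c \<le> \<phi> d"
  by (rule AC_mono[OF AC_phi]) (auto intro!: divide_nonneg_pos y_nonneg a_pos)

lemma phi_increment_ge:
  assumes "0 \<le> c" "c \<le> d" shows "(y d / A0) * (d - c) \<le> \<phi> d - \<phi> c"
proof (rule AC_increment_ge[OF AC_phi assms(2)])
  fix t assume t: "t \<in> {c..d}"
  show "y d / A0 \<le> y t / a t"
    using y_antimono[of t d] y_nonneg[of d] assms t a_pos[of t] a_le[of t] by (intro frac_le) auto
qed (use assms in auto)

text \<open>Since \<open>y\<close> is non-increasing, \<phi> gains at least
  \<open>x * y x / A0\<close> on \<open>{0..x}\<close>; as \<phi> stays below \<pi>/2, the flux
  decays at least like 1/x.\<close>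

lemma y_lim: "(y \<longlongrightarrow> 0) at_top"
proof (rule tendstoI)
  fix e :: real assume e: "e > 0"
  define x where "x = (pi / 2 + 1) * A0 / e"
  have x: "x > 0" using e A0_pos pi_gt_zero by (simp add: x_def add_pos_pos)
  have "(y x / A0) * x \<le> \<phi> x" using phi_increment_ge[of 0 x] x by simp
  also have "\<dots> \<le> pi / 2" using phi_range x by simp
  finally have "y x \<le> (pi / 2) * A0 / x" using x A0_pos by (simp add: field_simps)
  also have "\<dots> < e" using x e A0_pos pi_gt_zero by (simp add: x_def field_simps)
  finally have "y x < e" .
  then have "\<forall>t\<ge>x. dist (y t) 0 < e"
    using y_antimono[of x] y_nonneg x by (fastforce simp: dist_real_def)
  then show "\<forall>\<^sub>F x in at_top. dist (y x) 0 < e" unfolding eventually_at_top_linorder by blast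
qed

lemma energy_lim: "((\<lambda>x. (y x)\<^sup>2 + k\<^sup>2 * (sin (\<phi> x))\<^sup>2) \<longlongrightarrow> k\<^sup>2) at_top"
proof -
  have "((\<lambda>x. (y x)\<^sup>2 + k\<^sup>2 * (sin (\<phi> x))\<^sup>2) \<longlongrightarrow> 0\<^sup>2 + k\<^sup>2 * (sin (pi / 2))\<^sup>2) at_top"
    by (intro tendsto_intros y_lim phi_lim)
  then show ?thesis by simp
qed

text \<open>The energy with an upper bound \<open>k\<close> increases towards its limit k^2, and k^2
  - k^2 sin^2 \<phi> is the square of k cos \<phi>.\<close>

lemma y_le_cos:
  assumes "0 \<le> x" "0 \<le> k" "\<And>t. x \<le> t \<Longrightarrow> a t \<le> k"
  shows "y x \<le> k * cos (\<phi> x)"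
proof -
  have "(y x)\<^sup>2 + k\<^sup>2 * (sin (\<phi> x))\<^sup>2 \<le> k\<^sup>2"
  proof (rule tendsto_lowerbound[OF energy_lim])
    have "(y x)\<^sup>2 + k\<^sup>2 * (sin (\<phi> x))\<^sup>2 \<le> (y t)\<^sup>2 + k\<^sup>2 * (sin (\<phi> t))\<^sup>2" if "x \<le> t" for t
      by (rule energy_mono[OF ws that]) (use assms phi_range y_nonneg in auto)
    then show "\<forall>\<^sub>F t in at_top. (y x)\<^sup>2 + k\<^sup>2 * (sin (\<phi> x))\<^sup>2 \<le> (y t)\<^sup>2 + k\<^sup>2 * (sin (\<phi> t))\<^sup>2"
      unfolding eventually_at_top_linorder by blast
  qed simp
  then have "(y x)\<^sup>2 \<le> (k * cos (\<phi> x))\<^sup>2" by (simp add: power_mult_distrib cos_squared_eq right_diff_distrib)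
  moreover have "0 \<le> k * cos (\<phi> x)"
    using assms(1,2) phi_range[of x] sin_cos_nonneg[of "\<phi> x"] by simp
  ultimately show ?thesis by (rule power2_le_imp_le)
qed

text \<open>The energy with a lower bound \<open>k\<close> decreases towards k^2. Only the values of
  \<open>a\<close> from \<open>x\<close> onwards matter: for a non-decreasing coefficient
  \<open>k = a x\<close> is admissible, and this is the inequality on which stability rests.\<close>

lemma y_ge_cos:
  assumes "0 \<le> x" "0 \<le> k" "\<And>t. x \<le> t \<Longrightarrow> k \<le> a t"
  shows "k * cos (\<phi> x) \<le> y x"
proof -
  have "k\<^sup>2 \<le> (y x)\<^sup>2 + k\<^sup>2 * (sin (\<phi> x))\<^sup>2"
  proof (rule tendsto_upperbound[OF energy_lim])
    have "(y t)\<^sup>2 + k\<^sup>2 * (sin (\<phi> t))\<^sup>2 \<le> (y x)\<^sup>2 + k\<^sup>2 * (sin (\<phi> x))\<^sup>2" if "x \<le> t" for t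
      by (rule energy_antimono[OF ws that]) (use assms phi_range y_nonneg in auto)
    then show "\<forall>\<^sub>F t in at_top. (y t)\<^sup>2 + k\<^sup>2 * (sin (\<phi> t))\<^sup>2 \<le> (y x)\<^sup>2 + k\<^sup>2 * (sin (\<phi> x))\<^sup>2"
      unfolding eventually_at_top_linorder by blast
  qed simp
  then have "(k * cos (\<phi> x))\<^sup>2 \<le> (y x)\<^sup>2" by (simp add: power_mult_distrib cos_squared_eq right_diff_distrib)
  then show ?thesis using assms(1) y_nonneg power2_le_imp_le by blast
qed

lemma cos_pos: assumes "0 \<le> x" shows "0 < cos (\<phi> x)"
  by (rule cos_lower_bound[OF ws assms]) (use phi_range y_nonneg y_le_cos a_le A0_pos in auto)

lemma phi_less: assumes "0 \<le> x" shows "\<phi> x < pi / 2"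
proof -
  have "\<phi> x \<noteq> pi / 2" using cos_pos[OF assms] cos_pi_half by (metis less_irrefl)
  then show ?thesis using phi_range(2)[OF assms] by simp
qed

lemma y_pos: assumes "0 \<le> x" shows "0 < y x"
proof -
  have "0 < a0 * cos (\<phi> x)" using cos_pos[OF assms] a0 by simp
  also have "\<dots> \<le> y x" using y_ge_cos[OF assms] a0 a_ge by simp
  finally show ?thesis .
qed

lemma phi_strict_mono: assumes "0 \<le> c" "c < d" shows "\<phi> c < \<phi> d"
proof -
  have "0 < (y d / A0) * (d - c)" using assms y_pos A0_pos by simp
  then show ?thesis using phi_increment_ge[of c d] assms by linarith
qed

lemma phi_pos: "0 < x \<Longrightarrow> 0 < \<phi> x"
  using phi_strict_mono[of 0 x] by simp

end


section \<open>The initial value problem\<close>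

lemma sin_cos_Lipschitz: "\<bar>sin u * cos u - sin v * cos v\<bar> \<le> \<bar>u - v\<bar>" for u v :: real
proof -
  have "2 * (sin u * cos u - sin v * cos v) = sin (2 * u) - sin (2 * v)" by (simp add: sin_double)
  also have "\<dots> = 2 * sin (u - v) * cos (u + v)"
    by (simp add: sin_diff_sin diff_divide_distrib add_divide_distrib)
  finally have "sin u * cos u - sin v * cos v = sin (u - v) * cos (u + v)" by simp
  then have "\<bar>sin u * cos u - sin v * cos v\<bar> = \<bar>sin (u - v)\<bar> * \<bar>cos (u + v)\<bar>" by (simp add: abs_mult)
  also have "\<dots> \<le> \<bar>sin (u - v)\<bar> * 1" by (intro mult_left_mono) auto
  also have "\<dots> \<le> \<bar>u - v\<bar>" using abs_sin_x_le_abs_x[of "u - v"] by simp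
  finally show ?thesis .
qed

context wall_coefficient
begin

text \<open>Weighting the sup norm by \<open>exp (- rate * x)\<close> makes the Picard map on the half line a
  contraction with factor \<open>1/2\<close>, because \<open>A0 / (a0 * rate\<^sup>2) = 1/2\<close>.\<close>

definition rate :: real where "rate = sqrt (2 * A0 / a0)"

text \<open>The unknown \<open>w\<close> is the weighted angle: the angle itself is
  \<open>exp (rate * s) * w s\<close>. In this variable the map acts on bounded continuous functions
  although it is posed on an unbounded half line.\<close>

definition picard_flux :: "real \<Rightarrow> (real \<Rightarrow> real) \<Rightarrow> real \<Rightarrow> real" where
  "picard_flux p w t =
     p - integral {0..t} (\<lambda>s. a s * (sin (exp (rate * s) * w s) * cos (exp (rate * s) * w s)))"

definition picard_angle :: "real \<Rightarrow> (real \<Rightarrow> real) \<Rightarrow> real \<Rightarrow> real" where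
  "picard_angle p w x = integral {0..x} (\<lambda>t. picard_flux p w t / a t)"

lemma rate_pos: "0 < rate"
  using a0 A0_pos by (simp add: rate_def)

lemma rate_sq: "A0 / (a0 * rate\<^sup>2) = 1 / 2"
  using a0 A0_pos by (simp add: rate_def field_simps)

lemma picard_flux_AC:
  assumes "continuous_on UNIV w"
  shows "has_AC_deriv (picard_flux p w)
     (\<lambda>s. - (a s * (sin (exp (rate * s) * w s) * cos (exp (rate * s) * w s)))) {0..}"
  unfolding has_AC_deriv_def
proof (intro allI impI)
  fix c d :: real assume cd: "c \<le> d" "{c..d} \<subseteq> {0..}"
  let ?f = "\<lambda>s. a s * (sin (exp (rate * s) * w s) * cos (exp (rate * s) * w s))"
  have f: "?f absolutely_integrable_on {p..q}" for p q
    by (intro a_mult_integrable absolutely_integrable_continuous_real continuous_intros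
        continuous_on_subset[OF assms]) auto
  then have "integral {0..c} ?f + integral {c..d} ?f = integral {0..d} ?f"
    using cd by (intro Henstock_Kurzweil_Integration.integral_combine) (auto simp: absolutely_integrable_on_def)
  then show "(\<lambda>s. - ?f s) absolutely_integrable_on {c..d} \<and>
    integral {c..d} (\<lambda>s. - ?f s) = picard_flux p w d - picard_flux p w c"
    using f set_integral_diff(1)[OF absolutely_integrable_zero f, of c d] by (simp add: picard_flux_def)
qed

lemma picard_angle_AC:
  assumes "continuous_on UNIV w"
  shows "has_AC_deriv (picard_angle p w) (\<lambda>t. picard_flux p w t / a t) {0..}"
  unfolding has_AC_deriv_def
proof (intro allI impI)
  fix c d :: real assume cd: "c \<le> d" "{c..d} \<subseteq> {0..}"
  let ?f = "\<lambda>t. picard_flux p w t / a t"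
  have f: "?f absolutely_integrable_on {0..q}" for q
    by (intro a_div_integrable absolutely_integrable_continuous_real
        has_AC_deriv_imp_continuous_Icc[OF picard_flux_AC[OF assms]]) auto
  have "integral {0..c} ?f + integral {c..d} ?f = integral {0..d} ?f"
    using cd f[of d] by (intro Henstock_Kurzweil_Integration.integral_combine) (auto simp: absolutely_integrable_on_def)
  moreover have "?f absolutely_integrable_on {c..d}"
    by (rule absolutely_integrable_on_subinterval[OF f[of d]]) (use cd in auto)
  ultimately show "?f absolutely_integrable_on {c..d} \<and>
    integral {c..d} ?f = picard_angle p w d - picard_angle p w c"
    by (auto simp: picard_angle_def)
qed

lemma integral_exp_le:
  fixes f :: "real \<Rightarrow> real"
  assumes "0 \<le> x" "f integrable_on {0..x}" "0 \<le> b" "\<And>t. t \<in> {0..x} \<Longrightarrow> \<bar>f t\<bar> \<le> b * exp (rate * t) + c"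
  shows "\<bar>integral {0..x} f\<bar> \<le> b * exp (rate * x) / rate + c * x"
proof -
  have "((\<lambda>t. b * exp (rate * t) + c) has_integral
     (b * exp (rate * x) / rate + c * x) - (b * exp (rate * 0) / rate + c * 0)) {0..x}"
    by (rule fundamental_theorem_of_calculus[OF assms(1)])
      (use rate_pos in \<open>auto intro!: derivative_eq_intros simp: has_real_derivative_iff_has_vector_derivative[symmetric]\<close>)
  then have I: "((\<lambda>t. b * exp (rate * t) + c) has_integral (b * exp (rate * x) / rate + c * x - b / rate)) {0..x}"
    by simp
  have "norm (integral {0..x} f) \<le> integral {0..x} (\<lambda>t. b * exp (rate * t) + c)"
    by (rule integral_norm_bound_integral[OF assms(2)]) (use I assms(4) in auto)
  also have "\<dots> = b * exp (rate * x) / rate + c * x - b / rate" using I by (rule integral_unique)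
  also have "\<dots> \<le> b * exp (rate * x) / rate + c * x" using assms(3) rate_pos by simp
  finally show ?thesis by simp
qed

lemma picard_flux_diff:
  assumes w: "continuous_on UNIV w" and v: "continuous_on UNIV v" and D: "\<And>t. \<bar>w t - v t\<bar> \<le> D"
    and t: "0 \<le> t"
  shows "\<bar>picard_flux p w t - picard_flux q v t\<bar> \<le> A0 * D * exp (rate * t) / rate + \<bar>p - q\<bar>"
proof -
  let ?f = "\<lambda>w s. a s * (sin (exp (rate * s) * w s) * cos (exp (rate * s) * w s))"
  have i: "?f w integrable_on {0..t}" if "continuous_on UNIV w" for w
    using has_AC_derivD(2)[OF picard_flux_AC[OF that, of 0], of 0 t] t integrable_neg by fastforce
  have D0: "0 \<le> D" using D[of 0] by linarith
  have "\<bar>integral {0..t} (\<lambda>s. ?f w s - ?f v s)\<bar> \<le> (A0 * D) * exp (rate * t) / rate + 0 * t"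
  proof (rule integral_exp_le[OF t integrable_diff[OF i[OF w] i[OF v]]])
    show "0 \<le> A0 * D" using A0_pos D0 by simp
    fix s assume "s \<in> {0..t}"
    have "\<bar>?f w s - ?f v s\<bar> = a s * \<bar>sin (exp (rate * s) * w s) * cos (exp (rate * s) * w s)
        - sin (exp (rate * s) * v s) * cos (exp (rate * s) * v s)\<bar>"
      using a_pos[of s] by (simp add: right_diff_distrib[symmetric] abs_mult)
    also have "\<dots> \<le> A0 * (exp (rate * s) * D)"
    proof (rule mult_mono)
      have "\<bar>exp (rate * s) * w s - exp (rate * s) * v s\<bar> \<le> exp (rate * s) * D"
        using D by (simp add: right_diff_distrib[symmetric] abs_mult)
      then show "\<bar>sin (exp (rate * s) * w s) * cos (exp (rate * s) * w s)
        - sin (exp (rate * s) * v s) * cos (exp (rate * s) * v s)\<bar> \<le> exp (rate * s) * D"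
        using sin_cos_Lipschitz order_trans by blast
    qed (use a_le A0_pos in auto)
    finally show "\<bar>?f w s - ?f v s\<bar> \<le> A0 * D * exp (rate * s) + 0" by (simp add: mult_ac)
  qed
  then have "\<bar>integral {0..t} (?f w) - integral {0..t} (?f v)\<bar> \<le> A0 * D * exp (rate * t) / rate"
    using Henstock_Kurzweil_Integration.integral_diff[OF i[OF w] i[OF v]] by simp
  then show ?thesis unfolding picard_flux_def by linarith
qed

text \<open>Each of the two integrations of \<open>exp (rate * t)\<close> gains a factor
  \<open>1 / rate\<close>, so the weighted distance is multiplied by
  \<open>A0 / (a0 * rate\<^sup>2)\<close>. Admitting different initial fluxes lets this one estimate
  yield boundedness of the Picard map, its contraction property and the dependence on the
  flux.\<close>

lemma picard_angle_diff:
  assumes w: "continuous_on UNIV w" and v: "continuous_on UNIV v" and D: "\<And>t. \<bar>w t - v t\<bar> \<le> D"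
    and x: "0 \<le> x"
  shows "exp (- rate * x) * \<bar>picard_angle p w x - picard_angle q v x\<bar> \<le> D / 2 + \<bar>p - q\<bar> / (a0 * rate)"
proof -
  let ?f = "\<lambda>p w t. picard_flux p w t / a t"
  have i: "?f p w integrable_on {0..x}" if "continuous_on UNIV w" for p w
    using has_AC_derivD(2)[OF picard_angle_AC[OF that], of 0 x] x by simp
  have D0: "0 \<le> D" using D[of 0] by linarith
  have "\<bar>integral {0..x} (\<lambda>t. ?f p w t - ?f q v t)\<bar>
     \<le> (A0 * D / (a0 * rate)) * exp (rate * x) / rate + (\<bar>p - q\<bar> / a0) * x"
  proof (rule integral_exp_le[OF x integrable_diff[OF i[OF w] i[OF v]]])
    show "0 \<le> A0 * D / (a0 * rate)" using A0_pos D0 a0 rate_pos by simp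
    fix t assume t: "t \<in> {0..x}"
    have "\<bar>?f p w t - ?f q v t\<bar> = \<bar>picard_flux p w t - picard_flux q v t\<bar> / a t"
      using a_pos[of t] by (simp add: diff_divide_distrib[symmetric])
    also have "\<dots> \<le> (A0 * D * exp (rate * t) / rate + \<bar>p - q\<bar>) / a0"
      using picard_flux_diff[OF w v D, of t p q] t a_ge[of t] a0 by (intro frac_le) auto
    also have "\<dots> = (A0 * D / (a0 * rate)) * exp (rate * t) + \<bar>p - q\<bar> / a0"
      by (simp add: add_divide_distrib mult_ac)
    finally show "\<bar>?f p w t - ?f q v t\<bar> \<le> (A0 * D / (a0 * rate)) * exp (rate * t) + \<bar>p - q\<bar> / a0" .
  qed
  moreover have "(A0 * D / (a0 * rate)) * exp (rate * x) / rate = D * exp (rate * x) / 2"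
  proof -
    have "(A0 * D / (a0 * rate)) * exp (rate * x) / rate = D * exp (rate * x) * (A0 / (a0 * rate\<^sup>2))"
      by (simp add: power2_eq_square mult_ac)
    then show ?thesis unfolding rate_sq by simp
  qed
  ultimately have "\<bar>picard_angle p w x - picard_angle q v x\<bar> \<le> D * exp (rate * x) / 2 + \<bar>p - q\<bar> / a0 * x"
    using Henstock_Kurzweil_Integration.integral_diff[OF i[OF w, of p] i[OF v, of q]]
    unfolding picard_angle_def by (simp only:)
  then have "exp (- rate * x) * \<bar>picard_angle p w x - picard_angle q v x\<bar>
     \<le> exp (- rate * x) * (D * exp (rate * x) / 2 + \<bar>p - q\<bar> / a0 * x)"
    by (intro mult_left_mono) auto
  also have "\<dots> = D / 2 + \<bar>p - q\<bar> / a0 * (x * exp (- rate * x))"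
    by (simp add: exp_minus field_simps)
  also have "\<dots> \<le> D / 2 + \<bar>p - q\<bar> / a0 * (1 / rate)"
  proof -
    have "rate * x \<le> exp (rate * x)" using exp_ge_add_one_self[of "rate * x"] by linarith
    then have "x * exp (- rate * x) \<le> 1 / rate" using rate_pos by (simp add: exp_minus field_simps)
    then show ?thesis using a0 by (intro add_left_mono mult_left_mono) auto
  qed
  finally show ?thesis by simp
qed

lemma picard_zero: "picard_angle 0 (\<lambda>x. 0) x = 0"
  by (simp add: picard_angle_def picard_flux_def)

text \<open>Elements of the Banach space are functions on the whole line, so the half-line map is
  continued by its value at \<open>0\<close> to the left, by means of
  \<open>max 0 x\<close>.\<close>

definition picard :: "real \<Rightarrow> (real \<Rightarrow>\<^sub>C real) \<Rightarrow> (real \<Rightarrow>\<^sub>C real)" where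
  "picard p w = Bcontfun (\<lambda>x. exp (- rate * max 0 x) * picard_angle p (apply_bcontfun w) (max 0 x))"

lemma apply_picard:
  "apply_bcontfun (picard p w) x = exp (- rate * max 0 x) * picard_angle p (apply_bcontfun w) (max 0 x)"
proof -
  let ?g = "\<lambda>x. exp (- rate * max 0 x) * picard_angle p (apply_bcontfun w) (max 0 x)"
  have "continuous_on UNIV ?g"
    by (intro continuous_intros continuous_on_compose2[OF has_AC_deriv_imp_continuous[OF picard_angle_AC]])
      auto
  moreover have "bounded (range ?g)"
    unfolding bounded_iff
  proof (intro exI ballI)
    fix z assume "z \<in> range ?g"
    then obtain x where z: "z = ?g x" by blast
    have "\<bar>apply_bcontfun w t - 0\<bar> \<le> norm w" for t using norm_bounded[of w t] by simp
    from picard_angle_diff[where x = "max 0 x" and p = p and q = 0 and v = "\<lambda>_. 0", OF _ _ this]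
    show "norm z \<le> norm w / 2 + \<bar>p\<bar> / (a0 * rate)"
      by (simp add: z abs_mult picard_zero)
  qed
  ultimately have "?g \<in> bcontfun" by (simp add: bcontfun_def)
  then show ?thesis by (simp add: picard_def Bcontfun_inverse)
qed

lemma picard_contraction: "dist (picard p w) (picard q v) \<le> dist w v / 2 + \<bar>p - q\<bar> / (a0 * rate)"
proof (rule dist_bound)
  fix x
  have "\<bar>apply_bcontfun w t - apply_bcontfun v t\<bar> \<le> dist w v" for t
    using dist_bounded[of w t v] by (simp add: dist_real_def)
  from picard_angle_diff[where x = "max 0 x" and p = p and q = q, OF _ _ this]
  show "dist (apply_bcontfun (picard p w) x) (apply_bcontfun (picard q v) x) \<le> dist w v / 2 + \<bar>p - q\<bar> / (a0 * rate)"
    by (simp add: apply_picard dist_real_def right_diff_distrib[symmetric] abs_mult)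
qed

text \<open>Banach's fixed point theorem applies for every initial flux \<open>p\<close>. Inserting
  two fixed points into the contraction estimate and absorbing half of their distance gives
  Lipschitz dependence on \<open>p\<close>, and undoing the weight makes it uniform on bounded
  intervals.\<close>

lemma initial_value_problem:
  obtains \<Phi> Y where
    "\<And>p. wall_system a (\<Phi> p) (Y p) {0..}" "\<And>p. \<Phi> p 0 = 0" "\<And>p. Y p 0 = p"
    "\<And>X. \<exists>C>0. \<forall>p q x. 0 \<le> x \<longrightarrow> x \<le> X \<longrightarrow>
        \<bar>\<Phi> p x - \<Phi> q x\<bar> \<le> C * \<bar>p - q\<bar> \<and> \<bar>Y p x - Y q x\<bar> \<le> C * \<bar>p - q\<bar>"
proof -
  have "\<exists>!w. picard p w = w" for p
    by (rule banach_fix_type[of "1/2"]) (use picard_contraction[of p _ p] in auto)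
  then obtain W where W: "\<And>p. picard p (W p) = W p" by metis
  define \<Phi> where "\<Phi> p x = exp (rate * x) * apply_bcontfun (W p) x" for p x
  define Y where "Y p = picard_flux p (apply_bcontfun (W p))" for p
  have \<Phi>: "\<Phi> p x = picard_angle p (apply_bcontfun (W p)) x" if "0 \<le> x" for p x
  proof -
    have "apply_bcontfun (W p) x = exp (- rate * x) * picard_angle p (apply_bcontfun (W p)) x"
      using apply_picard[of p "W p" x] that W[of p] by simp
    then show ?thesis by (simp add: \<Phi>_def exp_minus)
  qed
  have dW: "dist (W p) (W q) \<le> 2 / (a0 * rate) * \<bar>p - q\<bar>" for p q
    using picard_contraction[of p "W p" q "W q"] W by simp
  show thesis
  proof (rule that[of \<Phi> Y])
    show "wall_system a (\<Phi> p) (Y p) {0..}" for p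
      unfolding wall_system_def
    proof
      show "has_AC_deriv (\<Phi> p) (\<lambda>x. Y p x / a x) {0..}"
        by (rule has_AC_deriv_cong[OF picard_angle_AC]) (auto simp: \<Phi> Y_def)
      show "has_AC_deriv (Y p) (\<lambda>x. - (a x * (sin (\<Phi> p x) * cos (\<Phi> p x)))) {0..}"
        unfolding Y_def \<Phi>_def by (rule picard_flux_AC) simp
    qed
    show "\<Phi> p 0 = 0" for p by (simp add: \<Phi> picard_angle_def)
    show "Y p 0 = p" for p by (simp add: Y_def picard_flux_def)
    fix X :: real
    define K where "K = 2 / (a0 * rate)"
    define C where "C = (A0 * K / rate) * exp (rate * X) + 1 + exp (rate * X) * K"
    have K: "K > 0" using a0 rate_pos by (simp add: K_def)
    have C: "C > 0" using K A0_pos rate_pos by (simp add: C_def add_pos_pos)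
    have "\<bar>\<Phi> p x - \<Phi> q x\<bar> \<le> C * \<bar>p - q\<bar> \<and> \<bar>Y p x - Y q x\<bar> \<le> C * \<bar>p - q\<bar>"
      if x: "0 \<le> x" "x \<le> X" for p q x
    proof
      have ex: "exp (rate * x) \<le> exp (rate * X)" using x rate_pos by simp
      have D: "\<bar>apply_bcontfun (W p) t - apply_bcontfun (W q) t\<bar> \<le> K * \<bar>p - q\<bar>" for t
        using dist_bounded[of "W p" t "W q"] dW[of p q] by (simp add: dist_real_def K_def)
      have "\<bar>\<Phi> p x - \<Phi> q x\<bar> = exp (rate * x) * \<bar>apply_bcontfun (W p) x - apply_bcontfun (W q) x\<bar>"
        by (simp add: \<Phi>_def right_diff_distrib[symmetric] abs_mult)
      also have "\<dots> \<le> exp (rate * X) * (K * \<bar>p - q\<bar>)" using ex D by (intro mult_mono) auto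
      also have "\<dots> = (exp (rate * X) * K) * \<bar>p - q\<bar>" by simp
      also have "\<dots> \<le> C * \<bar>p - q\<bar>"
        using K A0_pos rate_pos by (intro mult_right_mono) (auto simp: C_def)
      finally show "\<bar>\<Phi> p x - \<Phi> q x\<bar> \<le> C * \<bar>p - q\<bar>" .
      have "\<bar>Y p x - Y q x\<bar> \<le> A0 * (K * \<bar>p - q\<bar>) * exp (rate * x) / rate + \<bar>p - q\<bar>"
        unfolding Y_def by (rule picard_flux_diff[OF _ _ D x(1)]) auto
      also have "\<dots> = ((A0 * K / rate) * exp (rate * x) + 1) * \<bar>p - q\<bar>" by (simp add: algebra_simps)
      also have "\<dots> \<le> C * \<bar>p - q\<bar>"
      proof (rule mult_right_mono)
        have "(A0 * K / rate) * exp (rate * x) \<le> (A0 * K / rate) * exp (rate * X)"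
          using ex K A0_pos rate_pos by (intro mult_left_mono) auto
        moreover have "0 \<le> exp (rate * X) * K" using K by simp
        ultimately show "(A0 * K / rate) * exp (rate * x) + 1 \<le> C" unfolding C_def by linarith
      qed simp
      finally show "\<bar>Y p x - Y q x\<bar> \<le> C * \<bar>p - q\<bar>" .
    qed
    then show "\<exists>C>0. \<forall>p q x. 0 \<le> x \<longrightarrow> x \<le> X \<longrightarrow>
        \<bar>\<Phi> p x - \<Phi> q x\<bar> \<le> C * \<bar>p - q\<bar> \<and> \<bar>Y p x - Y q x\<bar> \<le> C * \<bar>p - q\<bar>"
      using C by blast
  qed
qed

end


section \<open>Shooting\<close>

lemma continuous_pos_lower_bound:
  fixes f :: "real \<Rightarrow> real"
  assumes "continuous_on {c..d} f" "c \<le> d" "\<And>t. t \<in> {c..d} \<Longrightarrow> 0 < f t"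
  obtains m where "0 < m" "\<And>t. t \<in> {c..d} \<Longrightarrow> m \<le> f t"
proof -
  obtain t0 where "t0 \<in> {c..d}" "\<forall>t\<in>{c..d}. f t0 \<le> f t"
    using continuous_attains_inf[OF compact_Icc _ assms(1)] assms(2) by auto
  then show thesis using that[of "f t0"] assms(3) by blast
qed

lemma continuous_pos_right:
  fixes f :: "real \<Rightarrow> real"
  assumes "continuous_on {0..} f" "0 \<le> x" "0 < f x"
  obtains e where "0 < e" "\<And>t. t \<in> {x..x+e} \<Longrightarrow> f x / 2 < f t"
proof -
  obtain d where d: "d > 0" "\<And>t. t \<in> {0..} \<Longrightarrow> dist t x < d \<Longrightarrow> dist (f t) (f x) < f x / 2"
    using assms unfolding continuous_on_iff by (metis atLeast_iff half_gt_zero)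
  have "f x / 2 < f t" if "t \<in> {x..x+d/2}" for t
  proof -
    have "\<bar>f t - f x\<bar> < f x / 2" using d(2)[of t] d(1) that assms(2) by (auto simp: dist_real_def)
    then show ?thesis by linarith
  qed
  then show thesis using that[of "d / 2"] d(1) by auto
qed

context wall_coefficient
begin

lemma flux_antimono:
  assumes "wall_system a \<phi> y S" "c \<le> d" "{c..d} \<subseteq> S"
    "\<And>x. x \<in> {c..d} \<Longrightarrow> 0 \<le> \<phi> x \<and> \<phi> x \<le> pi / 2"
  shows "y d \<le> y c"
proof (rule AC_antimono[OF _ assms(2,3)])
  show "has_AC_deriv y (\<lambda>x. - (a x * (sin (\<phi> x) * cos (\<phi> x)))) S"
    using assms(1) by (simp add: wall_system_def)
  fix x assume "x \<in> {c..d}"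
  then have "0 \<le> sin (\<phi> x) \<and> 0 \<le> cos (\<phi> x)" using assms(4) sin_cos_nonneg by auto
  then show "- (a x * (sin (\<phi> x) * cos (\<phi> x))) \<le> 0" using a_pos[of x] by simp
qed

lemma flux_decay:
  assumes "wall_system a \<phi> y S" "c \<le> d" "{c..d} \<subseteq> S" "0 \<le> m"
    "\<And>x. x \<in> {c..d} \<Longrightarrow> m \<le> sin (\<phi> x) * cos (\<phi> x)"
  shows "y d - y c \<le> - (a0 * m) * (d - c)"
proof (rule AC_increment_le[OF _ assms(2,3)])
  show "has_AC_deriv y (\<lambda>x. - (a x * (sin (\<phi> x) * cos (\<phi> x)))) S"
    using assms(1) by (simp add: wall_system_def)
  fix x assume "x \<in> {c..d}"
  then have "a0 * m \<le> a x * (sin (\<phi> x) * cos (\<phi> x))"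
    using assms(4,5) a_ge[of x] a0 by (intro mult_mono) auto
  then show "- (a x * (sin (\<phi> x) * cos (\<phi> x))) \<le> - (a0 * m)" by simp
qed

lemma angle_mono:
  assumes "wall_system a \<phi> y S" "c \<le> d" "{c..d} \<subseteq> S" "\<And>x. x \<in> {c..d} \<Longrightarrow> 0 \<le> y x"
  shows "\<phi> c \<le> \<phi> d"
proof (rule AC_mono[OF _ assms(2,3)])
  show "has_AC_deriv \<phi> (\<lambda>x. y x / a x) S" using assms(1) by (simp add: wall_system_def)
qed (use assms(4) a_pos in \<open>auto intro!: divide_nonneg_pos\<close>)

lemma angle_increment_ge:
  assumes "wall_system a \<phi> y S" "c \<le> d" "{c..d} \<subseteq> S" "0 \<le> m" "\<And>x. x \<in> {c..d} \<Longrightarrow> m \<le> y x"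
  shows "(m / A0) * (d - c) \<le> \<phi> d - \<phi> c"
proof (rule AC_increment_ge[OF _ assms(2,3)])
  show "has_AC_deriv \<phi> (\<lambda>x. y x / a x) S" using assms(1) by (simp add: wall_system_def)
  fix x assume "x \<in> {c..d}"
  then show "m / A0 \<le> y x / a x"
    using assms(4) assms(5)[of x] a_pos[of x] a_le[of x] by (intro frac_le) auto
qed

text \<open>The two ways in which a trajectory starting at \<open>\<phi> = 0\<close>, \<open>y > 0\<close> can leave the region
  \<open>\<phi> < \<pi>/2\<close>, \<open>y > 0\<close>. Shooting looks for an initial flux for which neither happens.\<close>

definition overshoots :: "(real \<Rightarrow> real) \<Rightarrow> (real \<Rightarrow> real) \<Rightarrow> bool" where
  "overshoots \<phi> y \<longleftrightarrow> (\<exists>x>0. pi / 2 < \<phi> x \<and> (\<forall>t\<in>{0..x}. 0 < y t))"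

definition turns_back :: "(real \<Rightarrow> real) \<Rightarrow> (real \<Rightarrow> real) \<Rightarrow> bool" where
  "turns_back \<phi> y \<longleftrightarrow> (\<exists>x>0. y x < 0 \<and> (\<forall>t\<in>{0..x}. \<phi> t < pi / 2))"

text \<open>Whichever of the two events comes first happens in the range where the other one
  excludes it.\<close>

lemma not_overshoots_and_turns_back: "\<not> (overshoots \<phi> y \<and> turns_back \<phi> y)"
proof
  assume "overshoots \<phi> y \<and> turns_back \<phi> y"
  then obtain s t where s: "s > 0" "pi / 2 < \<phi> s" "\<forall>r\<in>{0..s}. 0 < y r"
    and t: "t > 0" "y t < 0" "\<forall>r\<in>{0..t}. \<phi> r < pi / 2"
    by (auto simp: overshoots_def turns_back_def)
  have "s \<in> {0..t} \<or> t \<in> {0..s}" using s(1) t(1) by auto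
  then show False using s t by (meson less_asym)
qed

text \<open>The energy with \<open>k = a0\<close> does not increase until \<phi> first attains
  \<pi>/2 at some \<open>z\<close>, where it is at least a0^2; initially it is the square of
  \<open>y 0\<close>. This keeps the infimum of the overshooting fluxes positive.\<close>

lemma overshoots_initial_flux:
  assumes ws: "wall_system a \<phi> y {0..}" and "\<phi> 0 = 0" and "overshoots \<phi> y"
  shows "a0 \<le> y 0"
proof -
  obtain x where x: "x > 0" "pi / 2 < \<phi> x" "\<And>t. t \<in> {0..x} \<Longrightarrow> 0 < y t"
    using assms(3) by (auto simp: overshoots_def)
  obtain z where z: "0 \<le> z" "z \<le> x" "\<phi> z = pi / 2"
    using IVT'[of \<phi> 0 "pi / 2" x] wall_system_continuous(1)[OF ws, of 0 x] x assms(2) by auto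
  have mono: "\<phi> c \<le> \<phi> d" if "0 \<le> c" "c \<le> d" "d \<le> z" for c d
    by (rule angle_mono[OF ws that(2)]) (use that z x in \<open>auto intro: less_imp_le\<close>)
  have "(y z)\<^sup>2 + a0\<^sup>2 * (sin (\<phi> z))\<^sup>2 \<le> (y 0)\<^sup>2 + a0\<^sup>2 * (sin (\<phi> 0))\<^sup>2"
  proof (rule energy_antimono[OF ws z(1)])
    fix t assume t: "t \<in> {0..z}"
    then have "\<phi> 0 \<le> \<phi> t" "\<phi> t \<le> \<phi> z" using mono by auto
    then show "0 \<le> y t \<and> 0 \<le> \<phi> t \<and> \<phi> t \<le> pi / 2"
      using x(3)[of t] t z assms(2) by auto
  qed (use a0 a_ge in auto)
  then have "a0\<^sup>2 \<le> (y 0)\<^sup>2" using z assms(2) by (simp add: sin_pi_half) (smt (verit) zero_le_power2)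
  moreover have "0 < y 0" using x by auto
  ultimately show ?thesis using power2_le_imp_le[of a0 "y 0"] by simp
qed

text \<open>If \<phi>, once positive, stayed below \<pi>/2 - e, then sin \<phi> cos \<phi> would be
  bounded away from zero and the flux would decrease linearly until it is no longer positive. As
  \<phi> is monotone, this forces the limit \<pi>/2.\<close>

lemma trapped_imp_half_wall:
  assumes ws: "wall_system a \<phi> y {0..}" and phi0: "\<phi> 0 = 0"
    and tr: "\<And>x. 0 \<le> x \<Longrightarrow> 0 < y x \<and> \<phi> x < pi / 2"
  shows "half_wall a \<phi> y"
proof -
  have mono: "\<phi> c \<le> \<phi> d" if "0 \<le> c" "c \<le> d" for c d
    by (rule angle_mono[OF ws that(2)]) (use that tr in \<open>auto intro: less_imp_le\<close>)
  have nonneg: "0 \<le> \<phi> x" if "0 \<le> x" for x using mono[of 0 x] phi0 that by simp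
  have anti: "y d \<le> y c" if "0 \<le> c" "c \<le> d" for c d
  proof (rule flux_antimono[OF ws that(2)])
    show "{c..d} \<subseteq> {0..}" using that by auto
    fix x assume "x \<in> {c..d}"
    then show "0 \<le> \<phi> x \<and> \<phi> x \<le> pi / 2" using nonneg[of x] tr[of x] that by simp
  qed
  have "(y 1 / A0) * (1 - 0) \<le> \<phi> 1 - \<phi> 0"
    by (rule angle_increment_ge[OF ws]) (use anti[of _ 1] tr[of 1] in auto)
  moreover have "0 < y 1 / A0" using tr[of 1] A0_pos by simp
  ultimately have phi1: "0 < \<phi> 1" using phi0 by simp
  have "\<exists>x\<ge>0. pi / 2 - e < \<phi> x" if e: "0 < e" "e < pi / 2" for e
  proof (rule ccontr)
    assume "\<not> (\<exists>x\<ge>0. pi / 2 - e < \<phi> x)"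
    then have up: "\<phi> x \<le> pi / 2 - e" if "0 \<le> x" for x using that by force
    define m where "m = sin (\<phi> 1) * sin e"
    have m: "m > 0" using phi1 tr[of 1] e unfolding m_def by (intro mult_pos_pos sin_gt_zero) auto
    \<comment> \<open>At slope at most \<open>- (a0 * m)\<close> the flux \<open>y 1\<close> is used
      up over the length \<open>y 1 / (a0 * m)\<close>.\<close>
    define d where "d = 1 + y 1 / (a0 * m)"
    have d: "1 \<le> d" using tr[of 1] a0 m by (simp add: d_def less_imp_le)
    have "y d - y 1 \<le> - (a0 * m) * (d - 1)"
    proof (rule flux_decay[OF ws d])
      fix x assume x: "x \<in> {1..d}"
      have "sin (\<phi> 1) \<le> sin (\<phi> x)"
        using mono[of 1 x] x phi1 tr[of x] by (intro sin_monotone_2pi_le) auto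
      moreover have "sin e \<le> cos (\<phi> x)"
      proof -
        have "cos (pi / 2 - e) \<le> cos (\<phi> x)"
          using up[of x] nonneg[of x] x e by (intro cos_monotone_0_pi_le) auto
        then show ?thesis by (simp add: cos_diff)
      qed
      ultimately show "m \<le> sin (\<phi> x) * cos (\<phi> x)"
        unfolding m_def using e sin_cos_nonneg[of "\<phi> x"] sin_ge_zero[of e] nonneg[of x] tr[of x] x
        by (intro mult_mono) auto
    qed (use m in auto)
    then have "y d \<le> 0" using a0 m by (simp add: d_def)
    then show False using tr[of d] d by simp
  qed
  then have lim: "\<exists>x\<ge>0. pi / 2 - e < \<phi> x" if "0 < e" for e
    using that by (cases "e < pi / 2") (auto simp: not_less intro!: exI[of _ 1] intro: order_le_less_trans[OF _ phi1])
  have "(\<phi> \<longlongrightarrow> pi / 2) at_top"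
  proof (rule tendstoI)
    fix e :: real assume "e > 0"
    then obtain x where x: "x \<ge> 0" "pi / 2 - e < \<phi> x" using lim by blast
    have "dist (\<phi> t) (pi / 2) < e" if "x \<le> t" for t
      using mono[of x t] tr[of t] x that by (auto simp: dist_real_def)
    then show "\<forall>\<^sub>F x in at_top. dist (\<phi> x) (pi / 2) < e" unfolding eventually_at_top_linorder by blast
  qed
  then show ?thesis
    using ws phi0 nonneg tr by (auto simp: half_wall_def less_imp_le)
qed

text \<open>At the first exit \<open>z\<close> the trajectory leaves through the side \<phi> =
  \<pi>/2, through the side y = 0, or through the corner where both hold. The first two exits are
  transversal and continue into strict inequalities; the corner cannot be reached.\<close>

lemma not_trapped_imp:
  assumes ws: "wall_system a \<phi> y {0..}" and phi0: "\<phi> 0 = 0" and y0: "0 < y 0"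
    and esc: "0 \<le> x" "y x \<le> 0 \<or> pi / 2 \<le> \<phi> x"
  shows "overshoots \<phi> y \<or> turns_back \<phi> y"
proof -
  have cont: "continuous_on {0..} \<phi>" "continuous_on {0..} y"
    using ws has_AC_deriv_imp_continuous unfolding wall_system_def by blast+
  define S where "S = ({0..} \<inter> y -` {..0}) \<union> ({0..} \<inter> \<phi> -` {pi / 2..})"
  have "closed S"
    unfolding S_def using cont
    by (intro closed_Un continuous_closed_preimage) auto
  moreover have "x \<in> S" using esc by (auto simp: S_def)
  moreover have bdd: "bdd_below S" by (rule bdd_belowI[of _ 0]) (auto simp: S_def)
  ultimately have inf: "Inf S \<in> S" using closed_contains_Inf by blast
  define z where "z = Inf S"
  have z: "0 \<le> z" "y z \<le> 0 \<or> pi / 2 \<le> \<phi> z" using inf by (auto simp: z_def S_def)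
  have below: "0 < y t" "\<phi> t < pi / 2" if "0 \<le> t" "t < z" for t
  proof -
    have "t \<notin> S" using that cInf_lower[OF _ bdd, of t] by (auto simp: z_def)
    then show "0 < y t" "\<phi> t < pi / 2" using that by (auto simp: S_def)
  qed
  have z0: "0 < z" using z y0 phi0 pi_gt_zero by (cases "z = 0") auto
  have cz: "continuous_on {0..z} \<phi>" "continuous_on {0..z} y"
    using wall_system_continuous[OF ws, of 0 z] by auto
  have yz: "0 \<le> y z"
  proof (rule ccontr)
    assume n: "\<not> 0 \<le> y z"
    obtain t where t: "0 \<le> t" "t \<le> z" "y t = 0"
      using IVT2'[of y z 0 0] cz(2) n z y0 by auto
    then show False using below(1)[of t] n by (cases "t = z") auto
  qed
  have pz: "\<phi> z \<le> pi / 2"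
  proof (rule ccontr)
    assume n: "\<not> \<phi> z \<le> pi / 2"
    obtain t where t: "0 \<le> t" "t \<le> z" "\<phi> t = pi / 2"
      using IVT'[of \<phi> 0 "pi / 2" z] cz(1) n z phi0 by auto
    then show False using below(2)[of t] n by (cases "t = z") auto
  qed
  have y_nn: "0 \<le> y t" if "t \<in> {0..z}" for t
    using below(1)[of t] yz that by (cases "t = z") auto
  have mono: "\<phi> c \<le> \<phi> d" if "0 \<le> c" "c \<le> d" "d \<le> z" for c d
    by (rule angle_mono[OF ws that(2)]) (use that y_nn in auto)
  have range: "0 \<le> \<phi> t \<and> \<phi> t \<le> pi / 2" if "t \<in> {0..z}" for t
    using mono[of 0 t] mono[of t z] pz phi0 that by auto
  have anti: "y d \<le> y c" if "0 \<le> c" "c \<le> d" "d \<le> z" for c d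
    by (rule flux_antimono[OF ws that(2)]) (use that range in auto)
  consider "0 < y z" "\<phi> z = pi / 2" | "y z = 0" "\<phi> z < pi / 2" | "y z = 0" "\<phi> z = pi / 2"
    using z yz pz by linarith
  then show ?thesis
  proof cases
    case 1
    obtain e where e: "0 < e" "\<And>t. t \<in> {z..z+e} \<Longrightarrow> y z / 2 < y t"
      using continuous_pos_right[OF cont(2) z(1) 1(1)] by blast
    have "(y z / 2 / A0) * ((z + e) - z) \<le> \<phi> (z + e) - \<phi> z"
      by (rule angle_increment_ge[OF ws]) (use e z 1 in \<open>auto intro: less_imp_le\<close>)
    moreover have "0 < (y z / 2 / A0) * ((z + e) - z)" using e 1 A0_pos by simp
    ultimately have "pi / 2 < \<phi> (z + e)" using 1 by linarith
    moreover have "0 < y t" if "t \<in> {0..z+e}" for t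
      using below(1)[of t] e(2)[of t] that 1 by (cases "t < z") (auto intro: less_trans[of 0 "y z / 2"])
    ultimately show ?thesis using z0 e(1) unfolding overshoots_def by (intro disjI1 exI[of _ "z + e"]) auto
  next
    case 2
    \<comment> \<open>The flux crosses zero strictly only if sin \<phi> cos \<phi> is positive at
      \<open>z\<close>, so \<phi> must first be shown to have left \<open>0\<close>.\<close>
    have "(y (z/2) / A0) * (z/2 - 0) \<le> \<phi> (z/2) - \<phi> 0"
      by (rule angle_increment_ge[OF ws]) (use z0 anti[of _ "z/2"] below(1)[of "z/2"] in auto)
    moreover have "0 < (y (z/2) / A0) * (z/2 - 0)" using below(1)[of "z/2"] A0_pos z0 by simp
    ultimately have "0 < \<phi> z" using mono[of "z/2" z] z0 phi0 by linarith
    then have sc: "0 < sin (\<phi> z) * cos (\<phi> z)"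
      using 2 by (intro mult_pos_pos sin_gt_zero cos_gt_zero) auto
    have "continuous_on {0..} (\<lambda>t. sin (\<phi> t) * cos (\<phi> t))" by (intro continuous_intros cont)
    then obtain e where e: "0 < e"
      "\<And>t. t \<in> {z..z+e} \<Longrightarrow> sin (\<phi> z) * cos (\<phi> z) / 2 < sin (\<phi> t) * cos (\<phi> t)"
      using continuous_pos_right[of "\<lambda>t. sin (\<phi> t) * cos (\<phi> t)" z] z(1) sc by blast
    have "continuous_on {0..} (\<lambda>t. pi / 2 - \<phi> t)" by (intro continuous_intros cont)
    then obtain e' where e': "0 < e'" "\<And>t. t \<in> {z..z+e'} \<Longrightarrow> (pi / 2 - \<phi> z) / 2 < pi / 2 - \<phi> t"
      using continuous_pos_right[of "\<lambda>t. pi / 2 - \<phi> t" z] z(1) 2 by (metis diff_gt_0_iff_gt)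
    define r where "r = min e e'"
    have r: "0 < r" "r \<le> e" "r \<le> e'" using e e' by (auto simp: r_def)
    have "y (z + r) - y z \<le> - (a0 * (sin (\<phi> z) * cos (\<phi> z) / 2)) * ((z + r) - z)"
      by (rule flux_decay[OF ws]) (use r z sc e(2) in \<open>auto intro: less_imp_le\<close>)
    moreover have "0 < (a0 * (sin (\<phi> z) * cos (\<phi> z) / 2)) * ((z + r) - z)" using r a0 sc by simp
    ultimately have "y (z + r) < 0" using 2(1) unfolding minus_mult_left[symmetric] by linarith
    moreover have "\<phi> t < pi / 2" if "t \<in> {0..z+r}" for t
    proof (cases "t < z")
      case False
      then have "(pi / 2 - \<phi> z) / 2 < pi / 2 - \<phi> t" using e'(2)[of t] that r by auto
      moreover have "0 < (pi / 2 - \<phi> z) / 2" using 2 by simp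
      ultimately have "0 < pi / 2 - \<phi> t" by (rule less_trans[rotated])
      then show ?thesis by simp
    qed (use below(2) that in auto)
    ultimately show ?thesis using z0 r(1) unfolding turns_back_def by (intro disjI2 exI[of _ "z + r"]) auto
  next
    case 3
    \<comment> \<open>At the corner the energy with \<open>k = A0\<close> equals A0^2, so
      monotonicity of the energy gives y <= A0 cos \<phi> on all of \<open>{0..z}\<close>; the
      Gronwall bound then contradicts cos (\<phi> z) = 0.\<close>
    have "0 < cos (\<phi> z)"
    proof (rule cos_lower_bound[OF ws z(1) _ phi0])
      fix t assume t: "t \<in> {0..z}"
      have "(y t)\<^sup>2 + A0\<^sup>2 * (sin (\<phi> t))\<^sup>2 \<le> (y z)\<^sup>2 + A0\<^sup>2 * (sin (\<phi> z))\<^sup>2"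
        by (rule energy_mono[OF ws]) (use t range y_nn a_le in auto)
      then have "(y t)\<^sup>2 \<le> (A0 * cos (\<phi> t))\<^sup>2"
        using 3 by (simp add: power_mult_distrib cos_squared_eq right_diff_distrib)
      moreover have "0 \<le> A0 * cos (\<phi> t)" using range[OF t] A0_pos sin_cos_nonneg by simp
      ultimately have "y t \<le> A0 * cos (\<phi> t)" by (rule power2_le_imp_le)
      then show "0 \<le> \<phi> t \<and> \<phi> t \<le> pi / 2 \<and> 0 \<le> y t \<and> y t \<le> A0 * cos (\<phi> t)"
        using range[OF t] y_nn[OF t] by blast
    qed simp
    then show ?thesis using 3 by simp
  qed
qed

text \<open>Overshooting and turning back are mutually exclusive, and both are open conditions on
  the initial flux, because strict inequalities on a compact interval leave a margin. At the infimum
  of the overshooting fluxes neither holds: overshooting would persist below it, and turning back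
  would persist for overshooting fluxes just above it.\<close>

lemma half_wall_exists: "\<exists>\<phi> y. half_wall a \<phi> y"
proof -
  obtain \<Phi> Y where ws: "\<And>p. wall_system a (\<Phi> p) (Y p) {0..}"
    and phi0: "\<And>p. \<Phi> p 0 = 0" and Y0: "\<And>p. Y p 0 = p"
    and dep: "\<And>X. \<exists>C>0. \<forall>p q x. 0 \<le> x \<longrightarrow> x \<le> X \<longrightarrow>
        \<bar>\<Phi> p x - \<Phi> q x\<bar> \<le> C * \<bar>p - q\<bar> \<and> \<bar>Y p x - Y q x\<bar> \<le> C * \<bar>p - q\<bar>"
    using initial_value_problem by metis
  have near: "\<exists>d>0. \<forall>q. \<bar>p - q\<bar> < d \<longrightarrow> (\<forall>t\<in>{0..X}. \<bar>\<Phi> p t - \<Phi> q t\<bar> < m \<and> \<bar>Y p t - Y q t\<bar> < m)"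
    if m: "m > 0" for p X m
  proof -
    obtain C where C: "C > 0" "\<forall>p q x. 0 \<le> x \<longrightarrow> x \<le> X \<longrightarrow>
        \<bar>\<Phi> p x - \<Phi> q x\<bar> \<le> C * \<bar>p - q\<bar> \<and> \<bar>Y p x - Y q x\<bar> \<le> C * \<bar>p - q\<bar>" using dep by blast
    have "C * \<bar>p - q\<bar> < m" if "\<bar>p - q\<bar> < m / C" for q using that C(1) by (simp add: field_simps)
    then have "\<forall>q. \<bar>p - q\<bar> < m / C \<longrightarrow> (\<forall>t\<in>{0..X}. \<bar>\<Phi> p t - \<Phi> q t\<bar> < m \<and> \<bar>Y p t - Y q t\<bar> < m)"
      using C(2) by (meson atLeastAtMost_iff order_le_less_trans)
    moreover have "m / C > 0" using m C(1) by simp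
    ultimately show ?thesis by blast
  qed
  have open_over: "\<exists>d>0. \<forall>q. \<bar>p - q\<bar> < d \<longrightarrow> overshoots (\<Phi> q) (Y q)" if "overshoots (\<Phi> p) (Y p)" for p
  proof -
    obtain x where x: "x > 0" "pi / 2 < \<Phi> p x" "\<And>t. t \<in> {0..x} \<Longrightarrow> 0 < Y p t"
      using \<open>overshoots (\<Phi> p) (Y p)\<close> by (auto simp: overshoots_def)
    obtain m where m: "0 < m" "\<And>t. t \<in> {0..x} \<Longrightarrow> m \<le> Y p t"
      using continuous_pos_lower_bound[of 0 x "Y p"] wall_system_continuous(2)[OF ws, of 0 x p] x by auto
    define e where "e = min m (\<Phi> p x - pi / 2)"
    have e: "0 < e" "e \<le> m" "e \<le> \<Phi> p x - pi / 2" using m x by (auto simp: e_def)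
    obtain d where d: "d > 0" "\<And>q t. \<bar>p - q\<bar> < d \<Longrightarrow> t \<in> {0..x} \<Longrightarrow> \<bar>\<Phi> p t - \<Phi> q t\<bar> < e \<and> \<bar>Y p t - Y q t\<bar> < e"
      using near[OF e(1), of p x] by blast
    have "overshoots (\<Phi> q) (Y q)" if q: "\<bar>p - q\<bar> < d" for q
      unfolding overshoots_def
    proof (intro exI conjI ballI)
      show "pi / 2 < \<Phi> q x" using d(2)[OF q, of x] x e by auto
      show "0 < Y q t" if "t \<in> {0..x}" for t using d(2)[OF q that] m(2)[OF that] e by linarith
    qed (rule x)
    then show ?thesis using d(1) by blast
  qed
  have open_back: "\<exists>d>0. \<forall>q. \<bar>p - q\<bar> < d \<longrightarrow> turns_back (\<Phi> q) (Y q)" if "turns_back (\<Phi> p) (Y p)" for p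
  proof -
    obtain x where x: "x > 0" "Y p x < 0" "\<And>t. t \<in> {0..x} \<Longrightarrow> \<Phi> p t < pi / 2"
      using \<open>turns_back (\<Phi> p) (Y p)\<close> by (auto simp: turns_back_def)
    have "continuous_on {0..x} (\<lambda>t. pi / 2 - \<Phi> p t)"
      using wall_system_continuous(1)[OF ws, of 0 x p] by (intro continuous_intros) auto
    then obtain m where m: "0 < m" "\<And>t. t \<in> {0..x} \<Longrightarrow> m \<le> pi / 2 - \<Phi> p t"
      using continuous_pos_lower_bound[of 0 x "\<lambda>t. pi / 2 - \<Phi> p t"] x by auto
    define e where "e = min m (- Y p x)"
    have e: "0 < e" "e \<le> m" "e \<le> - Y p x" using m x by (auto simp: e_def)
    obtain d where d: "d > 0" "\<And>q t. \<bar>p - q\<bar> < d \<Longrightarrow> t \<in> {0..x} \<Longrightarrow> \<bar>\<Phi> p t - \<Phi> q t\<bar> < e \<and> \<bar>Y p t - Y q t\<bar> < e"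
      using near[OF e(1), of p x] by blast
    have "turns_back (\<Phi> q) (Y q)" if q: "\<bar>p - q\<bar> < d" for q
      unfolding turns_back_def
    proof (intro exI conjI ballI)
      show "Y q x < 0" using d(2)[OF q, of x] x e by auto
      show "\<Phi> q t < pi / 2" if "t \<in> {0..x}" for t using d(2)[OF q that] m(2)[OF that] e by linarith
    qed (rule x)
    then show ?thesis using d(1) by blast
  qed
  define A where "A = {p. overshoots (\<Phi> p) (Y p)}"
  have A_ge: "a0 \<le> p" if "p \<in> A" for p
    using overshoots_initial_flux[OF ws phi0, of p] that by (simp add: A_def Y0)
  \<comment> \<open>Over \<open>{0..1}\<close> the flux loses at most \<open>A0\<close>, so it stays
    above \<open>2 * A0\<close> and the angle grows by at least 2, which exceeds \<pi>/2.\<close>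
  have "3 * A0 \<in> A"
  proof -
    have Y_ge: "2 * A0 \<le> Y (3 * A0) t" if "t \<in> {0..1}" for t
    proof -
      have "- A0 * (t - 0) \<le> Y (3 * A0) t - Y (3 * A0) 0"
      proof (rule AC_increment_ge)
        show "has_AC_deriv (Y (3 * A0)) (\<lambda>x. - (a x * (sin (\<Phi> (3 * A0) x) * cos (\<Phi> (3 * A0) x)))) {0..}"
          using ws by (simp add: wall_system_def)
        fix s
        have "sin (\<Phi> (3 * A0) s) * cos (\<Phi> (3 * A0) s) \<le> 1"
          by (metis abs_le_D1 abs_mult abs_sin_le_one abs_cos_le_one abs_ge_zero mult_le_one)
        then have "a s * (sin (\<Phi> (3 * A0) s) * cos (\<Phi> (3 * A0) s)) \<le> a s * 1"
          using a_pos[of s] by (intro mult_left_mono) auto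
        then show "- A0 \<le> - (a s * (sin (\<Phi> (3 * A0) s) * cos (\<Phi> (3 * A0) s)))" using a_le[of s] by simp
      qed (use that in auto)
      moreover have "A0 * t \<le> A0" using that A0_pos by simp
      ultimately show ?thesis by (simp add: Y0)
    qed
    have "(2 * A0 / A0) * (1 - 0) \<le> \<Phi> (3 * A0) 1 - \<Phi> (3 * A0) 0"
      by (rule angle_increment_ge[OF ws]) (use Y_ge A0_pos in auto)
    then have "pi / 2 < \<Phi> (3 * A0) 1" using A0_pos phi0 pi_half_less_two by simp
    moreover have "\<forall>t\<in>{0..1}. 0 < Y (3 * A0) t" using Y_ge A0_pos by fastforce
    ultimately show ?thesis unfolding A_def overshoots_def by (auto intro!: exI[of _ 1])
  qed
  then have A_ne: "A \<noteq> {}" by blast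
  have bdd: "bdd_below A" using A_ge by (rule bdd_belowI)
  define p where "p = Inf A"
  have p: "a0 \<le> p" unfolding p_def using A_ne A_ge by (rule cInf_greatest)
  have notA: "\<not> overshoots (\<Phi> p) (Y p)"
  proof
    assume "overshoots (\<Phi> p) (Y p)"
    then obtain d where d: "d > 0" "\<And>q. \<bar>p - q\<bar> < d \<Longrightarrow> overshoots (\<Phi> q) (Y q)"
      using open_over by blast
    have "p - d / 2 \<in> A" using d by (simp add: A_def)
    then show False using cInf_lower[OF _ bdd] d(1) p_def by fastforce
  qed
  have notB: "\<not> turns_back (\<Phi> p) (Y p)"
  proof
    assume "turns_back (\<Phi> p) (Y p)"
    then obtain d where d: "d > 0" "\<And>q. \<bar>p - q\<bar> < d \<Longrightarrow> turns_back (\<Phi> q) (Y q)"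
      using open_back by blast
    obtain q where q: "q \<in> A" "q < p + d" using cInf_lessD[OF A_ne, of "p + d"] d(1) by (auto simp: p_def)
    have "p \<le> q" using cInf_lower[OF q(1) bdd] by (simp add: p_def)
    then have "turns_back (\<Phi> q) (Y q)" using d(2)[of q] q(2) by simp
    then show False using not_overshoots_and_turns_back q(1) by (auto simp: A_def)
  qed
  have "0 < Y p x \<and> \<Phi> p x < pi / 2" if "0 \<le> x" for x
    using not_trapped_imp[OF ws phi0 _ that, of p] notA notB p a0 Y0[of p] by force
  then have "half_wall a (\<Phi> p) (Y p)" by (rule trapped_imp_half_wall[OF ws phi0])
  then show ?thesis by blast
qed

end


section \<open>Calibration on the half line\<close>

lemma integral_exhausting_half_line:
  fixes F :: "real \<Rightarrow> real"
  assumes F: "F absolutely_integrable_on {0..}"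
    and c: "\<And>n. 0 \<le> c n" "c \<longlonglongrightarrow> 0" and d: "filterlim d at_top sequentially"
  shows "(\<lambda>n. integral {c n..d n} F) \<longlonglongrightarrow> integral {0..} F"
proof -
  \<comment> \<open>For \<open>c n > 0\<close> the truncated functions vanish at \<open>0\<close>
    and would miss the value \<open>F 0\<close>, so that value is set to zero beforehand.\<close>
  define h where "h x = (if x = 0 then 0 else F x)" for x
  define f where "f n x = (if x \<in> {c n..d n} then h x else 0)" for n x
  have h: "h absolutely_integrable_on {0..}"
    by (rule absolutely_integrable_spike[OF F, of "{0}"]) (auto simp: h_def)
  have h_eq: "integral S h = integral S F" for S
    by (rule integral_spike[of "{0}"]) (auto simp: h_def)
  have sub: "{c n..d n} \<subseteq> {0..}" for n using c(1)[of n] by auto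
  have int: "integral {0..} (f n) = integral {c n..d n} h" for n
    unfolding f_def
    using Henstock_Kurzweil_Integration.integral_restrict_Int[of "{0..}" "{c n..d n}" h]
      sub[of n] by (simp only: Int_absorb2)
  have "(\<lambda>n. integral {0..} (f n)) \<longlonglongrightarrow> integral {0..} h"
  proof (rule dominated_convergence[where h = "\<lambda>x. \<bar>h x\<bar>"])
    show "f n integrable_on {0..}" for n
    proof -
      have "h integrable_on {c n..d n}"
        using absolutely_integrable_on_subinterval[OF h sub] by (simp add: absolutely_integrable_on_def)
      then show ?thesis
        unfolding f_def using integrable_restrict_Int[of "{c n..d n}" h "{0..}"]
        unfolding Int_absorb2[OF sub] by (simp only:)
    qed
    show "(\<lambda>x. \<bar>h x\<bar>) integrable_on {0..}" using h by (simp add: absolutely_integrable_on_def)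
    show "norm (f n x) \<le> \<bar>h x\<bar>" for n x by (simp add: f_def)
    fix x :: real assume x: "x \<in> {0..}"
    show "(\<lambda>n. f n x) \<longlonglongrightarrow> h x"
    proof (cases "x = 0")
      case True
      then have "f n x = h x" for n by (simp add: f_def h_def)
      then show ?thesis by simp
    next
      case False
      then have "\<forall>\<^sub>F n in sequentially. c n < x" using order_tendstoD(2)[OF c(2), of x] x by simp
      moreover have "\<forall>\<^sub>F n in sequentially. x \<le> d n" using d by (simp add: filterlim_at_top)
      ultimately have "\<forall>\<^sub>F n in sequentially. f n x = h x" by eventually_elim (simp add: f_def)
      then show ?thesis by (rule tendsto_eventually)
    qed
  qed
  then show ?thesis by (simp add: int h_eq)
qed

lemma nonneg_absolutely_integrable_half_line:
  fixes F :: "real \<Rightarrow> real"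
  assumes F: "\<And>d. F absolutely_integrable_on {0..d}" and nn: "\<And>x. 0 \<le> x \<Longrightarrow> 0 \<le> F x"
    and B: "\<And>d. 0 \<le> d \<Longrightarrow> integral {0..d} F \<le> B"
  shows "F absolutely_integrable_on {0..}"
proof (rule nonnegative_absolutely_integrable_1)
  define f where "f n x = (if x \<in> {0..real n} then F x else 0)" for n x
  have int: "integral {0..} (f n) = integral {0..real n} F" "f n integrable_on {0..}" for n
  proof -
    have sub: "{0..real n} \<subseteq> {0..}" by auto
    show "integral {0..} (f n) = integral {0..real n} F"
      unfolding f_def 
      using Henstock_Kurzweil_Integration.integral_restrict_Int[of "{0..}" "{0..real n}" F] sub
      by (simp only: Int_absorb2)
    have "F integrable_on {0..real n}" using F[of "real n"] by (simp add: absolutely_integrable_on_def)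
    then show "f n integrable_on {0..}"
      unfolding f_def using integrable_restrict_Int[of "{0..real n}" F "{0..}"] sub by (simp add: Int_absorb2)
  qed
  have "F integrable_on {0..} \<and> (\<lambda>n. integral {0..} (f n)) \<longlonglongrightarrow> integral {0..} F"
  proof (rule monotone_convergence_increasing[OF int(2)])
    show "f n x \<le> f (Suc n) x" if "x \<in> {0..}" for n x using nn that by (auto simp: f_def)
    show "(\<lambda>n. f n x) \<longlonglongrightarrow> F x" if "x \<in> {0..}" for x
    proof -
      obtain n0 :: nat where n0: "x \<le> real n0" using real_arch_simple by blast
      have "\<forall>\<^sub>F n in sequentially. f n x = F x"
        using eventually_ge_at_top[of n0] by eventually_elim (use n0 that in \<open>auto simp: f_def\<close>)
      then show ?thesis by (rule tendsto_eventually)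
    qed
    have "\<bar>integral {0..} (f n)\<bar> \<le> B" for n
    proof -
      have "0 \<le> integral {0..real n} F" using F[of "real n"] nn by (intro integral_nonneg) (auto simp: absolutely_integrable_on_def)
      then show ?thesis using B[of "real n"] by (simp add: int)
    qed
    then show "bounded (range (\<lambda>n. integral {0..} (f n)))" by (auto simp: bounded_iff)
  qed
  then show "F integrable_on {0..}" by blast
qed (use nn in auto)

lemma integral_nonneg_eq_0_imp_AE:
  fixes F :: "real \<Rightarrow> real"
  assumes "F absolutely_integrable_on S" "\<And>x. x \<in> S \<Longrightarrow> 0 \<le> F x" "integral S F = 0"
  shows "AE x in lebesgue. x \<in> S \<longrightarrow> F x = 0"
proof -
  have "(LINT x:S|lebesgue. F x) = 0" using set_lebesgue_integral_eq_integral(2)[OF assms(1)] assms(3) by simp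
  then have "AE x in lebesgue. indicator S x *\<^sub>R F x = 0"
    using assms(1,2) unfolding set_lebesgue_integral_def set_integrable_def
    by (subst (asm) integral_nonneg_eq_0_iff_AE) (auto simp: indicator_def)
  then show ?thesis by eventually_elim (auto simp: indicator_def)
qed

context half_wall_solution
begin

lemma y_le_A0_cos: "0 \<le> x \<Longrightarrow> y x \<le> A0 * cos (\<phi> x)"
  using y_le_cos[of x A0] a_le A0_pos by simp

lemma a0_cos_le_y: "0 \<le> x \<Longrightarrow> a0 * cos (\<phi> x) \<le> y x"
  using y_ge_cos[of x a0] a_ge a0 by simp

text \<open>The density is written as 1 + tan^2, polynomial in the quotient, so that the identities
  built on it remain polynomial.\<close>

lemma AC_tan:
  "has_AC_deriv (\<lambda>x. sin (\<phi> x) / cos (\<phi> x)) (\<lambda>x. (1 + (sin (\<phi> x) / cos (\<phi> x))\<^sup>2) * (y x / a x)) {0..}"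
proof (rule has_AC_deriv_chain[OF AC_phi, where T = "{-(pi/2)<..<pi/2}" and f = "\<lambda>t. sin t / cos t"])
  show "\<phi> x \<in> {-(pi/2)<..<pi/2}" if "x \<in> {0..}" for x
    using phi_range(1)[of x] phi_less[of x] pi_gt_zero that by auto
  have c: "0 < cos t" if "t \<in> {-(pi/2)<..<pi/2}" for t
    using that by (auto intro!: cos_gt_zero_pi)
  then show "continuous_on {-(pi/2)<..<pi/2} (\<lambda>t. 1 + (sin t / cos t)\<^sup>2)"
    by (auto intro!: continuous_intros simp: less_imp_neq[symmetric])
  fix t :: real assume t: "t \<in> {-(pi/2)<..<pi/2}"
  have "((\<lambda>t. sin t / cos t) has_real_derivative (cos t * cos t - sin t * - sin t) / (cos t * cos t)) (at t within {-(pi/2)<..<pi/2})"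
    using c[OF t] by (auto intro!: derivative_eq_intros)
  moreover have "(C * C - S * - S) / (C * C) = 1 + (S / C)\<^sup>2" if "C \<noteq> 0" for S C :: real
    using that by (simp add: field_simps power2_eq_square)
  ultimately show "((\<lambda>t. sin t / cos t) has_real_derivative 1 + (sin t / cos t)\<^sup>2) (at t within {-(pi/2)<..<pi/2})"
    using c[OF t] by (metis less_irrefl)
qed simp

text \<open>The bound y <= A0 cos \<phi> compensates the blow-up of tan \<phi> at infinity. It
  controls the boundary terms of both the calibration and the stability argument.\<close>

lemma y_tan_le: assumes "0 \<le> x" shows "y x * (sin (\<phi> x) / cos (\<phi> x)) \<le> A0"
proof -
  have c: "0 < cos (\<phi> x)" "0 \<le> sin (\<phi> x)" "sin (\<phi> x) \<le> 1"
    using cos_pos[OF assms] phi_range[OF assms] sin_cos_nonneg by auto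
  have "y x / cos (\<phi> x) * sin (\<phi> x) \<le> A0 * 1"
    using y_le_A0_cos[OF assms] c A0_pos by (intro mult_mono) (auto simp: field_simps)
  then show ?thesis by simp
qed

definition energy_density :: "real \<Rightarrow> real" where
  "energy_density x = a x * (y x / a x)\<^sup>2 + a x * (cos (\<phi> x))\<^sup>2"

lemma energy_density_locally_integrable: "energy_density absolutely_integrable_on {0..d}"
proof -
  have c: "continuous_on {0..d} y" "continuous_on {0..d} \<phi>" using wall_system_continuous[OF ws, of 0 d] by auto
  have "(\<lambda>x. (y x)\<^sup>2 / a x + a x * (cos (\<phi> x))\<^sup>2) absolutely_integrable_on {0..d}"
    by (intro set_integral_add a_div_integrable a_mult_integrable absolutely_integrable_continuous_real
        continuous_intros c) auto
  moreover have "(\<lambda>x. (y x)\<^sup>2 / a x + a x * (cos (\<phi> x))\<^sup>2) = energy_density"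
    using a_pos by (auto simp: energy_density_def power2_eq_square fun_eq_iff less_imp_neq[symmetric])
  ultimately show ?thesis by simp
qed

text \<open>The density is at most a constant times cos^2 \<phi>, which is at most cos \<phi> and
  hence, by the lower bound on the flux, at most a constant times y / a. The latter integrates to
  the increment of \<phi>, which is at most \<pi>/2.\<close>

lemma energy_density_integrable: "energy_density absolutely_integrable_on {0..}"
proof -
  define C where "C = (A0\<^sup>2 / a0 + A0) * (A0 / a0)"
  have le: "energy_density x \<le> C * (y x / a x)" if x: "0 \<le> x" for x
  proof -
    have c: "0 \<le> cos (\<phi> x)" "cos (\<phi> x) \<le> 1" using cos_pos[OF x] by auto
    have "(y x)\<^sup>2 \<le> (A0 * cos (\<phi> x))\<^sup>2" using y_le_A0_cos[OF x] y_nonneg[OF x] by (rule power_mono)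
    then have "(y x)\<^sup>2 / a x \<le> (A0 * cos (\<phi> x))\<^sup>2 / a0" using a_pos[of x] a_ge[of x] a0 by (intro frac_le) auto
    moreover have "a x * (cos (\<phi> x))\<^sup>2 \<le> A0 * (cos (\<phi> x))\<^sup>2" using a_le by (intro mult_right_mono) auto
    ultimately have "energy_density x \<le> (A0\<^sup>2 / a0 + A0) * (cos (\<phi> x))\<^sup>2"
      using a_pos[of x] by (simp add: energy_density_def power2_eq_square algebra_simps)
    also have "\<dots> \<le> (A0\<^sup>2 / a0 + A0) * (A0 / a0 * (y x / a x))"
    proof (rule mult_left_mono)
      have "(cos (\<phi> x))\<^sup>2 \<le> cos (\<phi> x)" using c by (simp add: power2_eq_square mult_left_le)
      also have "\<dots> \<le> y x / a0" using a0_cos_le_y[OF x] a0 by (simp add: field_simps)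
      also have "\<dots> \<le> y x / a0 * (A0 / a x)"
      proof -
        have "y x / a0 * 1 \<le> y x / a0 * (A0 / a x)"
          using a_le[of x] a_pos[of x] y_nonneg[OF x] a0 by (intro mult_left_mono) auto
        then show ?thesis by simp
      qed
      finally show "(cos (\<phi> x))\<^sup>2 \<le> A0 / a0 * (y x / a x)" by (simp add: mult_ac)
    qed (use a0 A0_pos in auto)
    finally show ?thesis by (simp add: C_def mult_ac)
  qed
  have C0: "0 \<le> C" using a0 A0_pos by (simp add: C_def)
  show ?thesis
  proof (rule nonneg_absolutely_integrable_half_line[where B = "C * (pi / 2)"])
    show "energy_density absolutely_integrable_on {0..d}" for d by (rule energy_density_locally_integrable)
    show "0 \<le> energy_density x" for x using a_pos[of x] by (simp add: energy_density_def)
    show "integral {0..d} energy_density \<le> C * (pi / 2)" if d: "0 \<le> d" for d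
    proof -
      have 1: "(\<lambda>x. y x / a x) integrable_on {0..d}" "integral {0..d} (\<lambda>x. y x / a x) = \<phi> d"
        using has_AC_derivD(2,3)[OF AC_phi d] by auto
      have "integral {0..d} energy_density \<le> integral {0..d} (\<lambda>x. C * (y x / a x))"
        using energy_density_locally_integrable[of d] integrable_cmul[OF 1(1), of C] le
        by (intro integral_le) (auto simp: absolutely_integrable_on_def)
      also have "\<dots> = C * \<phi> d" using 1(2) by (simp only: Henstock_Kurzweil_Integration.integral_mult_right)
      also have "\<dots> \<le> C * (pi / 2)" using phi_range(2)[OF d] C0 by (rule mult_left_mono)
      finally show ?thesis .
    qed
  qed
qed

text \<open>On \<open>{0..1}\<close> both cos \<phi> and \<open>y\<close> are at least their values
  at 1, which bounds the slope of sin \<phi> from below. It limits cot \<phi> to order 1/x in the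
  boundary term at \<open>0\<close>.\<close>

lemma sin_phi_ge_linear:
  obtains k where "0 < k" "\<And>x. 0 \<le> x \<Longrightarrow> x \<le> 1 \<Longrightarrow> k * x \<le> sin (\<phi> x)"
proof
  define k where "k = cos (\<phi> 1) * (y 1 / A0)"
  show "0 < k" using cos_pos[of 1] y_pos[of 1] A0_pos by (simp add: k_def)
  have S: "has_AC_deriv (\<lambda>x. sin (\<phi> x)) (\<lambda>x. cos (\<phi> x) * (y x / a x)) {0..}"
    by (rule has_AC_deriv_chain[OF AC_phi, where T = UNIV]) (auto intro!: derivative_eq_intros continuous_intros)
  fix x :: real assume x: "0 \<le> x" "x \<le> 1"
  have "k * (x - 0) \<le> sin (\<phi> x) - sin (\<phi> 0)"
  proof (rule AC_increment_ge[OF S x(1)])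
    fix t assume t: "t \<in> {0..x}"
    have "cos (\<phi> 1) \<le> cos (\<phi> t)"
      using phi_mono[of t 1] phi_range[of t] phi_range[of 1] t x pi_ge_zero by (intro cos_monotone_0_pi_le) auto
    moreover have "y 1 / A0 \<le> y t / a t"
      using y_antimono[of t 1] y_nonneg[of 1] t x a_pos[of t] a_le[of t] by (intro frac_le) auto
    ultimately show "k \<le> cos (\<phi> t) * (y t / a t)"
      unfolding k_def using cos_pos[of t] y_nonneg[of 1] A0_pos t by (intro mult_mono) auto
  qed auto
  then show "k * x \<le> sin (\<phi> x)" by simp
qed

lemma phi_lim_0: "(\<phi> \<longlongrightarrow> 0) (at_right 0)"
proof -
  have "continuous_on {0..} \<phi>" using has_AC_deriv_imp_continuous[OF AC_phi] by simp
  then have "(\<phi> \<longlongrightarrow> \<phi> 0) (at 0 within {0..})" unfolding continuous_on_def by (rule bspec) simp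
  then have "(\<phi> \<longlongrightarrow> \<phi> 0) (at_right 0)" by (rule tendsto_within_subset) auto
  then show ?thesis by simp
qed

end

section \<open>Comparison of the half-line solution with an arbitrary competitor of finite
  energy\<close>

locale half_wall_competitor = half_wall_solution +
  fixes f g :: "real \<Rightarrow> real"
  assumes AC_f: "has_AC_deriv f g {0..}" and f0: "f 0 = 0" and f_lim: "(f \<longlongrightarrow> pi / 2) at_top"
    and f_energy: "(\<lambda>x. a x * (g x)\<^sup>2 + a x * (cos (f x))\<^sup>2) absolutely_integrable_on {0..}"
begin

text \<open>The boundary term of the completed square below.\<close>

definition calibration :: "real \<Rightarrow> real" where
  "calibration x = y x * ((sin (f x))\<^sup>2 * (cos (\<phi> x) / sin (\<phi> x)) - (cos (f x))\<^sup>2 * (sin (\<phi> x) / cos (\<phi> x)))"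

text \<open>Up to the weights \<open>sin\<^sup>2 \<phi>\<close> and \<open>cos\<^sup>2 \<phi>\<close> the two squares are those of the derivatives of
  \<open>sin f / sin \<phi>\<close> and \<open>cos f / cos \<phi>\<close>.\<close>

definition excess :: "real \<Rightarrow> real" where
  "excess x =
     a x * (cos (f x) * g x - sin (f x) * (cos (\<phi> x) / sin (\<phi> x)) * (y x / a x))\<^sup>2 +
     a x * (sin (f x) * g x - cos (f x) * (sin (\<phi> x) / cos (\<phi> x)) * (y x / a x))\<^sup>2"

text \<open>Picone's identity for sin f against sin \<phi> and for cos f against cos \<phi>, added
  up. \<open>G\<close> and \<open>q\<close> are the slopes of competitor and solution,
  \<open>A * q\<close> is the flux, and the right-hand side is the derivative of
  \<open>calibration\<close>. The quotients enter through \<open>s * ct = c\<close> and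
  \<open>c * tn = s\<close>, so that the claim is polynomial.\<close>

lemma excess_identity:
  fixes S C s c ct tn A G q :: real
  assumes "S\<^sup>2 + C\<^sup>2 = 1" "s\<^sup>2 + c\<^sup>2 = 1" "s * ct = c" "c * tn = s"
  shows "A * G\<^sup>2 + A * C\<^sup>2 - (A * q\<^sup>2 + A * c\<^sup>2) - (A * (C * G - S * ct * q)\<^sup>2 + A * (S * G - C * tn * q)\<^sup>2)
    = - (A * (s * c)) * (S\<^sup>2 * ct - C\<^sup>2 * tn)
      + A * q * ((2 * S * (C * G)) * ct - S\<^sup>2 * ((1 + ct\<^sup>2) * q) + (2 * C * (S * G)) * tn - C\<^sup>2 * ((1 + tn\<^sup>2) * q))"
  using assms by algebra

lemma calibration_AC:
  assumes "0 < c"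
  shows "has_AC_deriv calibration
    (\<lambda>x. (a x * (g x)\<^sup>2 + a x * (cos (f x))\<^sup>2) - energy_density x - excess x) {c..d}"
proof -
  let ?q = "\<lambda>x. y x / a x" and ?ct = "\<lambda>x. cos (\<phi> x) / sin (\<phi> x)" and ?tn = "\<lambda>x. sin (\<phi> x) / cos (\<phi> x)"
  have sub: "{c..d} \<subseteq> {0..}" using assms by auto
  note F = has_AC_deriv_subset[OF AC_f sub] and P = has_AC_deriv_subset[OF AC_phi sub]
    and Y = has_AC_deriv_subset[OF AC_y sub]
  have rng: "\<phi> x \<in> {0<..<pi/2}" if "x \<in> {c..d}" for x
    using phi_pos[of x] phi_less[of x] assms that by auto
  have sc: "0 < sin t" "0 < cos t" if "t \<in> {0<..<pi/2}" for t
    using that by (auto intro!: sin_gt_zero cos_gt_zero)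
  have 1: "has_AC_deriv (\<lambda>x. (sin (f x))\<^sup>2) (\<lambda>x. (2 * sin (f x) * cos (f x)) * g x) {c..d}"
    by (rule has_AC_deriv_chain[OF F, where T = UNIV and f = "\<lambda>t. (sin t)\<^sup>2"])
      (auto intro!: derivative_eq_intros continuous_intros)
  have 2: "has_AC_deriv (\<lambda>x. (cos (f x))\<^sup>2) (\<lambda>x. (- 2 * cos (f x) * sin (f x)) * g x) {c..d}"
    by (rule has_AC_deriv_chain[OF F, where T = UNIV and f = "\<lambda>t. (cos t)\<^sup>2"])
      (auto intro!: derivative_eq_intros continuous_intros)
  have cot_identity: "(- S * S - C * C) / (S * S) = - (1 + (C / S)\<^sup>2)" if "S \<noteq> 0" for S C :: real
    using that by (simp add: field_simps power2_eq_square)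
  have 3: "has_AC_deriv ?ct (\<lambda>x. - (1 + (?ct x)\<^sup>2) * ?q x) {c..d}"
  proof (rule has_AC_deriv_chain[OF P, where T = "{0<..<pi/2}" and f = "\<lambda>t. cos t / sin t"])
    fix t :: real assume t: "t \<in> {0<..<pi/2}"
    have "((\<lambda>t. cos t / sin t) has_real_derivative (- sin t * sin t - cos t * cos t) / (sin t * sin t)) (at t within {0<..<pi/2})"
      using sc[OF t] by (auto intro!: derivative_eq_intros)
    moreover have "(- sin t * sin t - cos t * cos t) / (sin t * sin t) = - (1 + (cos t / sin t)\<^sup>2)"
      using cot_identity[of "sin t" "cos t"] sc[OF t] by fastforce
    ultimately show "((\<lambda>t. cos t / sin t) has_real_derivative - (1 + (cos t / sin t)\<^sup>2)) (at t within {0<..<pi/2})" by simp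
  qed (use rng sc in \<open>auto intro!: continuous_intros simp: less_imp_neq[symmetric]\<close>)
  note 4 = has_AC_deriv_subset[OF AC_tan sub]
  note D = has_AC_deriv_mult[OF Y has_AC_deriv_diff[OF has_AC_deriv_mult[OF 1 3] has_AC_deriv_mult[OF 2 4]]]
  show ?thesis
  proof (rule has_AC_deriv_cong[OF D])
    fix x assume x: "x \<in> {c..d}"
    have s: "sin (\<phi> x) \<noteq> 0" "cos (\<phi> x) \<noteq> 0" "a x \<noteq> 0" using sc[OF rng[OF x]] a_pos[of x] by auto
    let ?S = "sin (f x)" and ?C = "cos (f x)" and ?s = "sin (\<phi> x)" and ?c = "cos (\<phi> x)"
    have yq: "y x = a x * ?q x" using s by simp
    have "a x * (g x)\<^sup>2 + a x * ?C\<^sup>2 - energy_density x - excess x =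
      - (a x * (?s * ?c)) * (?S\<^sup>2 * ?ct x - ?C\<^sup>2 * ?tn x)
      + a x * ?q x * ((2 * ?S * (?C * g x)) * ?ct x - ?S\<^sup>2 * ((1 + (?ct x)\<^sup>2) * ?q x)
         + (2 * ?C * (?S * g x)) * ?tn x - ?C\<^sup>2 * ((1 + (?tn x)\<^sup>2) * ?q x))"
      unfolding energy_density_def excess_def
      by (rule excess_identity) (use s in auto)
    also have "\<dots> = - (a x * (?s * ?c)) * (?S\<^sup>2 * ?ct x - ?C\<^sup>2 * ?tn x) + y x *
        (2 * ?S * ?C * g x * ?ct x + ?S\<^sup>2 * (- (1 + (?ct x)\<^sup>2) * ?q x) -
         (- 2 * ?C * ?S * g x * ?tn x + ?C\<^sup>2 * ((1 + (?tn x)\<^sup>2) * ?q x)))"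
      unfolding yq[symmetric] by (simp only: mult_minus_left mult_minus_right mult.assoc) (simp add: algebra_simps)
    finally show "- (a x * (?s * ?c)) * (?S\<^sup>2 * ?ct x - ?C\<^sup>2 * ?tn x) + y x *
        (2 * ?S * ?C * g x * ?ct x + ?S\<^sup>2 * (- (1 + (?ct x)\<^sup>2) * ?q x) -
         (- 2 * ?C * ?S * g x * ?tn x + ?C\<^sup>2 * ((1 + (?tn x)\<^sup>2) * ?q x)))
      = a x * (g x)\<^sup>2 + a x * ?C\<^sup>2 - energy_density x - excess x" by (rule sym)
  qed (simp add: calibration_def)
qed

lemma excess_nonneg: "0 \<le> excess x"
  using a_pos[of x] by (simp add: excess_def)

lemma excess_integral:
  assumes "0 < c" "c \<le> d"
  shows "excess absolutely_integrable_on {c..d}"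
    "integral {c..d} excess = integral {c..d} (\<lambda>x. a x * (g x)\<^sup>2 + a x * (cos (f x))\<^sup>2)
       - integral {c..d} energy_density - (calibration d - calibration c)"
proof -
  let ?E = "\<lambda>x. a x * (g x)\<^sup>2 + a x * (cos (f x))\<^sup>2"
  let ?K = "\<lambda>x. ?E x - energy_density x - excess x"
  have sub: "{c..d} \<subseteq> {0..}" using assms by auto
  have 1: "?E absolutely_integrable_on {c..d}" by (rule absolutely_integrable_on_subinterval[OF f_energy sub])
  have 2: "energy_density absolutely_integrable_on {c..d}"
    by (rule absolutely_integrable_on_subinterval[OF energy_density_integrable sub])
  note 3 = has_AC_derivD[OF calibration_AC[OF assms(1)] assms(2) order_refl]
  have "(\<lambda>x. (?E x - energy_density x) - ?K x) absolutely_integrable_on {c..d}"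
    by (rule set_integral_diff(1)[OF set_integral_diff(1)[OF 1 2] 3(1)])
  then show "excess absolutely_integrable_on {c..d}" by simp
  have i: "?E integrable_on {c..d}" "energy_density integrable_on {c..d}"
    using 1 2 by (simp_all add: absolutely_integrable_on_def)
  have "integral {c..d} (\<lambda>x. (?E x - energy_density x) - ?K x) =
     integral {c..d} (\<lambda>x. ?E x - energy_density x) - integral {c..d} ?K"
    by (rule Henstock_Kurzweil_Integration.integral_diff[OF integrable_diff[OF i] 3(2)])
  also have "integral {c..d} (\<lambda>x. ?E x - energy_density x) = integral {c..d} ?E - integral {c..d} energy_density"
    by (rule Henstock_Kurzweil_Integration.integral_diff[OF i])
  finally show "integral {c..d} excess = integral {c..d} ?E - integral {c..d} energy_density - (calibration d - calibration c)"
    using 3(3) by simp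
qed

text \<open>In the first term the flux and cot \<phi> both tend to zero. In the second, y tan \<phi>
  stays bounded and cos f tends to zero.\<close>

lemma calibration_lim_top: "(calibration \<longlongrightarrow> 0) at_top"
proof -
  have "((\<lambda>x. y x * ((sin (f x))\<^sup>2 * (cos (\<phi> x) / sin (\<phi> x)))) \<longlongrightarrow> 0 * ((sin (pi / 2))\<^sup>2 * (cos (pi / 2) / sin (pi / 2)))) at_top"
    by (intro tendsto_intros y_lim f_lim phi_lim) simp
  moreover have "((\<lambda>x. y x * ((cos (f x))\<^sup>2 * (sin (\<phi> x) / cos (\<phi> x)))) \<longlongrightarrow> 0) at_top"
  proof (rule Lim_null_comparison)
    show "\<forall>\<^sub>F x in at_top. norm (y x * ((cos (f x))\<^sup>2 * (sin (\<phi> x) / cos (\<phi> x)))) \<le> A0 * (cos (f x))\<^sup>2"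
      using eventually_ge_at_top[of 0]
    proof eventually_elim
      case (elim x)
      have c: "0 < cos (\<phi> x)" "0 \<le> y x" "0 \<le> sin (\<phi> x)"
        using cos_pos y_nonneg phi_range[OF elim] sin_cos_nonneg elim by auto
      have "(y x * (sin (\<phi> x) / cos (\<phi> x))) * (cos (f x))\<^sup>2 \<le> A0 * (cos (f x))\<^sup>2"
        using y_tan_le[OF elim] by (rule mult_right_mono) simp
      then show ?case using c by (simp add: abs_mult mult_ac)
    qed
    have "((\<lambda>x. A0 * (cos (f x))\<^sup>2) \<longlongrightarrow> A0 * (cos (pi / 2))\<^sup>2) at_top" by (intro tendsto_intros f_lim)
    then show "((\<lambda>x. A0 * (cos (f x))\<^sup>2) \<longlongrightarrow> 0) at_top" by simp
  qed
  ultimately have "((\<lambda>x. y x * ((sin (f x))\<^sup>2 * (cos (\<phi> x) / sin (\<phi> x))) - y x * ((cos (f x))\<^sup>2 * (sin (\<phi> x) / cos (\<phi> x)))) \<longlongrightarrow> 0 - 0) at_top"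
    by (intro tendsto_diff) simp_all
  then show ?thesis by (simp add: calibration_def[abs_def] right_diff_distrib)
qed

lemma g_sq_integrable: "(\<lambda>x. (g x)\<^sup>2) absolutely_integrable_on {0..d}"
proof -
  have "(\<lambda>x. a x * (g x)\<^sup>2 + a x * (cos (f x))\<^sup>2) absolutely_integrable_on {0..d}"
    by (rule absolutely_integrable_on_subinterval[OF f_energy]) auto
  moreover have "(\<lambda>x. a x * (cos (f x))\<^sup>2) absolutely_integrable_on {0..d}"
    by (intro a_mult_integrable absolutely_integrable_continuous_real continuous_intros
        has_AC_deriv_imp_continuous_Icc[OF AC_f]) auto
  ultimately have "(\<lambda>x. (a x * (g x)\<^sup>2 + a x * (cos (f x))\<^sup>2) - a x * (cos (f x))\<^sup>2) absolutely_integrable_on {0..d}"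
    by (rule set_integral_diff)
  then have "(\<lambda>x. a x * (g x)\<^sup>2 / a x) absolutely_integrable_on {0..d}" by (intro a_div_integrable) auto
  moreover have "a x * (g x)\<^sup>2 / a x = (g x)\<^sup>2" for x using a_pos[of x] by simp
  ultimately show ?thesis by simp
qed

text \<open>Cauchy-Schwarz for f as the integral of \<open>g\<close>, obtained by expanding the
  integral of (g - D)^2 with \<open>D\<close> the mean slope. The integral on the right tends to
  zero with \<open>x\<close>, so f^2 = o(x), which outweighs the order 1/x of cot \<phi>.\<close>

lemma f_sq_le: assumes "0 < x" shows "(f x)\<^sup>2 \<le> x * integral {0..x} (\<lambda>t. (g t)\<^sup>2)"
proof -
  define D where "D = f x / x"
  have gi: "g integrable_on {0..x}" "integral {0..x} g = f x"
    using has_AC_derivD(2,3)[OF AC_f, of 0 x] assms f0 by auto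
  have g2: "(\<lambda>t. (g t)\<^sup>2) integrable_on {0..x}" using g_sq_integrable by (simp add: absolutely_integrable_on_def)
  have "((\<lambda>t. (g t)\<^sup>2 - (2 * D) * g t + D\<^sup>2) has_integral
     integral {0..x} (\<lambda>t. (g t)\<^sup>2) - (2 * D) * f x + D\<^sup>2 * (x - 0)) {0..x}"
    using has_integral_const_real[of "D\<^sup>2" 0 x] assms gi(2)
    by (intro has_integral_add has_integral_diff has_integral_mult_right integrable_integral[OF g2])
      (use integrable_integral[OF gi(1)] in \<open>auto simp: mult.commute\<close>)
  then have "0 \<le> integral {0..x} (\<lambda>t. (g t)\<^sup>2) - (2 * D) * f x + D\<^sup>2 * (x - 0)"
  proof (rule has_integral_nonneg)
    fix t
    have "(g t)\<^sup>2 - (2 * D) * g t + D\<^sup>2 = (g t - D)\<^sup>2" by (simp add: power2_diff)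
    then show "0 \<le> (g t)\<^sup>2 - (2 * D) * g t + D\<^sup>2" by simp
  qed
  then show ?thesis using assms by (simp add: D_def power2_eq_square field_simps)
qed

text \<open>In the first term sin^2 f is o(x) while cot \<phi> is at most 1/(k x). The second term
  vanishes because tan \<phi> does.\<close>

lemma calibration_lim_0: "(calibration \<longlongrightarrow> 0) (at_right 0)"
proof -
  obtain k where k: "0 < k" "\<And>x. 0 \<le> x \<Longrightarrow> x \<le> 1 \<Longrightarrow> k * x \<le> sin (\<phi> x)" using sin_phi_ge_linear by blast
  have ev: "\<forall>\<^sub>F x in at_right 0. 0 < x \<and> x \<le> (1::real)"
    by (auto simp: eventually_at_right_field intro!: exI[of _ 1])
  have "((\<lambda>x. y x * ((sin (f x))\<^sup>2 * (cos (\<phi> x) / sin (\<phi> x)))) \<longlongrightarrow> 0) (at_right 0)"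
  proof (rule Lim_null_comparison)
    show "\<forall>\<^sub>F x in at_right 0. norm (y x * ((sin (f x))\<^sup>2 * (cos (\<phi> x) / sin (\<phi> x))))
        \<le> y 0 * (integral {0..x} (\<lambda>t. (g t)\<^sup>2) / k)"
      using ev
    proof eventually_elim
      case (elim x)
      then have x: "0 < x" "x \<le> 1" by auto
      have s: "0 < k * x" "k * x \<le> sin (\<phi> x)" using k x by auto
      have c: "0 < cos (\<phi> x)" "0 \<le> y x" "y x \<le> y 0" using cos_pos y_nonneg y_antimono[of 0 x] x by auto
      have "(sin (f x))\<^sup>2 \<le> (f x)\<^sup>2" using abs_sin_x_le_abs_x[of "f x"] by (simp add: abs_le_square_iff)
      also have "\<dots> \<le> x * integral {0..x} (\<lambda>t. (g t)\<^sup>2)" by (rule f_sq_le[OF x(1)])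
      finally have 1: "(sin (f x))\<^sup>2 \<le> x * integral {0..x} (\<lambda>t. (g t)\<^sup>2)" .
      have "(sin (f x))\<^sup>2 * (cos (\<phi> x) / sin (\<phi> x)) \<le> (x * integral {0..x} (\<lambda>t. (g t)\<^sup>2)) * (1 / (k * x))"
        using 1 s c by (intro mult_mono frac_le) (auto intro: order_trans[OF zero_le_power2])
      also have "\<dots> = integral {0..x} (\<lambda>t. (g t)\<^sup>2) / k" using x k by simp
      finally have 2: "(sin (f x))\<^sup>2 * (cos (\<phi> x) / sin (\<phi> x)) \<le> integral {0..x} (\<lambda>t. (g t)\<^sup>2) / k" .
      have 3: "0 \<le> (sin (f x))\<^sup>2 * (cos (\<phi> x) / sin (\<phi> x))"
        using c s by (intro mult_nonneg_nonneg divide_nonneg_pos) auto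
      then have "y x * ((sin (f x))\<^sup>2 * (cos (\<phi> x) / sin (\<phi> x))) \<le> y 0 * (integral {0..x} (\<lambda>t. (g t)\<^sup>2) / k)"
        using 2 c by (intro mult_mono) auto
      then show ?case using mult_nonneg_nonneg[OF c(2) 3] by (simp only: real_norm_def abs_of_nonneg)
    qed
    have "continuous_on {0..1} (\<lambda>x. integral {0..x} (\<lambda>t. (g t)\<^sup>2))"
      using g_sq_integrable by (intro indefinite_integral_continuous_1) (simp add: absolutely_integrable_on_def)
    then have "((\<lambda>x. integral {0..x} (\<lambda>t. (g t)\<^sup>2)) \<longlongrightarrow> 0) (at 0 within {0..1})"
      by (auto simp: continuous_on_def dest!: bspec[of _ _ 0])
    then have "((\<lambda>x. integral {0..x} (\<lambda>t. (g t)\<^sup>2)) \<longlongrightarrow> 0) (at_right 0)"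
      by (simp add: at_within_Icc_at_right)
    then have "((\<lambda>x. y 0 * (integral {0..x} (\<lambda>t. (g t)\<^sup>2) / k)) \<longlongrightarrow> y 0 * (0 / k)) (at_right 0)"
      using k(1) by (intro tendsto_intros) auto
    then show "((\<lambda>x. y 0 * (integral {0..x} (\<lambda>t. (g t)\<^sup>2) / k)) \<longlongrightarrow> 0) (at_right 0)" by simp
  qed
  moreover have "((\<lambda>x. y x * ((cos (f x))\<^sup>2 * (sin (\<phi> x) / cos (\<phi> x)))) \<longlongrightarrow> 0) (at_right 0)"
  proof (rule Lim_null_comparison)
    show "\<forall>\<^sub>F x in at_right 0. norm (y x * ((cos (f x))\<^sup>2 * (sin (\<phi> x) / cos (\<phi> x)))) \<le> y 0 * (sin (\<phi> x) / cos (\<phi> x))"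
      using ev
    proof eventually_elim
      case (elim x)
      then have x: "0 \<le> x" by auto
      have c: "0 < cos (\<phi> x)" "0 \<le> y x" "y x \<le> y 0" "0 \<le> sin (\<phi> x)"
        using cos_pos y_nonneg y_antimono[of 0 x] phi_range[OF x] sin_cos_nonneg x by auto
      have "(cos (f x))\<^sup>2 * (sin (\<phi> x) / cos (\<phi> x)) \<le> 1 * (sin (\<phi> x) / cos (\<phi> x))"
        using c by (intro mult_right_mono divide_nonneg_pos) (auto simp: abs_square_le_1)
      then have "y x * ((cos (f x))\<^sup>2 * (sin (\<phi> x) / cos (\<phi> x))) \<le> y 0 * (sin (\<phi> x) / cos (\<phi> x))"
        using c by (intro mult_mono) auto
      moreover have "0 \<le> y x * ((cos (f x))\<^sup>2 * (sin (\<phi> x) / cos (\<phi> x)))" using c by (intro mult_nonneg_nonneg divide_nonneg_pos) auto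
      ultimately show ?case by (simp only: real_norm_def abs_of_nonneg)
    qed
    have "((\<lambda>x. y 0 * (sin (\<phi> x) / cos (\<phi> x))) \<longlongrightarrow> y 0 * (sin 0 / cos 0)) (at_right 0)"
      by (intro tendsto_intros phi_lim_0) simp
    then show "((\<lambda>x. y 0 * (sin (\<phi> x) / cos (\<phi> x))) \<longlongrightarrow> 0) (at_right 0)" by simp
  qed
  ultimately have "((\<lambda>x. y x * ((sin (f x))\<^sup>2 * (cos (\<phi> x) / sin (\<phi> x))) - y x * ((cos (f x))\<^sup>2 * (sin (\<phi> x) / cos (\<phi> x)))) \<longlongrightarrow> 0 - 0) (at_right 0)"
    by (rule tendsto_diff)
  then show ?thesis by (simp add: calibration_def[abs_def] right_diff_distrib)
qed

lemma excess_lim: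
  "(\<lambda>n. integral {1 / real (Suc n)..real (Suc n)} excess) \<longlonglongrightarrow>
     integral {0..} (\<lambda>x. a x * (g x)\<^sup>2 + a x * (cos (f x))\<^sup>2) - integral {0..} energy_density"
proof -
  let ?E = "\<lambda>x. a x * (g x)\<^sup>2 + a x * (cos (f x))\<^sup>2"
  have r: "filterlim (\<lambda>n. 1 / real (Suc n)) (at_right 0) sequentially"
    unfolding filterlim_at using LIMSEQ_inverse_real_of_nat
    by (auto simp: divide_inverse)
  have r': "(\<lambda>n. 1 / real (Suc n)) \<longlonglongrightarrow> 0" using r by (simp add: filterlim_at)
  have t: "filterlim (\<lambda>n. real (Suc n)) at_top sequentially"
    by (rule filterlim_compose[OF filterlim_real_sequentially filterlim_Suc])
  have "(\<lambda>n. integral {1 / real (Suc n)..real (Suc n)} ?E - integral {1 / real (Suc n)..real (Suc n)} energy_density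
      - (calibration (real (Suc n)) - calibration (1 / real (Suc n)))) \<longlonglongrightarrow>
     integral {0..} ?E - integral {0..} energy_density - (0 - 0)"
    by (intro tendsto_diff integral_exhausting_half_line f_energy energy_density_integrable t r'
        filterlim_compose[OF calibration_lim_top t] filterlim_compose[OF calibration_lim_0 r]) auto
  moreover have "integral {1 / real (Suc n)..real (Suc n)} excess =
     integral {1 / real (Suc n)..real (Suc n)} ?E - integral {1 / real (Suc n)..real (Suc n)} energy_density
      - (calibration (real (Suc n)) - calibration (1 / real (Suc n)))" for n
    by (rule excess_integral(2)) (auto simp: field_simps)
  ultimately show ?thesis by simp
qed

lemma half_energy_le:
  "integral {0..} energy_density \<le> integral {0..} (\<lambda>x. a x * (g x)\<^sup>2 + a x * (cos (f x))\<^sup>2)"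
proof -
  have "0 \<le> integral {1 / real (Suc n)..real (Suc n)} excess" for n
  proof -
    have "excess absolutely_integrable_on {1 / real (Suc n)..real (Suc n)}"
      by (rule excess_integral(1)) (auto simp: field_simps)
    then show ?thesis by (intro integral_nonneg) (auto simp: absolutely_integrable_on_def excess_nonneg)
  qed
  then show ?thesis using LIMSEQ_le_const[OF excess_lim, of 0] by simp
qed

text \<open>The integrals of \<open>excess\<close> over the growing intervals \<open>I n\<close> are
  non-negative, non-decreasing and tend to zero, so each of them is zero.\<close>

lemma half_energy_eq_imp_excess_0:
  assumes eq: "integral {0..} energy_density = integral {0..} (\<lambda>x. a x * (g x)\<^sup>2 + a x * (cos (f x))\<^sup>2)"
  shows "AE x in lebesgue. 0 < x \<longrightarrow> excess x = 0"
proof -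
  define I where "I n = {1 / real (Suc n)..real (Suc n)}" for n
  have int: "excess absolutely_integrable_on I n" for n
    unfolding I_def by (rule excess_integral(1)) (auto simp: field_simps)
  then have int': "excess integrable_on I n" for n by (simp add: absolutely_integrable_on_def)
  have "incseq (\<lambda>n. integral (I n) excess)"
  proof (rule incseq_SucI)
    fix n
    have "I n \<subseteq> I (Suc n)"
      by (auto simp: I_def intro: order_trans[rotated] simp: frac_le)
    then show "integral (I n) excess \<le> integral (I (Suc n)) excess"
      by (rule integral_subset_le[OF _ int' int']) (use excess_nonneg in auto)
  qed
  moreover have lim: "(\<lambda>n. integral (I n) excess) \<longlonglongrightarrow> 0"
    using excess_lim eq by (simp add: I_def)
  ultimately have "integral (I n) excess \<le> 0" for n by (rule incseq_le)
  moreover have "0 \<le> integral (I n) excess" for n using int' excess_nonneg by (intro integral_nonneg) auto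
  ultimately have "integral (I n) excess = 0" for n by (meson order_antisym)
  then have "AE x in lebesgue. x \<in> I n \<longrightarrow> excess x = 0" for n
    by (intro integral_nonneg_eq_0_imp_AE[OF int] excess_nonneg)
  then have "AE x in lebesgue. \<forall>n. x \<in> I n \<longrightarrow> excess x = 0" by (rule AE_all_countable[THEN iffD2, OF allI])
  then show ?thesis
  proof eventually_elim
    case (elim x)
    show ?case
    proof
      assume x: "0 < x"
      obtain n :: nat where n: "max x (1 / x) \<le> real n" using real_arch_simple by blast
      then have 1: "x \<le> real (Suc n)" "1 / x \<le> real (Suc n)" by auto
      then have "1 / real (Suc n) \<le> x" using x by (simp add: field_simps)
      then show "excess x = 0" using elim 1 by (auto simp: I_def)
    qed
  qed
qed

lemma AE_derivative_0_imp_const: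
  assumes "has_AC_deriv u h S" "AE x in lebesgue. x \<in> S \<longrightarrow> h x = 0" "c \<le> d" "{c..d} \<subseteq> S"
  shows "u d = u c"
  using has_AC_derivD(3)[OF has_AC_deriv_cong_AE[OF assms(1), of "\<lambda>_. 0"] assms(3,4)] assms(2) by simp

text \<open>Vanishing excess makes both quotients constant. The constant for the cosines is read off
  at \<open>0\<close>; for the sines, which both vanish at \<open>0\<close>, it has to be read off
  in the limit at infinity.\<close>

lemma half_energy_eq_imp_eq:
  assumes eq: "integral {0..} energy_density = integral {0..} (\<lambda>x. a x * (g x)\<^sup>2 + a x * (cos (f x))\<^sup>2)"
    and x: "0 \<le> x"
  shows "f x = \<phi> x"
proof -
  have z: "AE x in lebesgue. 0 < x \<longrightarrow>
      cos (f x) * g x = sin (f x) * (cos (\<phi> x) / sin (\<phi> x)) * (y x / a x) \<and>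
      sin (f x) * g x = cos (f x) * (sin (\<phi> x) / cos (\<phi> x)) * (y x / a x)"
    using half_energy_eq_imp_excess_0[OF eq]
  proof eventually_elim
    case (elim x)
    show ?case
    proof
      assume "0 < x"
      then have "excess x = 0" using elim by simp
      then show "cos (f x) * g x = sin (f x) * (cos (\<phi> x) / sin (\<phi> x)) * (y x / a x) \<and>
        sin (f x) * g x = cos (f x) * (sin (\<phi> x) / cos (\<phi> x)) * (y x / a x)"
        using a_pos[of x] unfolding excess_def
        by (subst (asm) add_nonneg_eq_0_iff) auto
    qed
  qed
  have z0: "AE x in lebesgue. x \<noteq> (0::real)"
    unfolding eventually_ae_filter_negligible by (intro exI[of _ "{0}"]) auto
  have AC_sin: "has_AC_deriv (\<lambda>x. sin (h x)) (\<lambda>x. cos (h x) * h' x) {0..}"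
    and AC_cos: "has_AC_deriv (\<lambda>x. cos (h x)) (\<lambda>x. - sin (h x) * h' x) {0..}"
    if "has_AC_deriv h h' {0..}" for h h'
    by (rule has_AC_deriv_chain[OF that, where T = UNIV]; auto intro!: derivative_eq_intros continuous_intros)+
  have AC_inv: "has_AC_deriv (\<lambda>x. inverse (h x)) (\<lambda>x. - (inverse (h x) * inverse (h x)) * h' x) S"
    if "has_AC_deriv h h' S" "\<And>x. x \<in> S \<Longrightarrow> 0 < h x" for h h' and S :: "real set"
    by (rule has_AC_deriv_chain[OF that(1), where T = "{0<..}"])
      (use that(2) in \<open>auto intro!: derivative_eq_intros continuous_intros\<close>)
  have quotient_rule_cos: "(- S * G) * inverse c + C * (- (inverse c * inverse c) * (- s * q)) = 0"
    if "S * G = C * (s / c) * q" for S G c C s q :: real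
    unfolding mult_minus_left that by (simp add: divide_inverse mult_ac)
  have quotient_rule_sin: "(C * G) * inverse s + S * (- (inverse s * inverse s) * (c * q)) = 0"
    if "C * G = S * (c / s) * q" for S G c C s q :: real
    unfolding that by (simp add: divide_inverse mult_ac)
  have cos_eq: "cos (f x) = cos (\<phi> x)" if x: "0 \<le> x" for x
  proof -
    have "has_AC_deriv (\<lambda>x. cos (f x) * inverse (cos (\<phi> x)))
      (\<lambda>x. (- sin (f x) * g x) * inverse (cos (\<phi> x)) +
         cos (f x) * (- (inverse (cos (\<phi> x)) * inverse (cos (\<phi> x))) * (- sin (\<phi> x) * (y x / a x)))) {0..}"
      by (intro has_AC_deriv_mult AC_inv AC_cos AC_f AC_phi) (use cos_pos in auto)
    moreover have "AE x in lebesgue. x \<in> {0..} \<longrightarrow> (- sin (f x) * g x) * inverse (cos (\<phi> x)) +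
         cos (f x) * (- (inverse (cos (\<phi> x)) * inverse (cos (\<phi> x))) * (- sin (\<phi> x) * (y x / a x))) = 0"
      using z z0
    proof eventually_elim
      case (elim x)
      show ?case
      proof
        assume "x \<in> {0..}"
        then have "sin (f x) * g x = cos (f x) * (sin (\<phi> x) / cos (\<phi> x)) * (y x / a x)" using elim by auto
        then show "(- sin (f x) * g x) * inverse (cos (\<phi> x)) +
         cos (f x) * (- (inverse (cos (\<phi> x)) * inverse (cos (\<phi> x))) * (- sin (\<phi> x) * (y x / a x))) = 0"
          by (rule quotient_rule_cos)
      qed
    qed
    ultimately have "cos (f x) * inverse (cos (\<phi> x)) = cos (f 0) * inverse (cos (\<phi> 0))"
      by (rule AE_derivative_0_imp_const) (use x in auto)
    then show ?thesis using f0 cos_pos[OF x] by (simp add: field_simps)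
  qed
  have sin_const: "sin (f d) * inverse (sin (\<phi> d)) = sin (f c) * inverse (sin (\<phi> c))" if cd: "0 < c" "c \<le> d" for c d
  proof -
    have sub: "{0<..} \<subseteq> {0::real..}" by auto
    have sp: "0 < sin (\<phi> x)" if "x \<in> {0<..}" for x
      using phi_pos[of x] phi_less[of x] that by (intro sin_gt_zero) auto
    have "has_AC_deriv (\<lambda>x. sin (f x) * inverse (sin (\<phi> x)))
      (\<lambda>x. (cos (f x) * g x) * inverse (sin (\<phi> x)) +
         sin (f x) * (- (inverse (sin (\<phi> x)) * inverse (sin (\<phi> x))) * (cos (\<phi> x) * (y x / a x)))) {0<..}"
      by (intro has_AC_deriv_mult AC_inv has_AC_deriv_subset[OF AC_sin[OF AC_f] sub]
          has_AC_deriv_subset[OF AC_sin[OF AC_phi] sub] sp)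
    moreover have "AE x in lebesgue. x \<in> {0<..} \<longrightarrow> (cos (f x) * g x) * inverse (sin (\<phi> x)) +
         sin (f x) * (- (inverse (sin (\<phi> x)) * inverse (sin (\<phi> x))) * (cos (\<phi> x) * (y x / a x))) = 0"
      using z
    proof eventually_elim
      case (elim x)
      show ?case
      proof
        assume "x \<in> {0<..}"
        then have "cos (f x) * g x = sin (f x) * (cos (\<phi> x) / sin (\<phi> x)) * (y x / a x)" using elim by auto
        then show "(cos (f x) * g x) * inverse (sin (\<phi> x)) +
         sin (f x) * (- (inverse (sin (\<phi> x)) * inverse (sin (\<phi> x))) * (cos (\<phi> x) * (y x / a x))) = 0"
          by (rule quotient_rule_sin)
      qed
    qed
    ultimately show ?thesis by (rule AE_derivative_0_imp_const) (use cd in auto)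
  qed
  have sin_eq: "sin (f x) = sin (\<phi> x)" if x: "0 < x" for x
  proof -
    have "((\<lambda>d. sin (f d) * inverse (sin (\<phi> d))) \<longlongrightarrow> sin (pi / 2) * inverse (sin (pi / 2))) at_top"
      by (intro tendsto_intros f_lim phi_lim) simp
    moreover have "((\<lambda>d. sin (f d) * inverse (sin (\<phi> d))) \<longlongrightarrow> sin (f x) * inverse (sin (\<phi> x))) at_top"
    proof (rule tendsto_eventually)
      show "\<forall>\<^sub>F d in at_top. sin (f d) * inverse (sin (\<phi> d)) = sin (f x) * inverse (sin (\<phi> x))"
        using eventually_ge_at_top[of x] by eventually_elim (rule sin_const[OF x])
    qed
    ultimately have "sin (pi / 2) * inverse (sin (pi / 2)) = sin (f x) * inverse (sin (\<phi> x))"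
      by (rule tendsto_unique[OF trivial_limit_at_top_linorder])
    then have "sin (f x) * inverse (sin (\<phi> x)) = 1" by simp
    moreover have "0 < sin (\<phi> x)" using phi_pos[of x] phi_less[of x] x by (intro sin_gt_zero) auto
    ultimately show ?thesis by (simp add: field_simps)
  qed
  \<comment> \<open>Equal sines and cosines determine \<open>f\<close> only up to multiples of
    2\<pi>. The slopes are compared instead, so that f - \<phi> is constant and the common value at
    \<open>0\<close> decides.\<close>
  have "AE x in lebesgue. x \<in> {0..} \<longrightarrow> g x - y x / a x = 0"
    using z z0
  proof eventually_elim
    case (elim x)
    show ?case
    proof
      assume "x \<in> {0..}"
      then have x: "0 < x" using elim by auto
      have nz: "sin (\<phi> x) \<noteq> 0" "cos (\<phi> x) \<noteq> 0"
        using sin_gt_zero[of "\<phi> x"] phi_pos[of x] phi_less[of x] cos_pos[of x] x by auto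
      have 1: "cos (\<phi> x) * g x = cos (\<phi> x) * (y x / a x)" "sin (\<phi> x) * g x = sin (\<phi> x) * (y x / a x)"
        using elim x cos_eq[of x] sin_eq[of x] nz by auto
      then have "g x = y x / a x" using mult_left_cancel[OF nz(1)] by blast
      then show "g x - y x / a x = 0" by simp
    qed
  qed
  then have "f x - \<phi> x = f 0 - \<phi> 0"
    by (rule AE_derivative_0_imp_const[OF has_AC_deriv_diff[OF AC_f AC_phi]]) (use x in auto)
  then show ?thesis using f0 by simp
qed

end


section \<open>Solutions on the whole line\<close>

lemma integral_AE_cong:
  fixes f g :: "real \<Rightarrow> real"
  assumes "AE x in lebesgue. x \<in> S \<longrightarrow> f x = g x"
  shows "integral S f = integral S g"
proof -
  obtain N where N: "negligible N" "{x. \<not> (x \<in> S \<longrightarrow> f x = g x)} \<subseteq> N"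
    using assms unfolding eventually_ae_filter_negligible by blast
  show ?thesis by (rule integral_spike[OF N(1)]) (use N(2) in fastforce)
qed

lemma absolutely_integrable_AE_cong:
  fixes f g :: "real \<Rightarrow> real"
  assumes "f absolutely_integrable_on S" "AE x in lebesgue. x \<in> S \<longrightarrow> f x = g x"
  shows "g absolutely_integrable_on S"
proof -
  obtain N where N: "negligible N" "{x. \<not> (x \<in> S \<longrightarrow> f x = g x)} \<subseteq> N"
    using assms(2) unfolding eventually_ae_filter_negligible by blast
  show ?thesis by (rule absolutely_integrable_spike[OF assms(1) N(1)]) (use N(2) in fastforce)
qed

lemma AE_neq_0: "AE x in lebesgue. x \<noteq> (0::real)"
  unfolding eventually_ae_filter_negligible by (intro exI[of _ "{0}"]) auto

lemma has_AC_deriv_glue: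
  assumes "has_AC_deriv u g {0..}" "has_AC_deriv u g {..0}"
  shows "has_AC_deriv u g UNIV"
  unfolding has_AC_deriv_def
proof (intro allI impI)
  fix c d :: real assume cd: "c \<le> d" "{c..d} \<subseteq> UNIV"
  consider "0 \<le> c" | "d \<le> 0" | "c < 0" "0 < d" by linarith
  then show "g absolutely_integrable_on {c..d} \<and> integral {c..d} g = u d - u c"
  proof cases
    case 1
    then show ?thesis using has_AC_derivD(1,3)[OF assms(1) cd(1)] by simp
  next
    case 2
    then show ?thesis using has_AC_derivD(1,3)[OF assms(2) cd(1)] by simp
  next
    case 3
    have 1: "g absolutely_integrable_on {c..0}" "integral {c..0} g = u 0 - u c"
      using has_AC_derivD(1,3)[OF assms(2), of c 0] 3 by auto
    have 2: "g absolutely_integrable_on {0..d}" "integral {0..d} g = u d - u 0"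
      using has_AC_derivD(1,3)[OF assms(1), of 0 d] 3 by auto
    have g: "g absolutely_integrable_on {c..d}"
      using absolutely_integrable_Un[OF 1(1) 2(1)] 3 by (simp add: ivl_disj_un_two_touch)
    have "integral {c..0} g + integral {0..d} g = integral {c..d} g"
      using 3 g by (intro Henstock_Kurzweil_Integration.integral_combine) (auto simp: absolutely_integrable_on_def)
    then show ?thesis using g 1 2 by simp
  qed
qed

section \<open>Transfer between the two half lines by reflection, and the energy on the whole
  line\<close>

lemma has_AC_deriv_reflect_right:
  assumes "has_AC_deriv u g {..0}" shows "has_AC_deriv (\<lambda>x. - u (- x)) (\<lambda>x. g (- x)) {0..}"
  using has_AC_deriv_reflect[OF assms] by simp

lemma has_AC_deriv_reflect_left:
  assumes "has_AC_deriv u g {0..}" shows "has_AC_deriv (\<lambda>x. - u (- x)) (\<lambda>x. g (- x)) {..0}"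
  using has_AC_deriv_reflect[OF assms] by simp

lemma half_line_reflect:
  fixes F :: "real \<Rightarrow> real"
  shows "(\<lambda>x. F (- x)) absolutely_integrable_on {0..} \<longleftrightarrow> F absolutely_integrable_on {..0}"
    "F absolutely_integrable_on {..0} \<Longrightarrow> integral {0..} (\<lambda>x. F (- x)) = integral {..0} F"
  using has_absolute_integral_reflect_real[of "{0..}" "{..0}" F] by auto

lemma integral_UNIV_split:
  fixes F :: "real \<Rightarrow> real"
  assumes "F absolutely_integrable_on UNIV"
  shows "F absolutely_integrable_on {0..}" "F absolutely_integrable_on {..0}"
    "integral UNIV F = integral {0..} F + integral {..0} F"
proof -
  show 1: "F absolutely_integrable_on {0..}" "F absolutely_integrable_on {..0}"
    using set_integrable_subset[OF assms] by auto
  have "{0..} \<inter> {..0} = {0::real}" "{0..} \<union> {..0} = (UNIV :: real set)" by auto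
  then show "integral UNIV F = integral {0..} F + integral {..0} F"
    using 1 Henstock_Kurzweil_Integration.integral_Un[of F "{0..}" "{..0}"] by (simp add: absolutely_integrable_on_def)
qed

lemma absolutely_integrable_UNIV_iff: "F absolutely_integrable_on UNIV \<longleftrightarrow> integrable lebesgue F"
  for F :: "real \<Rightarrow> real"
  by (simp add: set_integrable_def)

lemma tendsto_reflect_at_top:
  fixes u :: "real \<Rightarrow> real"
  shows "((\<lambda>x. - u (- x)) \<longlongrightarrow> c) at_top \<longleftrightarrow> (u \<longlongrightarrow> - c) at_bot"
  unfolding filterlim_at_bot_mirror using tendsto_minus_cancel_left[of "\<lambda>x. u (- x)" c at_top] by simp

context wall_coefficient
begin

lemma reflect: "wall_coefficient (\<lambda>x. a (- x)) a0 A0"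
proof
  \<comment> \<open>Measurability of the reflected coefficient is recovered from integrals:
    \<open>a\<close> is bounded, hence locally integrable, and reflection preserves local
    integrability, which in turn implies measurability.\<close>
  have "(\<lambda>x. a (- x)) \<in> borel_measurable lebesgue"
  proof (rule locally_integrable_imp_measurable)
    fix p q :: real
    have "a absolutely_integrable_on {-q..-p}"
      using a_mult_integrable[where g = "\<lambda>_. 1" and S = "{-q..-p}"] by simp
    then show "(\<lambda>x. a (- x)) absolutely_integrable_on {p..q}"
      using absolutely_integrable_reflect_real[where f = a and a = "-q" and b = "-p"] by simp
  qed
  then show "(\<lambda>x. a (- x)) \<in> borel_measurable lebesgue" .
qed (use a0 a_ge a_le in auto)

lemma flux_terms_integrable:
  assumes "has_AC_deriv \<phi> g UNIV"
  shows "(\<lambda>x. a x * g x) absolutely_integrable_on {p..q}"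
    "(\<lambda>x. a x * (sin (\<phi> x) * cos (\<phi> x))) absolutely_integrable_on {p..q}"
    "(\<lambda>x. - (a x * (sin (\<phi> x) * cos (\<phi> x)))) absolutely_integrable_on {p..q}"
proof -
  show "(\<lambda>x. a x * g x) absolutely_integrable_on {p..q}"
    by (rule a_mult_integrable[OF has_AC_deriv_locally_integrable[OF assms]]) simp
  have c: "continuous_on {p..q} \<phi>"
    using has_AC_deriv_imp_continuous[OF assms] continuous_on_subset by blast
  show 1: "(\<lambda>x. a x * (sin (\<phi> x) * cos (\<phi> x))) absolutely_integrable_on {p..q}"
    by (intro a_mult_integrable absolutely_integrable_continuous_real continuous_intros c) simp
  show "(\<lambda>x. - (a x * (sin (\<phi> x) * cos (\<phi> x)))) absolutely_integrable_on {p..q}"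
    using set_integral_diff(1)[OF absolutely_integrable_zero 1] by simp
qed

lemma energy_measurable:
  assumes "has_AC_deriv u g UNIV"
  shows "(\<lambda>x. a x * (g x)\<^sup>2 + a x * (cos (u x))\<^sup>2) \<in> borel_measurable lebesgue"
proof -
  have "u \<in> borel_measurable lebesgue" "g \<in> borel_measurable lebesgue"
    using has_AC_deriv_self_integrable[OF assms] has_AC_deriv_locally_integrable[OF assms]
    by (auto intro: locally_integrable_imp_measurable)
  moreover have "(cos :: real \<Rightarrow> real) \<in> borel_measurable borel" by (rule borel_measurable_continuous_onI[OF continuous_on_cos[OF continuous_on_id]])
  ultimately show ?thesis using meas by (intro borel_measurable_add borel_measurable_times borel_measurable_power)
      (auto intro: measurable_compose[of u lebesgue borel cos])
qed

lemma G_finite_iff: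
  assumes "has_AC_deriv u (weak_deriv u) UNIV"
  shows "G a u < \<infinity> \<longleftrightarrow> integrable lebesgue (\<lambda>x. a x * (weak_deriv u x)\<^sup>2 + a x * (cos (u x))\<^sup>2)"
    "G a u < \<infinity> \<Longrightarrow> G a u = ennreal (integral UNIV (\<lambda>x. a x * (weak_deriv u x)\<^sup>2 + a x * (cos (u x))\<^sup>2))"
proof -
  let ?E = "\<lambda>x. a x * (weak_deriv u x)\<^sup>2 + a x * (cos (u x))\<^sup>2"
  have nn: "0 \<le> ?E x" for x using a_pos[of x] by simp
  show iff: "G a u < \<infinity> \<longleftrightarrow> integrable lebesgue ?E"
    unfolding G_def
  proof
    assume "(\<integral>\<^sup>+ x. ennreal (?E x) \<partial>lebesgue) < \<infinity>"
    then show "integrable lebesgue ?E"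
      by (intro integrableI_nonneg energy_measurable[OF assms]) (use nn in auto)
  next
    assume "integrable lebesgue ?E"
    then show "(\<integral>\<^sup>+ x. ennreal (?E x) \<partial>lebesgue) < \<infinity>"
      using nn_integral_eq_integral[of lebesgue ?E] nn by simp
  qed
  assume "G a u < \<infinity>"
  then have i: "integrable lebesgue ?E" using iff by simp
  then have "G a u = ennreal (LINT x|lebesgue. ?E x)"
    unfolding G_def by (intro nn_integral_eq_integral) (use nn in auto)
  also have "(LINT x|lebesgue. ?E x) = integral UNIV ?E" using integral_lebesgue[OF i] by simp
  finally show "G a u = ennreal (integral UNIV ?E)" .
qed

end

lemma wall_system_reflect_right:
  assumes "wall_system a \<phi> y {..0}"
  shows "wall_system (\<lambda>x. a (- x)) (\<lambda>x. - \<phi> (- x)) (\<lambda>x. y (- x)) {0..}"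
  unfolding wall_system_def
proof
  show "has_AC_deriv (\<lambda>x. - \<phi> (- x)) (\<lambda>x. y (- x) / a (- x)) {0..}"
    using has_AC_deriv_reflect_right assms unfolding wall_system_def by blast
  have "has_AC_deriv (\<lambda>x. - y (- x)) (\<lambda>x. - (a (- x) * (sin (\<phi> (- x)) * cos (\<phi> (- x))))) {0..}"
    using has_AC_deriv_reflect_right assms unfolding wall_system_def by blast
  from has_AC_deriv_minus[OF this]
  show "has_AC_deriv (\<lambda>x. y (- x)) (\<lambda>x. - (a (- x) * (sin (- \<phi> (- x)) * cos (- \<phi> (- x))))) {0..}"
    by simp
qed

lemma wall_system_reflect_left:
  assumes "wall_system (\<lambda>x. a (- x)) (\<lambda>x. - \<phi> (- x)) y {0..}"
  shows "wall_system a \<phi> (\<lambda>x. y (- x)) {..0}"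
  unfolding wall_system_def
proof
  have "has_AC_deriv (\<lambda>x. - \<phi> (- x)) (\<lambda>x. y x / a (- x)) {0..}"
    using assms unfolding wall_system_def by blast
  from has_AC_deriv_reflect_left[OF this]
  show "has_AC_deriv \<phi> (\<lambda>x. y (- x) / a x) {..0}" by simp
  have "has_AC_deriv y (\<lambda>x. - (a (- x) * (sin (- \<phi> (- x)) * cos (- \<phi> (- x))))) {0..}"
    using assms unfolding wall_system_def by blast
  from has_AC_deriv_minus[OF has_AC_deriv_reflect_left[OF this]]
  show "has_AC_deriv (\<lambda>x. y (- x)) (\<lambda>x. - (a x * (sin (\<phi> x) * cos (\<phi> x)))) {..0}" by simp
qed

text \<open>A wall is a pair of half-line solutions, the left one reflected so that all one-sided
  results apply to it. The initial fluxes \<open>yr 0\<close> and \<open>yl 0\<close> are left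
  independent because the equation is not imposed at \<open>0\<close>.\<close>

locale wall_pair =
  R: half_wall_solution a a0 A0 \<phi> yr + L: half_wall_solution "\<lambda>x. a (- x)" a0 A0 "\<lambda>x. - \<phi> (- x)" yl
  for a a0 A0 \<phi> yr yl
begin

definition flux :: "real \<Rightarrow> real" where
  "flux x = (if 0 \<le> x then yr x else yl (- x))"

lemma flux_pos: "0 < flux x"
  using R.y_pos L.y_pos by (simp add: flux_def)

lemma AC_left: "has_AC_deriv \<phi> (\<lambda>x. yl (- x) / a x) {..0}"
  and AC_yl: "has_AC_deriv (\<lambda>x. yl (- x)) (\<lambda>x. - (a x * (sin (\<phi> x) * cos (\<phi> x)))) {..0}"
  using wall_system_reflect_left[OF L.ws] by (auto simp: wall_system_def)

lemma AC_flux: "has_AC_deriv \<phi> (\<lambda>x. flux x / a x) UNIV"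
proof (rule has_AC_deriv_glue)
  show "has_AC_deriv \<phi> (\<lambda>x. flux x / a x) {0..}"
    by (rule has_AC_deriv_cong[OF R.AC_phi]) (auto simp: flux_def)
  show "has_AC_deriv \<phi> (\<lambda>x. flux x / a x) {..0}"
    by (rule has_AC_deriv_cong_AE[OF AC_left]) (use AE_neq_0 in eventually_elim, auto simp: flux_def)
qed

lemma weak_deriv_flux: "AE x in lebesgue. weak_deriv \<phi> x = flux x / a x"
  and AC_weak: "has_AC_deriv \<phi> (weak_deriv \<phi>) UNIV"
  using has_AC_deriv_weak_deriv[OF AC_flux] by auto

lemma flux_AE: "AE x in lebesgue. a x * weak_deriv \<phi> x = flux x"
  using weak_deriv_flux by eventually_elim (use R.a_pos in \<open>auto simp: less_imp_neq[symmetric]\<close>)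

lemma flux_le: "flux x \<le> max (yr 0) (yl 0)"
  using R.y_antimono[of 0 x] L.y_antimono[of 0 "- x"] by (auto simp: flux_def)

lemma energy_integrable:
  "integrable lebesgue (\<lambda>x. a x * (weak_deriv \<phi> x)\<^sup>2 + a x * (cos (\<phi> x))\<^sup>2)" (is "integrable lebesgue ?E")
  and energy_right: "integral {0..} (\<lambda>x. a x * (weak_deriv \<phi> x)\<^sup>2 + a x * (cos (\<phi> x))\<^sup>2) = integral {0..} R.energy_density"
  and energy_left: "integral {..0} (\<lambda>x. a x * (weak_deriv \<phi> x)\<^sup>2 + a x * (cos (\<phi> x))\<^sup>2) = integral {0..} L.energy_density"
proof -
  have r: "AE x in lebesgue. x \<in> {0..} \<longrightarrow> ?E x = R.energy_density x"
    using weak_deriv_flux by eventually_elim (auto simp: flux_def R.energy_density_def)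
  have l: "AE x in lebesgue. x \<in> {..0} \<longrightarrow> ?E x = L.energy_density (- x)"
    using weak_deriv_flux AE_neq_0 by eventually_elim (auto simp: flux_def L.energy_density_def)
  have l_int: "(\<lambda>x. L.energy_density (- x)) absolutely_integrable_on {..0}"
    using half_line_reflect(1)[of "\<lambda>x. L.energy_density (- x)"] L.energy_density_integrable by simp
  show "integral {0..} ?E = integral {0..} R.energy_density" by (rule integral_AE_cong[OF r])
  have "integral {..0} ?E = integral {..0} (\<lambda>x. L.energy_density (- x))" by (rule integral_AE_cong[OF l])
  also have "\<dots> = integral {0..} L.energy_density" using half_line_reflect(2)[OF l_int] by simp
  finally show "integral {..0} ?E = integral {0..} L.energy_density" .
  have "?E absolutely_integrable_on {0..}"
    by (rule absolutely_integrable_AE_cong[OF R.energy_density_integrable]) (use r in \<open>eventually_elim, simp\<close>)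
  moreover have "?E absolutely_integrable_on {..0}"
    by (rule absolutely_integrable_AE_cong[OF l_int]) (use l in \<open>eventually_elim, simp\<close>)
  ultimately have "?E absolutely_integrable_on ({0..} \<union> {..0})" by (rule absolutely_integrable_Un)
  moreover have "{0..} \<union> {..0} = (UNIV :: real set)" by auto
  ultimately show "integrable lebesgue ?E" by (simp add: set_integrable_def)
qed

lemma weak_deriv_L2: "weak_deriv \<phi> \<in> L2 UNIV"
proof -
  have m: "weak_deriv \<phi> \<in> borel_measurable lebesgue"
    by (rule locally_integrable_imp_measurable[OF has_AC_deriv_locally_integrable[OF AC_weak]])
  have "integrable lebesgue (\<lambda>x. (a x * (weak_deriv \<phi> x)\<^sup>2 + a x * (cos (\<phi> x))\<^sup>2) / a0)"
    using energy_integrable by (rule integrable_divide_zero)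
  then have "integrable lebesgue (\<lambda>x. (weak_deriv \<phi> x)\<^sup>2)"
  proof (rule Bochner_Integration.integrable_bound)
    have "(weak_deriv \<phi> x)\<^sup>2 \<le> (a x * (weak_deriv \<phi> x)\<^sup>2 + a x * (cos (\<phi> x))\<^sup>2) / a0" for x
    proof -
      have "a0 * (weak_deriv \<phi> x)\<^sup>2 \<le> a x * (weak_deriv \<phi> x)\<^sup>2" using R.a_ge by (intro mult_right_mono) auto
      moreover have "0 \<le> a x * (cos (\<phi> x))\<^sup>2" using R.a_pos[of x] by simp
      ultimately show ?thesis using R.a0 by (simp add: field_simps)
    qed
    then show "AE x in lebesgue. norm ((weak_deriv \<phi> x)\<^sup>2)
       \<le> norm ((a x * (weak_deriv \<phi> x)\<^sup>2 + a x * (cos (\<phi> x))\<^sup>2) / a0)"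
      using R.a_pos R.a0 by (simp add: less_imp_le)
  qed (use m in auto)
  then show ?thesis using m by (simp add: L2_UNIV_iff)
qed

lemma in_H1_dot: "\<phi> \<in> H1_dot"
proof -
  have "(\<lambda>x. (weak_deriv \<phi> x)\<^sup>2) absolutely_integrable_on {p..q}" for p q
    using weak_deriv_L2 by (auto simp: L2_UNIV_iff absolutely_integrable_UNIV_iff[symmetric] intro: set_integrable_subset)
  then have "\<phi> \<in> H1_loc \<and> continuous_on UNIV \<phi>" using AC_weak H1_loc_continuous_iff by blast
  then show ?thesis using weak_deriv_L2 by (simp add: H1_dot_def)
qed

lemma constraints: "wall_constraints \<phi>"
proof -
  have "(\<phi> \<longlongrightarrow> - (pi / 2)) at_bot" using L.phi_lim unfolding tendsto_reflect_at_top .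
  then show ?thesis using R.phi_lim R.phi0 by (simp add: wall_constraints_def)
qed

lemma is_competitor: "competitor \<phi>"
  using in_H1_dot constraints by (simp add: competitor_def H1_dot_def)

text \<open>Integration by parts on each side of \<open>0\<close> leaves the jump of the flux times
  the value of the test function at \<open>0\<close>. It vanishes if the fluxes match or if test
  functions cannot see \<open>0\<close>.\<close>

lemma solves:
  assumes "yr 0 = yl 0 \<or> 0 \<notin> U"
  shows "solves_in a U \<phi>"
  unfolding solves_in_def
proof
  fix \<psi> assume \<psi>: "\<psi> \<in> test_functions U"
  obtain m where m: "m > 0" "\<forall>x. \<bar>x\<bar> \<ge> m \<longrightarrow> \<psi> x = 0 \<and> deriv \<psi> x = 0"
    using test_functions_support[OF \<psi>] by metis
  let ?h = "\<lambda>x. a x * (sin (\<phi> x) * cos (\<phi> x))"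
  note wi = R.flux_terms_integrable(1)[OF AC_weak] and hi = R.flux_terms_integrable(2)[OF AC_weak]
  note TW = test_LINT_eq_integral(2,4)[OF \<psi> m(2) wi] and TH = test_LINT_eq_integral(1,3)[OF \<psi> m(2) hi]
  have split: "integral {-m..m} F = integral {-m..0} F + integral {0..m} F" if "F absolutely_integrable_on {-m..m}" for F :: "real \<Rightarrow> real"
    using Henstock_Kurzweil_Integration.integral_combine[of "-m" 0 m F] that m(1) by (simp add: absolutely_integrable_on_def)
  have AE_r: "AE x in lebesgue. x \<in> {0..m} \<longrightarrow> a x * weak_deriv \<phi> x * deriv \<psi> x = yr x * deriv \<psi> x"
    using flux_AE by eventually_elim (auto simp: flux_def)
  have AE_l: "AE x in lebesgue. x \<in> {-m..0} \<longrightarrow> a x * weak_deriv \<phi> x * deriv \<psi> x = yl (- x) * deriv \<psi> x"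
    using flux_AE AE_neq_0 by eventually_elim (auto simp: flux_def)
  have r: "integral {0..m} (\<lambda>x. a x * weak_deriv \<phi> x * deriv \<psi> x) = - yr 0 * \<psi> 0 + integral {0..m} (\<lambda>x. ?h x * \<psi> x)"
    using AC_by_parts(3)[OF has_AC_deriv_subset[OF R.AC_y] test_functions_AC[OF \<psi>], of 0 m] m
    by (simp add: integral_AE_cong[OF AE_r])
  have l: "integral {-m..0} (\<lambda>x. a x * weak_deriv \<phi> x * deriv \<psi> x) = yl 0 * \<psi> 0 + integral {-m..0} (\<lambda>x. ?h x * \<psi> x)"
    using AC_by_parts(3)[OF has_AC_deriv_subset[OF AC_yl] test_functions_AC[OF \<psi>], of "-m" 0] m
    by (simp add: integral_AE_cong[OF AE_l])
  have "(yl 0 - yr 0) * \<psi> 0 = 0" using assms test_functions_outside(1)[OF \<psi>, of 0] by auto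
  then have "yl 0 * \<psi> 0 = yr 0 * \<psi> 0" by (simp add: left_diff_distrib)
  then have "(LINT x:U|lebesgue. a x * weak_deriv \<phi> x * deriv \<psi> x) = (LINT x:U|lebesgue. ?h x * \<psi> x)"
    using TW TH split[OF TW(2)] split[OF TH(2)] r l by simp
  then show "- (LINT x:U|lebesgue. a x * weak_deriv \<phi> x * deriv \<psi> x)
        + (LINT x:U|lebesgue. a x * sin (\<phi> x) * cos (\<phi> x) * \<psi> x) = 0"
    by (simp add: mult.assoc)
qed

lemma is_wall_solution: "wall_solution a \<phi>"
proof -
  have "- (pi / 2) \<le> \<phi> (- x) \<and> \<phi> (- x) \<le> 0 \<and> 0 \<le> \<phi> x \<and> \<phi> x \<le> pi / 2" if "x > 0" for x
    using R.phi_range[of x] L.phi_range[of x] that by simp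
  then show ?thesis
    using in_H1_dot constraints solves[of "- {0}"] by (simp add: wall_solution_def)
qed

lemma Lipschitz: "(max (yr 0) (yl 0) / a0)-lipschitz_on UNIV \<phi>"
proof (rule lipschitz_onI)
  define K where "K = max (yr 0) (yl 0) / a0"
  have le: "flux x / a x \<le> K" for x
    using flux_le[of x] flux_pos[of x] R.a_ge[of x] R.a0 R.a_pos[of x] unfolding K_def by (intro frac_le) auto
  have ge: "0 \<le> flux x / a x" for x using flux_pos[of x] R.a_pos[of x] by simp
  have *: "\<bar>\<phi> d - \<phi> c\<bar> \<le> K * (d - c)" if "c \<le> d" for c d
    using AC_increment_le[OF AC_flux that, of K] AC_mono[OF AC_flux that] le ge by auto
  fix c d
  show "dist (\<phi> c) (\<phi> d) \<le> (max (yr 0) (yl 0) / a0) * dist c d"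
    unfolding K_def[symmetric]
  proof (cases "c \<le> d")
    case True
    then show "dist (\<phi> c) (\<phi> d) \<le> K * dist c d"
      using *[of c d] by (simp add: dist_real_def abs_minus_commute)
  next
    case False
    then show "dist (\<phi> c) (\<phi> d) \<le> K * dist c d"
      using *[of d c] by (simp add: dist_real_def)
  qed
qed (use R.y_pos[of 0] R.a0 in auto)

lemma strictly_increasing: "strict_mono \<phi>"
proof (rule strict_monoI)
  fix c d :: real assume cd: "c < d"
  consider "0 \<le> c" | "d \<le> 0" | "c < 0" "0 < d" by linarith
  then show "\<phi> c < \<phi> d"
  proof cases
    case 1 then show ?thesis using R.phi_strict_mono cd by simp
  next
    case 2 then show ?thesis using L.phi_strict_mono[of "- d" "- c"] cd by simp
  next
    case 3 then show ?thesis using R.phi_pos[of d] L.phi_pos[of "- c"] by simp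
  qed
qed

lemma flux_continuous: "continuous_on (- {0}) flux"
proof -
  have "continuous_on {0<..} yr"
    by (rule continuous_on_subset[OF has_AC_deriv_imp_continuous[OF R.AC_y]]) auto
  then have r: "continuous_on {0<..} flux" by (rule continuous_on_eq) (auto simp: flux_def)
  have "continuous_on {..<0} (\<lambda>x. yl (- x))"
    by (rule continuous_on_compose2[OF has_AC_deriv_imp_continuous[OF L.AC_y]])
      (auto intro: continuous_on_minus[OF continuous_on_id])
  then have l: "continuous_on {..<0} flux" by (rule continuous_on_eq) (auto simp: flux_def)
  have "continuous_on ({0<..} \<union> {..<0}) flux" by (rule continuous_on_open_Un[OF _ _ r l]) auto
  moreover have "{0<..} \<union> {..<0} = - {0::real}" by auto
  ultimately show ?thesis by simp
qed

text \<open>The equation itself exhibits the weak derivative of the flux away from \<open>0\<close>: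
  it is -a sin \<phi> cos \<phi>, bounded by \<open>A0\<close>.\<close>

lemma flux_W1_infinity: "(\<lambda>x. a x * weak_deriv \<phi> x) \<in> W1_infinity (- {0})"
proof -
  let ?w = "\<lambda>x. a x * weak_deriv \<phi> x" and ?h = "\<lambda>x. - (a x * (sin (\<phi> x) * cos (\<phi> x)))"
  note wi = R.flux_terms_integrable(1)[OF AC_weak] and hi = R.flux_terms_integrable(3)[OF AC_weak]
  have loc: "u \<in> L1_loc (- {0})" if "\<And>p q. u absolutely_integrable_on {p..q}" for u
    using that L1_loc_UNIV_iff[of u] by (simp add: L1_loc_def)
  have meas: "set_borel_measurable lebesgue (- {0}) u" if "\<And>p q. u absolutely_integrable_on {p..q}" for u :: "real \<Rightarrow> real"
    using locally_integrable_imp_measurable[OF that] unfolding set_borel_measurable_def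
    by (intro borel_measurable_scaleR borel_measurable_indicator) auto
  have "?w \<in> L_infinity (- {0})"
    unfolding L_infinity_def mem_Collect_eq
  proof (intro conjI exI)
    show "AE x in lebesgue. x \<in> - {0} \<longrightarrow> \<bar>?w x\<bar> \<le> max (yr 0) (yl 0)"
      using flux_AE
    proof eventually_elim
      case (elim x)
      show ?case unfolding elim using flux_le[of x] flux_pos[of x] by simp
    qed
  qed (rule meas[OF wi])
  moreover have "?h \<in> L_infinity (- {0})"
    unfolding L_infinity_def mem_Collect_eq
  proof (intro conjI exI)
    have "\<bar>?h x\<bar> \<le> A0" for x
    proof -
      have "\<bar>?h x\<bar> = a x * (\<bar>sin (\<phi> x)\<bar> * \<bar>cos (\<phi> x)\<bar>)" using R.a_pos[of x] by (simp add: abs_mult)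
      also have "\<dots> \<le> A0 * 1"
        using R.a_pos[of x] R.a_le[of x] R.A0_pos by (intro mult_mono mult_le_one) auto
      finally show ?thesis by simp
    qed
    then show "AE x in lebesgue. x \<in> - {0} \<longrightarrow> \<bar>?h x\<bar> \<le> A0" by simp
  qed (rule meas[OF hi])
  moreover have "has_weak_deriv (- {0}) ?w ?h"
    unfolding has_weak_deriv_def
  proof (intro conjI ballI loc wi hi)
    fix \<psi> assume "\<psi> \<in> test_functions (- {0})"
    then have "- (LINT x:- {0}|lebesgue. a x * weak_deriv \<phi> x * deriv \<psi> x)
        + (LINT x:- {0}|lebesgue. a x * sin (\<phi> x) * cos (\<phi> x) * \<psi> x) = 0"
      using solves[of "- {0}"] by (simp add: solves_in_def)
    moreover have "(LINT x:- {0}|lebesgue. ?h x * \<psi> x) = - (LINT x:- {0}|lebesgue. a x * sin (\<phi> x) * cos (\<phi> x) * \<psi> x)"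
      by (simp add: set_lebesgue_integral_def mult.assoc)
    ultimately show "(LINT x:- {0}|lebesgue. ?w x * deriv \<psi> x) = - (LINT x:- {0}|lebesgue. ?h x * \<psi> x)"
      by simp
  qed
  ultimately show ?thesis by (auto simp: W1_infinity_def)
qed

text \<open>A competitor of infinite energy is no threat. For the others each half line is
  calibrated separately, and since both one-sided inequalities go the same way, equality of the sums
  forces equality on each side.\<close>

lemma minimal:
  assumes "competitor u"
  shows "G a \<phi> \<le> G a u" "G a u \<le> G a \<phi> \<Longrightarrow> u = \<phi>"
proof -
  have H: "u \<in> H1_loc \<and> continuous_on UNIV u" and C: "wall_constraints u"
    using assms by (auto simp: competitor_def)
  have AC: "has_AC_deriv u (weak_deriv u) UNIV" using H H1_loc_continuous_iff by blast
  let ?E = "\<lambda>u x. a x * (weak_deriv u x)\<^sup>2 + a x * (cos (u x))\<^sup>2"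
  have fin: "G a \<phi> < \<infinity>" using R.G_finite_iff(1)[OF AC_weak] energy_integrable by simp
  have G: "G a \<phi> = ennreal (integral {0..} R.energy_density + integral {0..} L.energy_density)"
    using R.G_finite_iff(2)[OF AC_weak fin] integral_UNIV_split(3)[of "?E \<phi>"] energy_integrable
      energy_right energy_left by (simp add: absolutely_integrable_UNIV_iff)
  have main: "G a \<phi> \<le> G a u \<and> (G a u \<le> G a \<phi> \<longrightarrow> u = \<phi>)" if finu: "G a u < \<infinity>"
  proof -
    have i: "?E u absolutely_integrable_on UNIV"
      using R.G_finite_iff(1)[OF AC] finu by (simp add: absolutely_integrable_UNIV_iff)
    note s = integral_UNIV_split[OF i]
    interpret r: half_wall_competitor a a0 A0 \<phi> yr u "weak_deriv u"
    proof
      show "has_AC_deriv u (weak_deriv u) {0..}" by (rule has_AC_deriv_subset[OF AC]) simp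
    qed (use C s(1) in \<open>auto simp: wall_constraints_def\<close>)
    interpret l: half_wall_competitor "\<lambda>x. a (- x)" a0 A0 "\<lambda>x. - \<phi> (- x)" yl "\<lambda>x. - u (- x)" "\<lambda>x. weak_deriv u (- x)"
    proof
      show "has_AC_deriv (\<lambda>x. - u (- x)) (\<lambda>x. weak_deriv u (- x)) {0..}"
        by (rule has_AC_deriv_reflect_right[OF has_AC_deriv_subset[OF AC]]) simp
      show "((\<lambda>x. - u (- x)) \<longlongrightarrow> pi / 2) at_top"
        using C unfolding tendsto_reflect_at_top by (simp add: wall_constraints_def)
      show "(\<lambda>x. a (- x) * (weak_deriv u (- x))\<^sup>2 + a (- x) * (cos (- u (- x)))\<^sup>2) absolutely_integrable_on {0..}"
        using half_line_reflect(1)[of "?E u"] s(2) by simp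
    qed (use C in \<open>simp add: wall_constraints_def\<close>)
    have L_int: "integral {0..} (\<lambda>x. a (- x) * (weak_deriv u (- x))\<^sup>2 + a (- x) * (cos (- u (- x)))\<^sup>2) = integral {..0} (?E u)"
      using half_line_reflect(2)[OF s(2)] by simp
    have le: "integral {0..} R.energy_density \<le> integral {0..} (?E u)"
      "integral {0..} L.energy_density \<le> integral {..0} (?E u)"
      using r.half_energy_le l.half_energy_le unfolding L_int by auto
    have Gu: "G a u = ennreal (integral {0..} (?E u) + integral {..0} (?E u))"
      using R.G_finite_iff(2)[OF AC finu] s(3) by simp
    have nn: "0 \<le> integral {0..} R.energy_density" "0 \<le> integral {0..} L.energy_density"
      using R.energy_density_integrable L.energy_density_integrable R.a_pos L.a_pos
      by (auto intro!: integral_nonneg simp: R.energy_density_def L.energy_density_def absolutely_integrable_on_def less_imp_le)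
    show ?thesis
    proof (intro conjI impI)
      show "G a \<phi> \<le> G a u" unfolding G Gu using le by (intro ennreal_leI) auto
      assume "G a u \<le> G a \<phi>"
      then have "integral {0..} (?E u) + integral {..0} (?E u) \<le> integral {0..} R.energy_density + integral {0..} L.energy_density"
        unfolding G Gu using nn by (subst (asm) ennreal_le_iff) auto
      then have e: "integral {0..} R.energy_density = integral {0..} (?E u)"
        "integral {0..} L.energy_density = integral {..0} (?E u)" using le by linarith+
      show "u = \<phi>"
      proof
        fix x
        show "u x = \<phi> x"
        proof (cases "0 \<le> x")
          case True then show ?thesis using r.half_energy_eq_imp_eq e(1) by simp
        next
          case False
          then have "- u (- (- x)) = - \<phi> (- (- x))"
            by (intro l.half_energy_eq_imp_eq) (use e(2) L_int in auto)
          then show ?thesis by simp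
        qed
      qed
    qed
  qed
  show "G a \<phi> \<le> G a u" using main by (cases "G a u < \<infinity>") (auto simp: not_less top_unique)
  show "u = \<phi>" if "G a u \<le> G a \<phi>" using main that fin by (meson order_le_less_trans)
qed

lemma is_minimizer: "is_arg_min (G a) competitor \<phi>"
  using is_competitor minimal(1) by (auto simp: is_arg_min_def not_less)

lemma minimizer_unique: "is_arg_min (G a) competitor u \<Longrightarrow> u = \<phi>"
  using is_competitor minimal(2)[of u] by (auto simp: is_arg_min_def not_less)

end

context wall_coefficient
begin

text \<open>On each open half line the weak equation says that a \<phi>' has the weak derivative -a
  sin \<phi> cos \<phi>, so it agrees almost everywhere with an absolutely continuous flux that
  extends to \<open>0\<close>. The two one-sided values obtained there may differ.\<close>

lemma wall_solution_imp_pair: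
  assumes sol: "wall_solution a \<phi>"
  shows "\<exists>yr yl. wall_pair a a0 A0 \<phi> yr yl"
proof -
  have AC: "has_AC_deriv \<phi> (weak_deriv \<phi>) UNIV"
    using sol H1_loc_continuous_iff by (auto simp: wall_solution_def H1_dot_def)
  let ?w = "\<lambda>x. a x * weak_deriv \<phi> x" and ?h = "\<lambda>x. - (a x * (sin (\<phi> x) * cos (\<phi> x)))"
  note wi = flux_terms_integrable(1)[OF AC] and hi = flux_terms_integrable(3)[OF AC]
  \<comment> \<open>A test function supported in one half line is also one for the punctured line,
    and it vanishes on the other side.\<close>
  have weak: "(LINT x:U|lebesgue. ?w x * deriv \<psi> x) = - (LINT x:U|lebesgue. ?h x * \<psi> x)"
    if U: "U \<subseteq> - {0}" and \<psi>: "\<psi> \<in> test_functions U" for U \<psi>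
  proof -
    have "\<psi> \<in> test_functions (- {0})" using \<psi> test_functions_mono[OF U] by blast
    then have eq: "- (LINT x:- {0}|lebesgue. a x * weak_deriv \<phi> x * deriv \<psi> x)
        + (LINT x:- {0}|lebesgue. a x * sin (\<phi> x) * cos (\<phi> x) * \<psi> x) = 0"
      using sol by (simp add: wall_solution_def solves_in_def)
    have shrink: "(LINT x:- {0}|lebesgue. F x) = (LINT x:U|lebesgue. F x)" if "\<And>x. x \<notin> U \<Longrightarrow> F x = 0" for F :: "real \<Rightarrow> real"
      unfolding set_lebesgue_integral_def
      by (rule Bochner_Integration.integral_cong) (use that U in \<open>auto simp: indicator_def\<close>)
    have "(LINT x:U|lebesgue. ?h x * \<psi> x) = - (LINT x:U|lebesgue. a x * sin (\<phi> x) * cos (\<phi> x) * \<psi> x)"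
      by (simp add: set_lebesgue_integral_def mult.assoc)
    then show ?thesis
      using eq shrink[of "\<lambda>x. a x * weak_deriv \<phi> x * deriv \<psi> x"]
        shrink[of "\<lambda>x. a x * sin (\<phi> x) * cos (\<phi> x) * \<psi> x"] test_functions_outside[OF \<psi>] by simp
  qed
  \<comment> \<open>\<open>U\<close> will be an open half line and \<open>S\<close> its closure. The
    added point \<open>0\<close> is a null set, so the almost everywhere identity for the slope
    carries over.\<close>
  have half: "\<exists>v. wall_system a \<phi> v S"
    if U: "U \<subseteq> - {0}" "open U" "convex U" and S: "S \<subseteq> insert 0 U" for U S
  proof -
    obtain v where v: "has_AC_deriv v ?h UNIV" "AE x in lebesgue. x \<in> U \<longrightarrow> ?w x = v x"
      using weak_equation_imp_AC[OF wi hi U(2,3) weak[OF U(1)]] by blast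
    have "AE x in lebesgue. x \<in> S \<longrightarrow> weak_deriv \<phi> x = v x / a x"
      using v(2) AE_neq_0
    proof eventually_elim
      case (elim x)
      show ?case
      proof
        assume "x \<in> S"
        then have "a x * weak_deriv \<phi> x = v x" using elim S by auto
        then show "weak_deriv \<phi> x = v x / a x" using a_pos[of x] by (simp add: field_simps)
      qed
    qed
    then have "has_AC_deriv \<phi> (\<lambda>x. v x / a x) S"
      by (intro has_AC_deriv_cong_AE[OF has_AC_deriv_subset[OF AC subset_UNIV]])
    then show ?thesis
      using has_AC_deriv_subset[OF v(1), of S] unfolding wall_system_def by blast
  qed
  obtain yr where yr: "wall_system a \<phi> yr {0..}" 
  proof -
    have "{0..} \<subseteq> insert 0 {0::real<..}" by force
    then show thesis using half[of "{0<..}" "{0..}"] that by auto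
  qed
  obtain yl where yl: "wall_system a \<phi> yl {..0}" 
  proof -
    have "{..0} \<subseteq> insert 0 {..<0::real}" by force
    then show thesis using half[of "{..<0}" "{..0}"] that by auto
  qed
  interpret l: wall_coefficient "\<lambda>x. a (- x)" a0 A0 by (rule reflect)
  have C: "\<phi> 0 = 0" "(\<phi> \<longlongrightarrow> pi / 2) at_top" "(\<phi> \<longlongrightarrow> - (pi / 2)) at_bot"
    using sol by (auto simp: wall_solution_def wall_constraints_def)
  have rng: "- (pi / 2) \<le> \<phi> (- x) \<and> \<phi> (- x) \<le> 0 \<and> 0 \<le> \<phi> x \<and> \<phi> x \<le> pi / 2" if "0 \<le> x" for x
    using sol that C(1) by (cases "x = 0") (auto simp: wall_solution_def)
  have "half_wall a \<phi> yr" using yr C rng by (auto simp: half_wall_def)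
  moreover have "half_wall (\<lambda>x. a (- x)) (\<lambda>x. - \<phi> (- x)) (\<lambda>x. yl (- x))"
  proof -
    have "((\<lambda>x. - \<phi> (- x)) \<longlongrightarrow> pi / 2) at_top" using C(3) unfolding tendsto_reflect_at_top .
    moreover have "0 \<le> - \<phi> (- x) \<and> - \<phi> (- x) \<le> pi / 2" if "0 \<le> x" for x using rng[OF that] by linarith
    ultimately show ?thesis
      using wall_system_reflect_right[OF yl] C(1) unfolding half_wall_def by simp
  qed
  ultimately have "wall_pair a a0 A0 \<phi> yr (\<lambda>x. yl (- x))"
    unfolding wall_pair_def half_wall_solution_def half_wall_solution_axioms_def
    using wall_coefficient_axioms l.wall_coefficient_axioms by blast
  then show ?thesis by blast
qed

lemma wall_solution_exists: "\<exists>\<phi>. wall_solution a \<phi>"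
proof -
  interpret l: wall_coefficient "\<lambda>x. a (- x)" a0 A0 by (rule reflect)
  obtain pr yr where r: "half_wall a pr yr" using half_wall_exists by blast
  obtain pl yl where l: "half_wall (\<lambda>x. a (- x)) pl yl" using l.half_wall_exists by blast
  define \<phi> where "\<phi> x = (if 0 \<le> x then pr x else - pl (- x))" for x
  have cong: "half_wall b v y" if "half_wall b u y" "\<And>x. 0 \<le> x \<Longrightarrow> u x = v x" for b u v y
  proof -
    have "\<forall>\<^sub>F x in at_top. u x = v x" using eventually_ge_at_top[of 0] by eventually_elim (rule that(2))
    then have "(v \<longlongrightarrow> pi / 2) at_top" using that(1) Lim_transform_eventually unfolding half_wall_def by blast
    moreover have "wall_system b v y {0..}"
      using that unfolding half_wall_def wall_system_def
      by (auto intro: has_AC_deriv_cong)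
    ultimately show ?thesis using that unfolding half_wall_def by auto
  qed
  have "half_wall a \<phi> yr" by (rule cong[OF r]) (simp add: \<phi>_def)
  moreover have "half_wall (\<lambda>x. a (- x)) (\<lambda>x. - \<phi> (- x)) yl"
    by (rule cong[OF l]) (use r l in \<open>auto simp: \<phi>_def half_wall_def\<close>)
  ultimately have "wall_pair a a0 A0 \<phi> yr yl"
    unfolding wall_pair_def half_wall_solution_def half_wall_solution_axioms_def
    using wall_coefficient_axioms l.wall_coefficient_axioms by blast
  then show ?thesis using wall_pair.is_wall_solution by blast
qed

lemma wall_solution_unique:
  assumes "wall_solution a \<phi>" "wall_solution a \<psi>"
  shows "\<phi> = \<psi>"
proof -
  obtain yr yl zr zl where p: "wall_pair a a0 A0 \<phi> yr yl" "wall_pair a a0 A0 \<psi> zr zl"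
    using wall_solution_imp_pair assms by blast
  show ?thesis using wall_pair.minimizer_unique[OF p(2) wall_pair.is_minimizer[OF p(1)]] .
qed

end


section \<open>Stability\<close>

lemma tendsto_integral_half_line:
  fixes F :: "real \<Rightarrow> real"
  assumes "F absolutely_integrable_on {0..}"
  shows "((\<lambda>d. integral {0..d} F) \<longlongrightarrow> integral {0..} F) at_top"
  by (rule tendsto_at_topI_sequentially) (rule integral_exhausting_half_line[OF assms]; simp)

context half_wall_solution
begin

text \<open>The square is that of cos \<phi> (v / cos \<phi>)', with \<open>t\<close> = tan \<phi>,
  \<open>q\<close> the slope of \<phi> and \<open>G\<close> that of v. What remains is minus the
  derivative of y tan \<phi> v^2 and the amount by which cos \<phi> is a strict supersolution; cos
  2\<phi> appears as 2c^2 - 1.\<close>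

lemma stability_identity:
  fixes A G q t c s v :: real
  assumes "s\<^sup>2 + c\<^sup>2 = 1" "c * t = s"
  shows "A * G\<^sup>2 - A * (2 * c\<^sup>2 - 1) * v\<^sup>2 =
    - ((- (A * (s * c)) * t + A * q * ((1 + t\<^sup>2) * q)) * v\<^sup>2 + A * q * t * (2 * v * G))
    + A * (G + t * q * v)\<^sup>2 + (A * q\<^sup>2 - A * c\<^sup>2) * v\<^sup>2"
  using assms by algebra

text \<open>Integrated over \<open>{0..d}\<close>, the identity leaves the boundary term y tan
  \<phi> v^2, which vanishes at \<open>0\<close> and is at most A0 v(d)^2 at \<open>d\<close>. If
  the whole integral were negative, v^2 would exceed a positive constant near infinity, contrary to
  its integrability.\<close>

lemma half_stability:
  assumes mono: "\<And>x t. 0 < x \<Longrightarrow> x \<le> t \<Longrightarrow> a x \<le> a t"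
    and v: "has_AC_deriv v p {0..}"
    and Q: "(\<lambda>x. a x * (p x)\<^sup>2 - a x * cos (2 * \<phi> x) * (v x)\<^sup>2) absolutely_integrable_on {0..}"
    and v2: "(\<lambda>x. (v x)\<^sup>2) absolutely_integrable_on {0..}"
  shows "0 \<le> integral {0..} (\<lambda>x. a x * (p x)\<^sup>2 - a x * cos (2 * \<phi> x) * (v x)\<^sup>2)"
proof -
  let ?Q = "\<lambda>x. a x * (p x)\<^sup>2 - a x * cos (2 * \<phi> x) * (v x)\<^sup>2"
  let ?q = "\<lambda>x. y x / a x" and ?tn = "\<lambda>x. sin (\<phi> x) / cos (\<phi> x)"
  have V: "has_AC_deriv (\<lambda>x. (v x)\<^sup>2) (\<lambda>x. 2 * v x * p x) {0..}"
    by (rule has_AC_deriv_chain[OF v, where T = UNIV and f = "\<lambda>t. t\<^sup>2"])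
      (auto intro!: derivative_eq_intros continuous_intros)
  note B = has_AC_deriv_minus[OF has_AC_deriv_mult[OF has_AC_deriv_mult[OF AC_y AC_tan] V]]
  have bound: "- (A0 * (v d)\<^sup>2) \<le> integral {0..d} ?Q" if d: "0 \<le> d" for d
  proof -
    let ?D = "\<lambda>x. - ((- (a x * (sin (\<phi> x) * cos (\<phi> x))) * ?tn x + y x * ((1 + (?tn x)\<^sup>2) * ?q x)) * (v x)\<^sup>2
        + y x * ?tn x * (2 * v x * p x))"
    have sub: "{0..d} \<subseteq> {0..}" by auto
    note B' = has_AC_derivD[OF B d sub]
    have Qi: "?Q integrable_on {0..d}"
      using absolutely_integrable_on_subinterval[OF Q, of 0 d] by (simp add: absolutely_integrable_on_def)
    have le: "?D x \<le> ?Q x" if "0 < x" for x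
    proof -
      have nz: "cos (\<phi> x) \<noteq> 0" "a x \<noteq> 0" using cos_pos[of x] that a_pos[of x] by auto
      have yq: "y x = a x * ?q x" using nz by simp
      have "a x * cos (\<phi> x) \<le> y x"
        by (rule y_ge_cos) (use that mono a_pos[of x] in auto)
      then have "(a x * cos (\<phi> x))\<^sup>2 \<le> (y x)\<^sup>2"
        using a_pos[of x] cos_pos[of x] that by (intro power_mono) auto
      then have "a x * (cos (\<phi> x))\<^sup>2 \<le> a x * (?q x)\<^sup>2"
        using a_pos[of x] by (simp add: power_mult_distrib power_divide power2_eq_square field_simps)
      then have nn: "0 \<le> a x * (p x + ?tn x * ?q x * v x)\<^sup>2 + (a x * (?q x)\<^sup>2 - a x * (cos (\<phi> x))\<^sup>2) * (v x)\<^sup>2"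
        using a_pos[of x] by (intro add_nonneg_nonneg mult_nonneg_nonneg) auto
      have "?Q x = a x * (p x)\<^sup>2 - a x * (2 * (cos (\<phi> x))\<^sup>2 - 1) * (v x)\<^sup>2" by (simp add: cos_double_cos)
      also have "\<dots> = - ((- (a x * (sin (\<phi> x) * cos (\<phi> x))) * ?tn x + a x * ?q x * ((1 + (?tn x)\<^sup>2) * ?q x)) * (v x)\<^sup>2
        + a x * ?q x * ?tn x * (2 * v x * p x))
        + a x * (p x + ?tn x * ?q x * v x)\<^sup>2 + (a x * (?q x)\<^sup>2 - a x * (cos (\<phi> x))\<^sup>2) * (v x)\<^sup>2"
        by (rule stability_identity) (use nz in auto)
      finally show ?thesis using nn unfolding yq[symmetric] by linarith
    qed
    have "- (y d * ?tn d * (v d)\<^sup>2) - - (y 0 * ?tn 0 * (v 0)\<^sup>2) = integral {0..d} ?D" using B'(3) by simp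
    also have "\<dots> \<le> integral {0..d} ?Q"
    proof -
      \<comment> \<open>The pointwise inequality is known for x > 0 only, since monotonicity of
        \<open>a\<close> says nothing about \<open>a 0\<close>; the integrand is adjusted at that
        single point.\<close>
      let ?Q' = "\<lambda>x. if x = 0 then ?D x else ?Q x"
      have Qi': "?Q' integrable_on {0..d}" by (rule integrable_spike[OF Qi, of "{0}"]) auto
      have "integral {0..d} ?D \<le> integral {0..d} ?Q'"
        by (rule integral_le[OF B'(2) Qi']) (use le in auto)
      also have "\<dots> = integral {0..d} ?Q" by (rule integral_spike[of "{0}"]) auto
      finally show ?thesis .
    qed
    finally have 1: "- (y d * ?tn d * (v d)\<^sup>2) \<le> integral {0..d} ?Q" by simp
    have "y d * ?tn d \<le> A0" using y_tan_le[OF d] by simp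
    then have "y d * ?tn d * (v d)\<^sup>2 \<le> A0 * (v d)\<^sup>2" by (intro mult_right_mono) auto
    then show ?thesis using 1 by linarith
  qed
  show ?thesis
  proof (rule ccontr)
    assume "\<not> 0 \<le> integral {0..} ?Q"
    then have neg: "integral {0..} ?Q < 0" by simp
    \<comment> \<open>Once the partial integrals are below half of their negative limit, the
      boundary estimate forces v^2 to be at least this value.\<close>
    define k where "k = - integral {0..} ?Q / 2 / A0"
    have k: "0 < k" using neg A0_pos by (simp add: k_def divide_neg_pos)
    have "\<forall>\<^sub>F d in at_top. integral {0..d} ?Q < integral {0..} ?Q / 2"
    proof (rule order_tendstoD(2)[OF tendsto_integral_half_line[OF Q]])
      show "integral {0..} ?Q < integral {0..} ?Q / 2" using neg by linarith
    qed
    moreover have "\<forall>\<^sub>F d in at_top. (0::real) \<le> d" by (rule eventually_ge_at_top)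
    ultimately have "\<forall>\<^sub>F d in at_top. 0 \<le> d \<and> k \<le> (v d)\<^sup>2"
    proof eventually_elim
      case (elim d)
      have "- integral {0..} ?Q / 2 \<le> A0 * (v d)\<^sup>2" using bound[of d] elim by linarith
      then have "k \<le> (v d)\<^sup>2" using A0_pos by (simp add: k_def field_simps)
      then show ?case using elim by simp
    qed
    then obtain d0 where d0: "\<And>d. d0 \<le> d \<Longrightarrow> 0 \<le> d \<and> k \<le> (v d)\<^sup>2"
      unfolding eventually_at_top_linorder by blast
    define I where "I = integral {0..} (\<lambda>x. (v x)\<^sup>2)"
    \<comment> \<open>The length is chosen so that \<open>k\<close> integrates to
      \<open>I + 1\<close>, more than the total integral \<open>I\<close> of v^2.\<close>
    define d where "d = d0 + (I + 1) / k"
    have v2i: "(\<lambda>x. (v x)\<^sup>2) integrable_on {0..}" using v2 by (simp add: absolutely_integrable_on_def)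
    have I0: "0 \<le> I" unfolding I_def by (rule integral_nonneg[OF v2i]) simp
    have dd: "d0 \<le> d" using I0 k by (simp add: d_def)
    have sub: "{d0..d} \<subseteq> {0..}" using d0 by auto
    have vi: "(\<lambda>x. (v x)\<^sup>2) integrable_on {d0..d}"
      using absolutely_integrable_on_subinterval[OF v2 sub] by (simp add: absolutely_integrable_on_def)
    have "I + 1 = integral {d0..d} (\<lambda>x. k)" using dd k by (simp add: d_def)
    also have "\<dots> \<le> integral {d0..d} (\<lambda>x. (v x)\<^sup>2)"
      by (rule integral_le[OF _ vi]) (use d0 in auto)
    also have "\<dots> \<le> I" unfolding I_def by (rule integral_subset_le[OF sub vi v2i]) simp
    finally show False by simp
  qed
qed

end

lemma sin_Lipschitz: "\<bar>sin s - sin t\<bar> \<le> \<bar>s - t\<bar>"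
  and cos_Lipschitz: "\<bar>cos s - cos t\<bar> \<le> \<bar>s - t\<bar>" for s t :: real
proof -
  have h: "\<bar>2 * sin ((s - t) / 2) * r\<bar> \<le> \<bar>s - t\<bar>" if "\<bar>r\<bar> \<le> 1" for r
  proof -
    have "\<bar>2 * sin ((s - t) / 2) * r\<bar> = 2 * \<bar>sin ((s - t) / 2)\<bar> * \<bar>r\<bar>" by (simp add: abs_mult)
    also have "\<dots> \<le> 2 * \<bar>(s - t) / 2\<bar> * 1"
      using that abs_sin_x_le_abs_x[of "(s - t) / 2"] by (intro mult_mono) auto
    finally show ?thesis by simp
  qed
  show "\<bar>sin s - sin t\<bar> \<le> \<bar>s - t\<bar>" unfolding sin_diff_sin by (rule h) simp
  have "sin ((t - s) / 2) = - sin ((s - t) / 2)" by (metis minus_diff_eq minus_divide_left sin_minus)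
  then have "cos s - cos t = 2 * sin ((s - t) / 2) * - sin ((s + t) / 2)"
    by (simp add: cos_diff_cos)
  then show "\<bar>cos s - cos t\<bar> \<le> \<bar>s - t\<bar>" using h[of "- sin ((s + t) / 2)"] by simp
qed

text \<open>The mean value theorem turns the increment into a slope at an intermediate point, and
  the Lipschitz bound for the slope supplies the second factor \<open>k\<close>. The constant is not
  sharp, but only the quadratic order is used.\<close>

lemma cos_Taylor: "\<bar>cos (v + k) - cos v + k * sin v\<bar> \<le> k\<^sup>2"
  and sin_Taylor: "\<bar>sin (v + k) - sin v - k * cos v\<bar> \<le> k\<^sup>2" for v k :: real
proof -
  have mvt: "\<exists>z. \<bar>z - v\<bar> \<le> \<bar>k\<bar> \<and> f (v + k) - f v = k * f' z"
    if "\<And>x. (f has_real_derivative f' x) (at x)" for f f' :: "real \<Rightarrow> real"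
  proof (cases "k = 0")
    case False
    then consider "v < v + k" | "v + k < v" by linarith
    then show ?thesis
    proof cases
      case 1
      have "\<exists>z>v. z < v + k \<and> f (v + k) - f v = (v + k - v) * f' z"
        using 1 that by (intro MVT2) auto
      then obtain z where "z > v" "z < v + k" "f (v + k) - f v = (v + k - v) * f' z" by blast
      then show ?thesis by (intro exI[of _ z]) simp
    next
      case 2
      have "\<exists>z>v + k. z < v \<and> f v - f (v + k) = (v - (v + k)) * f' z"
        using 2 that by (intro MVT2) auto
      then obtain z where "z > v + k" "z < v" "f v - f (v + k) = (v - (v + k)) * f' z" by blast
      then show ?thesis by (intro exI[of _ z]) simp
    qed
  qed auto
  obtain z where z: "\<bar>z - v\<bar> \<le> \<bar>k\<bar>" "cos (v + k) - cos v = k * - sin z"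
    using mvt[of cos "\<lambda>z. - sin z"] DERIV_cos by blast
  have "\<bar>cos (v + k) - cos v + k * sin v\<bar> = \<bar>k\<bar> * \<bar>sin z - sin v\<bar>"
    unfolding z(2) by (simp add: abs_mult[symmetric] right_diff_distrib abs_minus_commute)
  also have "\<dots> \<le> \<bar>k\<bar> * \<bar>k\<bar>" using sin_Lipschitz[of z v] z(1) by (intro mult_left_mono) auto
  finally show "\<bar>cos (v + k) - cos v + k * sin v\<bar> \<le> k\<^sup>2" by (simp add: power2_eq_square)
  obtain z where z: "\<bar>z - v\<bar> \<le> \<bar>k\<bar>" "sin (v + k) - sin v = k * cos z"
    using mvt[of sin cos] DERIV_sin by blast
  have "\<bar>sin (v + k) - sin v - k * cos v\<bar> = \<bar>k\<bar> * \<bar>cos z - cos v\<bar>"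
    unfolding z(2) by (simp add: abs_mult[symmetric] right_diff_distrib)
  also have "\<dots> \<le> \<bar>k\<bar> * \<bar>k\<bar>" using cos_Lipschitz[of z v] z(1) by (intro mult_left_mono) auto
  finally show "\<bar>sin (v + k) - sin v - k * cos v\<bar> \<le> k\<^sup>2" by (simp add: power2_eq_square)
qed

text \<open>A pointwise Taylor bound integrated over the line has this form, so it takes the place
  of a theorem on differentiation under the integral sign.\<close>

lemma has_real_derivative_if_quadratic_remainder:
  fixes f :: "real \<Rightarrow> real"
  assumes "\<And>h. \<bar>f (t + h) - f t - h * D\<bar> \<le> C * h\<^sup>2"
  shows "(f has_real_derivative D) (at t)"
  unfolding DERIV_def
proof (rule LIM_zero_cancel, rule Lim_null_comparison)
  show "\<forall>\<^sub>F h in at 0. norm ((f (t + h) - f t) / h - D) \<le> C * \<bar>h\<bar>"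
    unfolding eventually_at_filter
  proof (intro always_eventually allI impI)
    fix h :: real assume h: "h \<noteq> 0"
    have "(f (t + h) - f t) / h - D = (f (t + h) - f t - h * D) / h" using h by (simp add: field_simps)
    then have "norm ((f (t + h) - f t) / h - D) = \<bar>f (t + h) - f t - h * D\<bar> / \<bar>h\<bar>" by simp
    also have "\<dots> \<le> C * h\<^sup>2 / \<bar>h\<bar>" using assms[of h] by (intro divide_right_mono) auto
    also have "\<dots> = C * \<bar>h\<bar>"
    proof -
      have "h\<^sup>2 = \<bar>h\<bar> * \<bar>h\<bar>" by (simp add: power2_eq_square)
      moreover have "C * (r * r) / r = C * r" if "r \<noteq> 0" for r using that by simp
      ultimately show ?thesis using h by (metis abs_eq_0)
    qed
    finally show "norm ((f (t + h) - f t) / h - D) \<le> C * \<bar>h\<bar>" .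
  qed
  have "((\<lambda>h. C * \<bar>h\<bar>) \<longlongrightarrow> C * \<bar>0\<bar>) (at 0)" by (intro tendsto_intros)
  then show "((\<lambda>h. C * \<bar>h\<bar>) \<longlongrightarrow> 0) (at 0)" by simp
qed

lemma has_weak_deriv_AE_cong:
  assumes "has_weak_deriv UNIV u g" "AE x in lebesgue. u x = v x"
  shows "has_weak_deriv UNIV v g"
  unfolding has_weak_deriv_def
proof (intro conjI ballI)
  show "v \<in> L1_loc UNIV"
    using assms absolutely_integrable_AE_cong[where f = u and g = v] unfolding has_weak_deriv_def L1_loc_UNIV_iff
    by (metis (mono_tags, lifting) eventually_mono)
  show "g \<in> L1_loc UNIV" using assms(1) by (simp add: has_weak_deriv_def)
  fix \<psi> :: "real \<Rightarrow> real" assume \<psi>: "\<psi> \<in> test_functions UNIV"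
  obtain m where m: "m > 0" "\<forall>x. \<bar>x\<bar> \<ge> m \<longrightarrow> \<psi> x = 0 \<and> deriv \<psi> x = 0"
    using test_functions_support[OF \<psi>] by metis
  have ui: "u absolutely_integrable_on {-m..m}" and vi: "v absolutely_integrable_on {-m..m}"
    using \<open>v \<in> L1_loc UNIV\<close> assms(1) by (auto simp: has_weak_deriv_def L1_loc_UNIV_iff)
  have "integral {-m..m} (\<lambda>x. u x * deriv \<psi> x) = integral {-m..m} (\<lambda>x. v x * deriv \<psi> x)"
    by (rule integral_AE_cong) (use assms(2) in \<open>eventually_elim, simp\<close>)
  then have "(LINT x:UNIV|lebesgue. u x * deriv \<psi> x) = (LINT x:UNIV|lebesgue. v x * deriv \<psi> x)"
    using test_LINT_eq_integral(2)[OF \<psi> m(2) ui] test_LINT_eq_integral(2)[OF \<psi> m(2) vi] by simp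
  then show "(LINT x:UNIV|lebesgue. v x * deriv \<psi> x) = - (LINT x:UNIV|lebesgue. g x * \<psi> x)"
    using assms(1) \<psi> by (simp add: has_weak_deriv_def)
qed


section \<open>Second variation\<close>

lemma integrable_AE_cong:
  fixes f g :: "real \<Rightarrow> real"
  assumes "AE x in lebesgue. f x = g x"
  shows "integrable lebesgue f \<longleftrightarrow> integrable lebesgue g" "(LINT x|lebesgue. f x) = (LINT x|lebesgue. g x)"
proof -
  have imp: "integrable lebesgue v" if "integrable lebesgue u" "AE x in lebesgue. u x = v x" for u v :: "real \<Rightarrow> real"
    using absolutely_integrable_AE_cong[where f = u and g = v and S = UNIV] that
    by (simp add: absolutely_integrable_UNIV_iff)
  have "AE x in lebesgue. g x = f x" using assms by eventually_elim simp
  then show iff: "integrable lebesgue f \<longleftrightarrow> integrable lebesgue g" using imp assms by blast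
  show "(LINT x|lebesgue. f x) = (LINT x|lebesgue. g x)"
  proof (cases "integrable lebesgue f")
    case True
    then show ?thesis using iff assms by (intro integral_cong_AE) (auto intro: borel_measurable_integrable)
  next
    case False
    then show ?thesis using iff by (simp add: not_integrable_integral_eq)
  qed
qed

lemma integrable_product_of_squares:
  fixes u w :: "real \<Rightarrow> real"
  assumes "u \<in> borel_measurable lebesgue" "w \<in> borel_measurable lebesgue"
    "integrable lebesgue (\<lambda>x. (u x)\<^sup>2)" "integrable lebesgue (\<lambda>x. (w x)\<^sup>2)"
  shows "integrable lebesgue (\<lambda>x. u x * w x)"
proof (rule Bochner_Integration.integrable_bound)
  show "integrable lebesgue (\<lambda>x. (u x)\<^sup>2 + (w x)\<^sup>2)" using assms(3,4) by simp
  have "\<bar>u x * w x\<bar> \<le> (u x)\<^sup>2 + (w x)\<^sup>2" for x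
  proof -
    have "0 \<le> (\<bar>u x\<bar> - \<bar>w x\<bar>)\<^sup>2" by simp
    then have "2 * \<bar>u x * w x\<bar> \<le> (u x)\<^sup>2 + (w x)\<^sup>2" by (simp add: power2_diff abs_mult)
    then show ?thesis by linarith
  qed
  then show "AE x in lebesgue. norm (u x * w x) \<le> norm ((u x)\<^sup>2 + (w x)\<^sup>2)" by simp
qed (use assms in auto)

context wall_coefficient
begin

lemma integrable_a_mult: "integrable lebesgue F \<Longrightarrow> integrable lebesgue (\<lambda>x. a x * F x)"
  using a_mult_integrable[where g = F and S = UNIV] by (simp add: absolutely_integrable_UNIV_iff)

end

text \<open>\<open>v\<close> stands for the continuous representative of a perturbation in
  \<open>H1\<close> and \<open>p\<close> for its weak derivative.\<close>

locale wall_perturbation = wall_pair a a0 A0 \<phi> yr yl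
  for a a0 A0 \<phi> yr yl +
  fixes v p :: "real \<Rightarrow> real"
  assumes AC_v: "has_AC_deriv v p UNIV"
    and v2: "integrable lebesgue (\<lambda>x. (v x)\<^sup>2)" and p2: "integrable lebesgue (\<lambda>x. (p x)\<^sup>2)"
begin

lemma measurable_v [measurable]: "v \<in> borel_measurable lebesgue"
  and measurable_p [measurable]: "p \<in> borel_measurable lebesgue"
  and measurable_phi [measurable]: "\<phi> \<in> borel_measurable lebesgue"
  and measurable_wd [measurable]: "weak_deriv \<phi> \<in> borel_measurable lebesgue"
  using has_AC_deriv_self_integrable has_AC_deriv_locally_integrable AC_v AC_weak
  by (auto intro: locally_integrable_imp_measurable)

lemma measurable_a [measurable]: "a \<in> borel_measurable lebesgue" by (rule R.meas)

lemma measurable_sin_cos [measurable]: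
  "u \<in> borel_measurable lebesgue \<Longrightarrow> (\<lambda>x. sin (u x)) \<in> borel_measurable lebesgue"
  "u \<in> borel_measurable lebesgue \<Longrightarrow> (\<lambda>x. cos (u x)) \<in> borel_measurable lebesgue" for u :: "real \<Rightarrow> real"
  by (rule borel_measurable_continuous_on[OF continuous_on_sin[OF continuous_on_id]]
      borel_measurable_continuous_on[OF continuous_on_cos[OF continuous_on_id]]; assumption)+

lemma wd2: "integrable lebesgue (\<lambda>x. (weak_deriv \<phi> x)\<^sup>2)"
  using weak_deriv_L2 by (simp add: L2_UNIV_iff)

text \<open>Finite energy puts cos \<phi> into L2, and shifting the argument by t v changes the
  cosine by at most the absolute value of t v, which is in L2 as well.\<close>

lemma cos2: "integrable lebesgue (\<lambda>x. (cos (\<phi> x + t * v x))\<^sup>2)"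
proof -
  have "integrable lebesgue (\<lambda>x. (a x * (weak_deriv \<phi> x)\<^sup>2 + a x * (cos (\<phi> x))\<^sup>2) / a0)"
    using energy_integrable by (rule integrable_divide_zero)
  then have "integrable lebesgue (\<lambda>x. (cos (\<phi> x))\<^sup>2)"
  proof (rule Bochner_Integration.integrable_bound)
    have "(cos (\<phi> x))\<^sup>2 \<le> (a x * (weak_deriv \<phi> x)\<^sup>2 + a x * (cos (\<phi> x))\<^sup>2) / a0" for x
    proof -
      have "a0 * (cos (\<phi> x))\<^sup>2 \<le> a x * (cos (\<phi> x))\<^sup>2" using R.a_ge by (intro mult_right_mono) auto
      moreover have "0 \<le> a x * (weak_deriv \<phi> x)\<^sup>2" using R.a_pos[of x] by simp
      ultimately show ?thesis using R.a0 by (simp add: field_simps)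
    qed
    then show "AE x in lebesgue. norm ((cos (\<phi> x))\<^sup>2)
       \<le> norm ((a x * (weak_deriv \<phi> x)\<^sup>2 + a x * (cos (\<phi> x))\<^sup>2) / a0)"
      using R.a_pos R.a0 by (simp add: less_imp_le)
  qed measurable
  then have "integrable lebesgue (\<lambda>x. 2 * (cos (\<phi> x))\<^sup>2 + 2 * t\<^sup>2 * (v x)\<^sup>2)" using v2 by simp
  then show ?thesis
  proof (rule Bochner_Integration.integrable_bound)
    have "(cos (\<phi> x + t * v x))\<^sup>2 \<le> 2 * (cos (\<phi> x))\<^sup>2 + 2 * t\<^sup>2 * (v x)\<^sup>2" for x
    proof -
      have "\<bar>cos (\<phi> x + t * v x)\<bar> \<le> \<bar>cos (\<phi> x)\<bar> + \<bar>t * v x\<bar>"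
        using cos_Lipschitz[of "\<phi> x + t * v x" "\<phi> x"] by simp
      then have "(cos (\<phi> x + t * v x))\<^sup>2 \<le> (\<bar>cos (\<phi> x)\<bar> + \<bar>t * v x\<bar>)\<^sup>2"
        by (metis abs_ge_zero power2_abs power_mono)
      also have "\<dots> \<le> 2 * \<bar>cos (\<phi> x)\<bar>\<^sup>2 + 2 * \<bar>t * v x\<bar>\<^sup>2"
        using sum_squares_bound[of "\<bar>cos (\<phi> x)\<bar>" "\<bar>t * v x\<bar>"] by (simp add: power2_sum)
      finally show ?thesis by (simp add: power_mult_distrib)
    qed
    then show "AE x in lebesgue. norm ((cos (\<phi> x + t * v x))\<^sup>2) \<le> norm (2 * (cos (\<phi> x))\<^sup>2 + 2 * t\<^sup>2 * (v x)\<^sup>2)"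
      by simp
  qed measurable
qed

lemma sin_v: "integrable lebesgue (\<lambda>x. sin (2 * (\<phi> x + t * v x)) * v x)"
proof (rule integrable_product_of_squares[OF _ _ _ v2])
  have "integrable lebesgue (\<lambda>x. 4 * (cos (\<phi> x + t * v x))\<^sup>2)" using cos2 by simp
  then show "integrable lebesgue (\<lambda>x. (sin (2 * (\<phi> x + t * v x)))\<^sup>2)"
  proof (rule Bochner_Integration.integrable_bound)
    have "(sin (2 * (\<phi> x + t * v x)))\<^sup>2 \<le> 4 * (cos (\<phi> x + t * v x))\<^sup>2" for x
    proof -
      have "(sin (\<phi> x + t * v x))\<^sup>2 * (cos (\<phi> x + t * v x))\<^sup>2 \<le> 1 * (cos (\<phi> x + t * v x))\<^sup>2"
        by (intro mult_right_mono) (auto simp: abs_square_le_1)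
      then show ?thesis unfolding sin_double power_mult_distrib by simp
    qed
    then show "AE x in lebesgue. norm ((sin (2 * (\<phi> x + t * v x)))\<^sup>2) \<le> norm (4 * (cos (\<phi> x + t * v x))\<^sup>2)"
      by simp
  qed measurable
qed measurable

lemma cos_v2: "integrable lebesgue (\<lambda>x. cos (2 * \<phi> x) * (v x)\<^sup>2)"
proof (rule Bochner_Integration.integrable_bound[OF v2])
  have "\<bar>cos (2 * \<phi> x)\<bar> * \<bar>(v x)\<^sup>2\<bar> \<le> 1 * \<bar>(v x)\<^sup>2\<bar>" for x by (intro mult_right_mono) auto
  then show "AE x in lebesgue. norm (cos (2 * \<phi> x) * (v x)\<^sup>2) \<le> norm ((v x)\<^sup>2)" by (simp add: abs_mult)
qed measurable

text \<open>The one-dimensional Sobolev embedding: the derivative 2 v p of v^2 is integrable.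
  Boundedness is needed because the remainder for the second derivative of the potential is cubic in
  \<open>v\<close>.\<close>

lemma v_bounded: obtains M where "0 < M" "\<And>x. \<bar>v x\<bar> \<le> M"
proof -
  have V: "has_AC_deriv (\<lambda>x. (v x)\<^sup>2) (\<lambda>x. 2 * v x * p x) UNIV"
    by (rule has_AC_deriv_chain[OF AC_v, where T = UNIV and f = "\<lambda>t. t\<^sup>2"])
      (auto intro!: derivative_eq_intros continuous_intros)
  define K where "K = integral UNIV (\<lambda>x. \<bar>2 * v x * p x\<bar>)"
  have "integrable lebesgue (\<lambda>x. 2 * (v x * p x))"
    using integrable_product_of_squares[OF _ _ v2 p2] by simp
  then have i: "(\<lambda>x. 2 * v x * p x) absolutely_integrable_on UNIV"
    by (simp add: absolutely_integrable_UNIV_iff mult.assoc)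
  then have ai: "(\<lambda>x. \<bar>2 * v x * p x\<bar>) integrable_on UNIV" by (simp add: absolutely_integrable_on_def)
  have *: "\<bar>(v d)\<^sup>2 - (v c)\<^sup>2\<bar> \<le> K" if "c \<le> d" for c d
  proof -
    have sub: "(\<lambda>x. 2 * v x * p x) absolutely_integrable_on {c..d}"
      by (rule set_integrable_subset[OF i]) auto
    then have I: "(\<lambda>x. 2 * v x * p x) integrable_on {c..d}" "(\<lambda>x. \<bar>2 * v x * p x\<bar>) integrable_on {c..d}"
      by (simp_all add: absolutely_integrable_on_def)
    have "\<bar>(v d)\<^sup>2 - (v c)\<^sup>2\<bar> = norm (integral {c..d} (\<lambda>x. 2 * v x * p x))"
      using has_AC_derivD(3)[OF V that] by simp
    also have "\<dots> \<le> integral {c..d} (\<lambda>x. \<bar>2 * v x * p x\<bar>)"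
      by (rule integral_norm_bound_integral[OF I]) simp
    also have "\<dots> \<le> K" unfolding K_def by (rule integral_subset_le[OF _ I(2) ai]) auto
    finally show ?thesis .
  qed
  have "\<bar>v x\<bar> \<le> 1 + (v 0)\<^sup>2 + K" for x
  proof -
    have "(v x)\<^sup>2 \<le> (v 0)\<^sup>2 + K" using *[of 0 x] *[of x 0] by (cases "0 \<le> x") auto
    moreover have "\<bar>v x\<bar> \<le> 1 + (v x)\<^sup>2"
      using sum_squares_bound[of 1 "\<bar>v x\<bar>"] by simp
    ultimately show ?thesis by linarith
  qed
  moreover have "0 < 1 + (v 0)\<^sup>2 + K"
  proof -
    have "0 \<le> K" unfolding K_def by (rule integral_nonneg[OF ai]) simp
    then show ?thesis using zero_le_power2[of "v 0"] by linarith
  qed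
  ultimately show thesis using that by blast
qed

definition perturbed_density :: "real \<Rightarrow> real \<Rightarrow> real" where
  "perturbed_density t x = a x * (weak_deriv \<phi> x + t * p x)\<^sup>2 + a x * (cos (\<phi> x + t * v x))\<^sup>2"

definition second_variation_density :: "real \<Rightarrow> real" where
  "second_variation_density x = a x * (p x)\<^sup>2 - a x * cos (2 * \<phi> x) * (v x)\<^sup>2"

definition potential :: "real \<Rightarrow> real" where
  "potential t = (LINT x|lebesgue. a x * (cos (\<phi> x + t * v x))\<^sup>2)"

definition potential_deriv :: "real \<Rightarrow> real" where
  "potential_deriv t = - (LINT x|lebesgue. a x * (sin (2 * (\<phi> x + t * v x)) * v x))"

lemma second_variation_density_integrable: "integrable lebesgue second_variation_density"
proof -
  have "integrable lebesgue (\<lambda>x. a x * (p x)\<^sup>2 - a x * (cos (2 * \<phi> x) * (v x)\<^sup>2))"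
    by (intro Bochner_Integration.integrable_diff R.integrable_a_mult p2 cos_v2)
  then show ?thesis by (simp add: second_variation_density_def[abs_def] mult.assoc)
qed

lemma wd_p: "integrable lebesgue (\<lambda>x. weak_deriv \<phi> x * p x)"
  by (rule integrable_product_of_squares[OF _ _ wd2 p2]) measurable

lemma perturbed_energy:
  "integrable lebesgue (perturbed_density t)"
  "(LINT x|lebesgue. perturbed_density t x) =
    (LINT x|lebesgue. a x * (weak_deriv \<phi> x)\<^sup>2) + 2 * t * (LINT x|lebesgue. a x * (weak_deriv \<phi> x * p x))
     + t\<^sup>2 * (LINT x|lebesgue. a x * (p x)\<^sup>2) + potential t"
proof -
  have e: "perturbed_density t x = a x * (weak_deriv \<phi> x)\<^sup>2 + 2 * t * (a x * (weak_deriv \<phi> x * p x))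
     + t\<^sup>2 * (a x * (p x)\<^sup>2) + a x * (cos (\<phi> x + t * v x))\<^sup>2" for x
    by (simp add: perturbed_density_def power2_eq_square algebra_simps)
  note i = R.integrable_a_mult[OF wd2] R.integrable_a_mult[OF wd_p] R.integrable_a_mult[OF p2]
    R.integrable_a_mult[OF cos2[of t]]
  show "integrable lebesgue (perturbed_density t)"
    unfolding e by (intro Bochner_Integration.integrable_add integrable_mult_right i)
  show "(LINT x|lebesgue. perturbed_density t x) =
    (LINT x|lebesgue. a x * (weak_deriv \<phi> x)\<^sup>2) + 2 * t * (LINT x|lebesgue. a x * (weak_deriv \<phi> x * p x))
     + t\<^sup>2 * (LINT x|lebesgue. a x * (p x)\<^sup>2) + potential t"
    unfolding e potential_def using i by simp
qed

lemma LINT_abs_le: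
  fixes F H :: "real \<Rightarrow> real"
  assumes "integrable lebesgue F" "integrable lebesgue H" "\<And>x. \<bar>F x\<bar> \<le> H x"
  shows "\<bar>LINT x|lebesgue. F x\<bar> \<le> (LINT x|lebesgue. H x)"
proof -
  have "\<bar>LINT x|lebesgue. F x\<bar> \<le> (LINT x|lebesgue. \<bar>F x\<bar>)" by (rule integral_abs_bound)
  also have "\<dots> \<le> (LINT x|lebesgue. H x)" by (rule integral_mono) (use assms in auto)
  finally show ?thesis .
qed

lemma potential_has_deriv: "(potential has_real_derivative potential_deriv t) (at t)"
proof (rule has_real_derivative_if_quadratic_remainder)
  fix h
  let ?F = "\<lambda>x. a x * (cos (\<phi> x + (t + h) * v x))\<^sup>2 - a x * (cos (\<phi> x + t * v x))\<^sup>2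
       + h * (a x * (sin (2 * (\<phi> x + t * v x)) * v x))"
  note i = R.integrable_a_mult[OF cos2[of "t + h"]] R.integrable_a_mult[OF cos2[of t]] R.integrable_a_mult[OF sin_v[of t]]
  have rem: "potential (t + h) - potential t - h * potential_deriv t = (LINT x|lebesgue. ?F x)"
    unfolding potential_def potential_deriv_def using i by simp
  have "\<bar>LINT x|lebesgue. ?F x\<bar> \<le> (LINT x|lebesgue. (2 * A0 * h\<^sup>2) * (v x)\<^sup>2)"
  proof (rule LINT_abs_le)
    show "integrable lebesgue ?F" using i by simp
    show "integrable lebesgue (\<lambda>x. (2 * A0 * h\<^sup>2) * (v x)\<^sup>2)" using v2 by simp
    fix x
    let ?u = "2 * (\<phi> x + t * v x)" and ?k = "2 * (h * v x)"
    \<comment> \<open>Doubling the angle replaces the square by a single cosine, so that one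
      application of \<open>cos_Taylor\<close> bounds the remainder.\<close>
    have double: "(cos r)\<^sup>2 = (cos (2 * r) + 1) / 2" for r :: real by (simp add: cos_double_cos)
    have uk: "2 * (\<phi> x + (t + h) * v x) = ?u + ?k" by (simp add: algebra_simps)
    have factor: "\<alpha> * A - \<alpha> * B + k * (\<alpha> * (S * w)) = \<alpha> * (A - B + (k * w) * S)" for \<alpha> A B k S w :: real
      by (simp add: algebra_simps)
    have "(cos (\<phi> x + (t + h) * v x))\<^sup>2 - (cos (\<phi> x + t * v x))\<^sup>2 + (h * v x) * sin ?u
        = (cos (?u + ?k) - cos ?u + ?k * sin ?u) / 2"
      unfolding double uk by (simp add: field_simps)
    then have F: "?F x = a x * ((cos (?u + ?k) - cos ?u + ?k * sin ?u) / 2)"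
      using factor[of "a x" _ _ h "sin ?u" "v x"] by simp
    have "\<bar>?F x\<bar> = a x * (\<bar>cos (?u + ?k) - cos ?u + ?k * sin ?u\<bar> / 2)"
      unfolding F using R.a_pos[of x] by (simp add: abs_mult)
    also have "\<dots> \<le> A0 * (?k\<^sup>2 / 2)"
      using cos_Taylor[of ?u ?k] R.a_le[of x] R.A0_pos by (intro mult_mono) auto
    also have "\<dots> = (2 * A0 * h\<^sup>2) * (v x)\<^sup>2" by (simp add: power_mult_distrib)
    finally show "\<bar>?F x\<bar> \<le> (2 * A0 * h\<^sup>2) * (v x)\<^sup>2" .
  qed
  also have "\<dots> = (2 * A0 * (LINT x|lebesgue. (v x)\<^sup>2)) * h\<^sup>2" by simp
  finally show "\<bar>potential (t + h) - potential t - h * potential_deriv t\<bar> \<le> (2 * A0 * (LINT x|lebesgue. (v x)\<^sup>2)) * h\<^sup>2"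
    unfolding rem .
qed

text \<open>The remainder is v times a quadratic term in h v. One factor is bounded by
  \<open>M\<close>, and the other two form the integrable v^2.\<close>

lemma potential_deriv_has_deriv:
  "(potential_deriv has_real_derivative - 2 * (LINT x|lebesgue. a x * (cos (2 * \<phi> x) * (v x)\<^sup>2))) (at 0)"
proof -
  obtain M where M: "0 < M" "\<And>x. \<bar>v x\<bar> \<le> M" using v_bounded by blast
  show ?thesis
  proof (rule has_real_derivative_if_quadratic_remainder)
    fix h
    let ?F = "\<lambda>x. a x * (sin (2 * (\<phi> x + (0 + h) * v x)) * v x) - a x * (sin (2 * (\<phi> x + 0 * v x)) * v x)
       - h * (2 * (a x * (cos (2 * \<phi> x) * (v x)\<^sup>2)))"
    note i = R.integrable_a_mult[OF sin_v[of "0 + h"]] R.integrable_a_mult[OF sin_v[of 0]] R.integrable_a_mult[OF cos_v2]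
    have rem: "potential_deriv (0 + h) - potential_deriv 0 - h * (- 2 * (LINT x|lebesgue. a x * (cos (2 * \<phi> x) * (v x)\<^sup>2)))
       = - (LINT x|lebesgue. ?F x)"
      unfolding potential_deriv_def using i by simp
    have "\<bar>LINT x|lebesgue. ?F x\<bar> \<le> (LINT x|lebesgue. (4 * A0 * M * h\<^sup>2) * (v x)\<^sup>2)"
    proof (rule LINT_abs_le)
      show "integrable lebesgue ?F" using i by (intro Bochner_Integration.integrable_diff integrable_mult_right) auto
      show "integrable lebesgue (\<lambda>x. (4 * A0 * M * h\<^sup>2) * (v x)\<^sup>2)" using v2 by simp
      fix x
      let ?u = "2 * \<phi> x" and ?k = "2 * (h * v x)"
      have uk: "2 * (\<phi> x + (0 + h) * v x) = ?u + ?k" "2 * (\<phi> x + 0 * v x) = ?u" by (simp_all add: algebra_simps)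
      have factor: "\<alpha> * (S * w) - \<alpha> * (S' * w) - k * (2 * (\<alpha> * (C * w\<^sup>2))) = \<alpha> * w * (S - S' - (2 * (k * w)) * C)"
        for \<alpha> S S' k C w :: real by (simp add: algebra_simps power2_eq_square)
      have F: "?F x = a x * v x * (sin (?u + ?k) - sin ?u - ?k * cos ?u)"
        unfolding uk by (rule factor)
      have "\<bar>?F x\<bar> = a x * \<bar>v x\<bar> * \<bar>sin (?u + ?k) - sin ?u - ?k * cos ?u\<bar>"
        unfolding F using R.a_pos[of x] by (simp add: abs_mult)
      also have "\<dots> \<le> A0 * M * ?k\<^sup>2"
        using sin_Taylor[of ?u ?k] R.a_le[of x] R.a_pos[of x] R.A0_pos M by (intro mult_mono) auto
      also have "\<dots> = (4 * A0 * M * h\<^sup>2) * (v x)\<^sup>2" by (simp add: power_mult_distrib)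
      finally show "\<bar>?F x\<bar> \<le> (4 * A0 * M * h\<^sup>2) * (v x)\<^sup>2" .
    qed
    also have "\<dots> = (4 * A0 * M * (LINT x|lebesgue. (v x)\<^sup>2)) * h\<^sup>2" by simp
    finally show "\<bar>potential_deriv (0 + h) - potential_deriv 0 - h * (- 2 * (LINT x|lebesgue. a x * (cos (2 * \<phi> x) * (v x)\<^sup>2)))\<bar>
      \<le> (4 * A0 * M * (LINT x|lebesgue. (v x)\<^sup>2)) * h\<^sup>2"
      unfolding rem abs_minus_cancel .
  qed
qed

text \<open>The gradient part of the energy is a quadratic polynomial in \<open>t\<close>, so only
  the potential has to be differentiated by estimates.\<close>

lemma second_derivative:
  "has_second_deriv_at (\<lambda>t. LINT x|lebesgue. perturbed_density t x)
     (2 * (LINT x|lebesgue. second_variation_density x)) 0"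
proof -
  define I0 where "I0 = (LINT x|lebesgue. a x * (weak_deriv \<phi> x)\<^sup>2)"
  define I1 where "I1 = (LINT x|lebesgue. a x * (weak_deriv \<phi> x * p x))"
  define I2 where "I2 = (LINT x|lebesgue. a x * (p x)\<^sup>2)"
  define J where "J = (LINT x|lebesgue. a x * (cos (2 * \<phi> x) * (v x)\<^sup>2))"
  have f: "(\<lambda>t. LINT x|lebesgue. perturbed_density t x) = (\<lambda>t. I0 + 2 * t * I1 + t\<^sup>2 * I2 + potential t)"
    by (simp add: perturbed_energy(2) I0_def I1_def I2_def)
  have "(LINT x|lebesgue. second_variation_density x) = (LINT x|lebesgue. a x * (p x)\<^sup>2 - a x * (cos (2 * \<phi> x) * (v x)\<^sup>2))"
    by (simp add: second_variation_density_def mult.assoc)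
  also have "\<dots> = I2 - J"
    unfolding I2_def J_def using R.integrable_a_mult[OF p2] R.integrable_a_mult[OF cos_v2] by simp
  finally have s: "(LINT x|lebesgue. second_variation_density x) = I2 - J" .
  have 1: "((\<lambda>t. I0 + 2 * t * I1 + t\<^sup>2 * I2 + potential t) has_real_derivative
     2 * I1 + 2 * t * I2 + potential_deriv t) (at t)" for t
    by (auto intro!: derivative_eq_intros potential_has_deriv)
  have 2: "((\<lambda>t. 2 * I1 + 2 * t * I2 + potential_deriv t) has_real_derivative 2 * (I2 - J)) (at 0)"
    by (auto intro!: derivative_eq_intros potential_deriv_has_deriv[folded J_def])
  show ?thesis unfolding has_second_deriv_at_def f s using 1 2 by (intro exI conjI) auto
qed

lemma perturbed_G:
  assumes "AE x in lebesgue. \<eta> x = v x"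
  shows "G a (\<lambda>x. \<phi> x + t * \<eta> x) = ennreal (LINT x|lebesgue. perturbed_density t x)"
proof -
  have "has_AC_deriv (\<lambda>x. \<phi> x + t * v x) (\<lambda>x. weak_deriv \<phi> x + t * p x) UNIV"
    by (intro has_AC_deriv_add has_AC_deriv_cmult AC_weak AC_v)
  then have "has_weak_deriv UNIV (\<lambda>x. \<phi> x + t * v x) (\<lambda>x. weak_deriv \<phi> x + t * p x)"
    by (rule has_AC_deriv_imp_has_weak_deriv)
  moreover have "AE x in lebesgue. \<phi> x + t * v x = \<phi> x + t * \<eta> x" using assms by eventually_elim simp
  ultimately have "has_weak_deriv UNIV (\<lambda>x. \<phi> x + t * \<eta> x) (\<lambda>x. weak_deriv \<phi> x + t * p x)"
    by (rule has_weak_deriv_AE_cong)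
  from weak_deriv_AE(2)[OF this]
  have "AE x in lebesgue. ennreal (a x * (weak_deriv (\<lambda>x. \<phi> x + t * \<eta> x) x)\<^sup>2 + a x * (cos (\<phi> x + t * \<eta> x))\<^sup>2)
     = ennreal (perturbed_density t x)"
    using assms by eventually_elim (simp add: perturbed_density_def)
  then have "G a (\<lambda>x. \<phi> x + t * \<eta> x) = (\<integral>\<^sup>+ x. ennreal (perturbed_density t x) \<partial>lebesgue)"
    unfolding G_def by (rule nn_integral_cong_AE)
  also have "\<dots> = ennreal (LINT x|lebesgue. perturbed_density t x)"
    using R.a_pos by (intro nn_integral_eq_integral perturbed_energy(1)) (auto simp: perturbed_density_def less_imp_le)
  finally show ?thesis .
qed

end

context wall_pair
begin

text \<open>The odd reflection of \<phi> is again a wall solution, so uniqueness makes \<phi> odd.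
  Then both fluxes have the same derivative on the right half line and differ by a constant
  \<open>k\<close>; divided by \<open>a\<close> both are slopes of the same \<phi>, so k / a
  integrates to zero and k = 0. Equal initial fluxes are what makes the equation hold across
  \<open>0\<close>.\<close>

lemma odd_if_even:
  assumes even: "\<And>x. a (- x) = a x"
  shows "\<phi> (- x) = - \<phi> x" "yr 0 = yl 0"
proof -
  have aeq: "(\<lambda>x. a (- x)) = a" using even by auto
  have "wall_pair a a0 A0 (\<lambda>x. - \<phi> (- x)) yl yr"
    using R.half_wall_solution_axioms L.half_wall_solution_axioms
    unfolding wall_pair_def aeq by simp
  then have "wall_solution a (\<lambda>x. - \<phi> (- x))" by (rule wall_pair.is_wall_solution)
  then have eq: "(\<lambda>x. - \<phi> (- x)) = \<phi>" using R.wall_solution_unique[OF _ is_wall_solution] by blast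
  then show "\<phi> (- x) = - \<phi> x" by (metis add.inverse_inverse)
  have AC_l: "has_AC_deriv \<phi> (\<lambda>x. yl x / a x) {0..}"
    and Y_l: "has_AC_deriv yl (\<lambda>x. - (a x * (sin (\<phi> x) * cos (\<phi> x)))) {0..}"
    using L.AC_phi L.AC_y unfolding eq even by (auto simp: fun_cong[OF eq])
  define k where "k = yr 0 - yl 0"
  have const: "yr x - yl x = k" if "0 \<le> x" for x
    using has_AC_derivD(3)[OF has_AC_deriv_diff[OF R.AC_y Y_l] that] by (simp add: k_def)
  have D: "has_AC_deriv (\<lambda>x. \<phi> x - \<phi> x) (\<lambda>x. k / a x) {0..}"
    by (rule has_AC_deriv_cong[OF has_AC_deriv_diff[OF R.AC_phi AC_l]])
      (auto simp: const[symmetric] diff_divide_distrib)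
  show "yr 0 = yl 0"
  proof (rule ccontr)
    assume "yr 0 \<noteq> yl 0"
    then have k: "k \<noteq> 0" by (simp add: k_def)
    have "\<bar>k\<bar> / A0 * (1 - 0) \<le> (\<lambda>x. sgn k * (\<phi> x - \<phi> x)) 1 - (\<lambda>x. sgn k * (\<phi> x - \<phi> x)) 0"
    proof (rule AC_increment_ge[OF has_AC_deriv_cmult[OF D]])
      fix x
      have "sgn k * (k / a x) = \<bar>k\<bar> / a x" by (simp add: abs_sgn)
      then show "\<bar>k\<bar> / A0 \<le> sgn k * (k / a x)"
        using R.a_le[of x] R.a_pos[of x] by (simp add: frac_le)
    qed auto
    then have "\<bar>k\<bar> / A0 \<le> 0" by simp
    then show False using k R.A0_pos by (simp add: divide_le_0_iff)
  qed
qed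

lemma second_variation:
  assumes even: "\<And>x. a (- x) = a x" and mono: "mono_on {0<..} a" and \<eta>: "\<eta> \<in> H1"
  shows "G a (\<lambda>x. \<phi> x + t * \<eta> x) < \<infinity>"
    "integrable lebesgue (Q_integrand a \<phi> \<eta>)"
    "has_second_deriv_at (\<lambda>t. enn2real (G a (\<lambda>x. \<phi> x + t * \<eta> x))) (2 * (LINT x|lebesgue. Q_integrand a \<phi> \<eta> x)) 0"
    "0 \<le> (LINT x|lebesgue. Q_integrand a \<phi> \<eta> x)"
proof -
  obtain p where p: "p \<in> L2 UNIV" "has_weak_deriv UNIV \<eta> p" and \<eta>2: "\<eta> \<in> L2 UNIV"
    using \<eta> by (auto simp: H1_def)
  obtain v where v: "has_AC_deriv v p UNIV" "AE x in lebesgue. \<eta> x = v x"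
    using has_weak_deriv_imp_AC[OF p(2)] by blast
  have "AE x in lebesgue. (\<eta> x)\<^sup>2 = (v x)\<^sup>2" using v(2) by eventually_elim simp
  then have v2: "integrable lebesgue (\<lambda>x. (v x)\<^sup>2)"
    using \<eta>2 integrable_AE_cong(1) by (fastforce simp: L2_UNIV_iff)
  interpret P: wall_perturbation a a0 A0 \<phi> yr yl v p
    by unfold_locales (use v v2 p in \<open>auto simp: L2_UNIV_iff\<close>)
  have GP: "G a (\<lambda>x. \<phi> x + t * \<eta> x) = ennreal (LINT x|lebesgue. P.perturbed_density t x)" for t
    by (rule P.perturbed_G[OF v(2)])
  then show "G a (\<lambda>x. \<phi> x + t * \<eta> x) < \<infinity>" by simp
  have "AE x in lebesgue. Q_integrand a \<phi> \<eta> x = P.second_variation_density x"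
    using v(2) weak_deriv_AE(2)[OF p(2)]
    by eventually_elim (simp add: Q_integrand_def P.second_variation_density_def)
  note Q = integrable_AE_cong[OF this]
  show "integrable lebesgue (Q_integrand a \<phi> \<eta>)" using Q(1) P.second_variation_density_integrable by simp
  have "0 \<le> (LINT x|lebesgue. P.perturbed_density t x)" for t
    using R.a_pos by (intro integral_nonneg_AE) (auto simp: P.perturbed_density_def less_imp_le)
  then have "(\<lambda>t. enn2real (G a (\<lambda>x. \<phi> x + t * \<eta> x))) = (\<lambda>t. LINT x|lebesgue. P.perturbed_density t x)"
    by (simp add: GP)
  then show "has_second_deriv_at (\<lambda>t. enn2real (G a (\<lambda>x. \<phi> x + t * \<eta> x))) (2 * (LINT x|lebesgue. Q_integrand a \<phi> \<eta> x)) 0"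
    unfolding Q(2) using P.second_derivative by simp
  have S: "P.second_variation_density absolutely_integrable_on UNIV"
    using P.second_variation_density_integrable by (simp add: absolutely_integrable_UNIV_iff)
  have V: "(\<lambda>x. (v x)\<^sup>2) absolutely_integrable_on UNIV" using v2 by (simp add: absolutely_integrable_UNIV_iff)
  have mono': "a x \<le> a t" if "0 < x" "x \<le> t" for x t using mono that by (auto simp: mono_on_def)
  note S' = integral_UNIV_split[OF S] and V' = integral_UNIV_split[OF V]
  have 1: "0 \<le> integral {0..} P.second_variation_density"
    using R.half_stability[OF mono' has_AC_deriv_subset[OF v(1)]] S'(1) V'(1)
    unfolding P.second_variation_density_def[abs_def] by blast
  have 2: "0 \<le> integral {..0} P.second_variation_density"
  proof -
    let ?S = "\<lambda>x. a (- x) * (p (- x))\<^sup>2 - a (- x) * cos (2 * - \<phi> (- x)) * (- v (- x))\<^sup>2"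
    have eq: "?S = (\<lambda>x. P.second_variation_density (- x))"
      by (auto simp: P.second_variation_density_def)
    have "0 \<le> integral {0..} ?S"
    proof (rule L.half_stability)
      show "has_AC_deriv (\<lambda>x. - v (- x)) (\<lambda>x. p (- x)) {0..}"
        by (rule has_AC_deriv_reflect_right[OF has_AC_deriv_subset[OF v(1)]]) simp
      show "?S absolutely_integrable_on {0..}" unfolding eq half_line_reflect(1) by (rule S'(2))
      show "(\<lambda>x. (- v (- x))\<^sup>2) absolutely_integrable_on {0..}"
        using half_line_reflect(1)[of "\<lambda>x. (v x)\<^sup>2"] V'(2) by simp
    qed (use mono' even in auto)
    then show ?thesis unfolding eq using half_line_reflect(2)[OF S'(2)] by simp
  qed
  have "(LINT x|lebesgue. P.second_variation_density x) = integral UNIV P.second_variation_density"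
    using integral_lebesgue[OF P.second_variation_density_integrable] by simp
  then show "0 \<le> (LINT x|lebesgue. Q_integrand a \<phi> \<eta> x)"
    unfolding Q(2) using 1 2 S'(3) by simp
qed

end

section \<open>Invariance under changes of the coefficient and of the flux on null sets\<close>

lemma solves_in_AE_cong:
  assumes "AE x in lebesgue. a x = b x"
  shows "solves_in a U \<phi> \<longleftrightarrow> solves_in b U \<phi>"
proof -
  have "(LINT x:U|lebesgue. a x * weak_deriv \<phi> x * deriv \<psi> x) = (LINT x:U|lebesgue. b x * weak_deriv \<phi> x * deriv \<psi> x)"
    "(LINT x:U|lebesgue. a x * sin (\<phi> x) * cos (\<phi> x) * \<psi> x) = (LINT x:U|lebesgue. b x * sin (\<phi> x) * cos (\<phi> x) * \<psi> x)" for \<psi>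
    unfolding set_lebesgue_integral_def
    by (rule integrable_AE_cong(2); use assms in eventually_elim; simp)+
  then show ?thesis by (simp add: solves_in_def)
qed

lemma G_AE_cong:
  assumes "AE x in lebesgue. a x = b x"
  shows "G a = G b"
proof
  fix \<phi>
  show "G a \<phi> = G b \<phi>"
    unfolding G_def by (rule nn_integral_cong_AE) (use assms in eventually_elim, simp)
qed

lemma wall_solution_AE_cong:
  assumes "AE x in lebesgue. a x = b x"
  shows "wall_solution a = wall_solution b"
  using solves_in_AE_cong[OF assms] by (auto simp: wall_solution_def fun_eq_iff)

lemma Q_integrand_AE_cong:
  assumes "AE x in lebesgue. a x = b x"
  shows "integrable lebesgue (Q_integrand a \<phi> \<eta>) \<longleftrightarrow> integrable lebesgue (Q_integrand b \<phi> \<eta>)"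
    "(LINT x|lebesgue. Q_integrand a \<phi> \<eta> x) = (LINT x|lebesgue. Q_integrand b \<phi> \<eta> x)"
  by (rule integrable_AE_cong; use assms in eventually_elim; simp add: Q_integrand_def)+

lemma W1_infinity_AE_cong:
  assumes u: "u \<in> W1_infinity U" and eq: "AE x in lebesgue. u x = v x"
  shows "v \<in> W1_infinity U"
proof -
  obtain g where g: "u \<in> L_infinity U" "g \<in> L_infinity U" "has_weak_deriv U u g"
    using u by (auto simp: W1_infinity_def)
  have "v \<in> L_infinity U"
    unfolding L_infinity_def mem_Collect_eq
  proof
    have "(\<lambda>x. indicator U x *\<^sub>R u x) \<in> borel_measurable lebesgue"
      using g(1) by (simp add: L_infinity_def set_borel_measurable_def)
    moreover have "AE x in lebesgue. indicator U x *\<^sub>R u x = indicator U x *\<^sub>R v x"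
      using eq by eventually_elim simp
    ultimately show "set_borel_measurable lebesgue U v"
      unfolding set_borel_measurable_def by (rule borel_measurable_AE)
    obtain C where "AE x in lebesgue. x \<in> U \<longrightarrow> \<bar>u x\<bar> \<le> C" using g(1) by (auto simp: L_infinity_def)
    with eq have "AE x in lebesgue. x \<in> U \<longrightarrow> \<bar>v x\<bar> \<le> C" by eventually_elim simp
    then show "\<exists>C. AE x in lebesgue. x \<in> U \<longrightarrow> \<bar>v x\<bar> \<le> C" by blast
  qed
  moreover have "has_weak_deriv U v g"
    unfolding has_weak_deriv_def
  proof (intro conjI ballI)
    show "v \<in> L1_loc U"
      unfolding L1_loc_def
    proof (intro CollectI allI impI)
      fix K assume "compact K \<and> K \<subseteq> U"
      then have "set_integrable lebesgue K u" using g(3) by (simp add: has_weak_deriv_def L1_loc_def)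
      then show "set_integrable lebesgue K v"
        by (rule absolutely_integrable_AE_cong) (use eq in eventually_elim, simp)
    qed
    show "g \<in> L1_loc U" using g(3) by (simp add: has_weak_deriv_def)
    fix \<psi> assume \<psi>: "\<psi> \<in> test_functions U"
    have "(LINT x:U|lebesgue. u x * deriv \<psi> x) = (LINT x:U|lebesgue. v x * deriv \<psi> x)"
      unfolding set_lebesgue_integral_def
      by (rule integrable_AE_cong(2)) (use eq in eventually_elim, simp)
    then show "(LINT x:U|lebesgue. v x * deriv \<psi> x) = - (LINT x:U|lebesgue. g x * \<psi> x)"
      using g(3) \<psi> by (simp add: has_weak_deriv_def)
  qed
  ultimately show ?thesis using g(2) by (auto simp: W1_infinity_def)
qed

theorem theorem2:
  fixes a :: "real \<Rightarrow> real" and a0 A0 :: real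
  assumes "a \<in> borel_measurable lebesgue"
    and "0 < a0" and "a0 \<le> A0"
    and "AE x in lebesgue. a0 \<le> a x \<and> a x \<le> A0"
  shows "(\<exists>!\<phi>. wall_solution a \<phi>) \<and>
    (\<forall>\<phi>. wall_solution a \<phi> \<longrightarrow>
       (\<exists>L. L-lipschitz_on UNIV \<phi>) \<and>
       strict_mono \<phi> \<and>
       (\<lambda>x. a x * weak_deriv \<phi> x) \<in> W1_infinity (- {0}) \<and>
       (\<exists>w. continuous_on (- {0}) w \<and>
            (AE x in lebesgue. w x = a x * weak_deriv \<phi> x) \<and>
            (\<forall>x. x \<noteq> 0 \<longrightarrow> 0 < w x)) \<and>
       is_arg_min (G a) competitor \<phi> \<and>
       (\<forall>\<psi>. is_arg_min (G a) competitor \<psi> \<longrightarrow> \<psi> = \<phi>) \<and>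
       ((\<forall>x. a (- x) = a x) \<and> mono_on {0<..} a \<longrightarrow>
          (\<forall>x. \<phi> (- x) = - \<phi> x) \<and>
          solves_in a UNIV \<phi> \<and>
          (\<forall>\<eta>\<in>H1.
             (\<forall>\<^sub>F t in nhds 0. G a (\<lambda>x. \<phi> x + t * \<eta> x) < \<infinity>) \<and>
             integrable lebesgue (Q_integrand a \<phi> \<eta>) \<and>
             has_second_deriv_at (\<lambda>t. enn2real (G a (\<lambda>x. \<phi> x + t * \<eta> x)))
               (2 * (LINT x|lebesgue. Q_integrand a \<phi> \<eta> x)) 0 \<and>
             0 \<le> (LINT x|lebesgue. Q_integrand a \<phi> \<eta> x))))"
proof -
  \<comment> \<open>Clamping makes the bounds valid everywhere, changes \<open>a\<close> on a null
    set only, and preserves measurability, evenness and monotonicity.\<close>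
  define b where "b x = max a0 (min A0 (a x))" for x
  have ab: "AE x in lebesgue. a x = b x" using assms(4) by eventually_elim (simp add: b_def)
  interpret wall_coefficient b a0 A0
  proof
    show "b \<in> borel_measurable lebesgue"
      unfolding b_def[abs_def] by (intro borel_measurable_max borel_measurable_min assms(1)) simp_all
  qed (use assms in \<open>auto simp: b_def\<close>)
  note eqs = G_AE_cong[OF ab] wall_solution_AE_cong[OF ab] solves_in_AE_cong[OF ab] Q_integrand_AE_cong[OF ab]
  have "\<exists>!\<phi>. wall_solution b \<phi>" using wall_solution_exists wall_solution_unique by blast
  moreover have "(\<exists>L. L-lipschitz_on UNIV \<phi>) \<and> strict_mono \<phi> \<and>
       (\<lambda>x. a x * weak_deriv \<phi> x) \<in> W1_infinity (- {0}) \<and>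
       (\<exists>w. continuous_on (- {0}) w \<and>
            (AE x in lebesgue. w x = a x * weak_deriv \<phi> x) \<and> (\<forall>x. x \<noteq> 0 \<longrightarrow> 0 < w x)) \<and>
       is_arg_min (G b) competitor \<phi> \<and>
       (\<forall>\<psi>. is_arg_min (G b) competitor \<psi> \<longrightarrow> \<psi> = \<phi>) \<and>
       ((\<forall>x. a (- x) = a x) \<and> mono_on {0<..} a \<longrightarrow>
          (\<forall>x. \<phi> (- x) = - \<phi> x) \<and> solves_in b UNIV \<phi> \<and>
          (\<forall>\<eta>\<in>H1.
             (\<forall>\<^sub>F t in nhds 0. G b (\<lambda>x. \<phi> x + t * \<eta> x) < \<infinity>) \<and>
             integrable lebesgue (Q_integrand b \<phi> \<eta>) \<and>
             has_second_deriv_at (\<lambda>t. enn2real (G b (\<lambda>x. \<phi> x + t * \<eta> x)))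
               (2 * (LINT x|lebesgue. Q_integrand b \<phi> \<eta> x)) 0 \<and>
             0 \<le> (LINT x|lebesgue. Q_integrand b \<phi> \<eta> x)))"
    if sol: "wall_solution b \<phi>" for \<phi>
  proof -
    obtain yr yl where "wall_pair b a0 A0 \<phi> yr yl" using wall_solution_imp_pair[OF sol] by blast
    then interpret W: wall_pair b a0 A0 \<phi> yr yl .
    have "AE x in lebesgue. b x * weak_deriv \<phi> x = a x * weak_deriv \<phi> x" using ab by eventually_elim simp
    then have 1: "(\<lambda>x. a x * weak_deriv \<phi> x) \<in> W1_infinity (- {0})"
      by (rule W1_infinity_AE_cong[OF W.flux_W1_infinity])
    have "AE x in lebesgue. W.flux x = a x * weak_deriv \<phi> x"
      using W.flux_AE ab by eventually_elim simp
    then have 2: "\<exists>w. continuous_on (- {0}) w \<and>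
        (AE x in lebesgue. w x = a x * weak_deriv \<phi> x) \<and> (\<forall>x. x \<noteq> 0 \<longrightarrow> 0 < w x)"
      using W.flux_continuous W.flux_pos by blast
    have 3: "(\<forall>x. \<phi> (- x) = - \<phi> x) \<and> solves_in b UNIV \<phi> \<and>
          (\<forall>\<eta>\<in>H1.
             (\<forall>\<^sub>F t in nhds 0. G b (\<lambda>x. \<phi> x + t * \<eta> x) < \<infinity>) \<and>
             integrable lebesgue (Q_integrand b \<phi> \<eta>) \<and>
             has_second_deriv_at (\<lambda>t. enn2real (G b (\<lambda>x. \<phi> x + t * \<eta> x)))
               (2 * (LINT x|lebesgue. Q_integrand b \<phi> \<eta> x)) 0 \<and>
             0 \<le> (LINT x|lebesgue. Q_integrand b \<phi> \<eta> x))"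
      if a: "(\<forall>x. a (- x) = a x) \<and> mono_on {0<..} a"
    proof -
      have even: "b (- x) = b x" for x using a by (simp add: b_def)
      have mono: "mono_on {0<..} b"
      proof (rule mono_onI)
        fix r s :: real assume "r \<in> {0<..}" "s \<in> {0<..}" "r \<le> s"
        then have "a r \<le> a s" using a by (auto simp: mono_on_def)
        then show "b r \<le> b s" unfolding b_def by (intro max.mono min.mono) simp_all
      qed
      show ?thesis
        using W.odd_if_even[OF even] W.solves[of UNIV] W.second_variation[OF even mono]
        by (simp add: always_eventually)
    qed
    show ?thesis
      using W.Lipschitz W.strictly_increasing 1 2 W.is_minimizer W.minimizer_unique 3 by blast
  qed
  ultimately show ?thesis unfolding eqs by blast
qed


end
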